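(* Let $r,q\in\mathbb{N}$ with $r\ge 2$ and $q\geq 2$. For $k\in\{r-1,r\}$ let $Y_k$ be the GIT quotient of $X(w_{k,kq+1})^{ss}_{T_{J_k}}(\mathcal{L}((kq+1)\omega_{k(k)}))$ by $T_{J_k}$ (defined in the context). Then there is a morphism $\phi_{r}:Y_{r}\longrightarrow Y_{r-1}$ which makes $Y_{r}$ a $\mathbb{P}^{r(q-1)}$-bundle over $Y_{r-1}$.
   Context: All varieties are over $\mathbb{C}$. For $k\ge 1$ put $n_k=kq+1$ and $G_k=PSL(n_k,\mathbb{C})$. Let $T_k\subset B_k\subset G_k$ be a maximal torus and a Borel subgroup (say, images of the diagonal and of the upper triangular matrices), with simple roots $\alpha_{1(k)},\dots,\alpha_{n_k-1(k)}$, simple reflections $s_{\alpha_{i(k)}}$, fundamental weights $\omega_{i(k)}$, and one-parameter subgroups $\lambda_{i(k)}$ of $T_k$ dual to the simple roots, i.e. $\langle\alpha_{i(k)},\lambda_{j(k)}\rangle=\delta_{i,j}$ (so $\lambda_{j(k)}(t)$ is the class of $\mathrm{diag}(t,\dots,t,1,\dots,1)$ with $j$ entries $t$). Let $Q_k$ be the standard maximal parabolic subgroup of $G_k$ corresponding to $\alpha_{k(k)}$, so $G_k/Q_k$ is the Grassmannian $G_{k,n_k}$. $\mathcal{L}(n_k\omega_{k(k)})$ is the line bundle on $G_{k,n_k}$ associated to the character $n_k\omega_{k(k)}$ of $T_k$, i.e. the restriction of $\mathcal{O}(n_k)$ for the Plücker embedding with its natural $G_k$-linearization. For $w$ a minimal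 length representative modulo the Weyl group of $Q_k$, $X(w)=\overline{B_kwQ_k/Q_k}$ is the Schubert variety. Set $$w_{k,n_k}=(s_{\alpha_{q(k)}}\cdots s_{\alpha_{1(k)}})(s_{\alpha_{2q(k)}}\cdots s_{\alpha_{2(k)}})\cdots(s_{\alpha_{kq(k)}}\cdots s_{\alpha_{k(k)}}),$$ in one-line notation $(q+1,2q+1,\dots,kq+1)$; $X(w_{k,n_k})$ is the unique minimal dimensional Schubert variety in $G_{k,n_k}$ admitting semistable points for the $T_k$-linearized bundle $\mathcal{L}(n_k\omega_{k(k)})$. Let $T_{J_k}\subseteq T_k$ be the subtorus generated by $\lambda_{jq(k)}(\mathbb{G}_m)$, $1\le j\le k$. For a reductive group $H$ acting on a projective variety $X$ with $H$-linearized ample line bundle $\mathcal{L}$, $X^{ss}_H(\mathcal{L})$ is the set of $x\in X$ for which some $s\in H^0(X,\mathcal{L}^{\otimes m})^H$, $m\geq 1$, satisfies $s(x)\ne0$. The GIT quotient is the quotient of $X^{ss}_H(\mathcal{L})$ by $H$. $Y_k:=T_{J_k}\backslash\backslash X(w_{k,n_k})^{ss}_{T_{J_k}}(\mathcal{L}(n_k\omega_{k(k)}))$. A $\mathbb{P}^m$-bundle over $Z$ is a morphism $\phi:Y\to Z$ with an open cover $\{U_i\}$ of $Z$ and isomorphisms $h_i:\phi^{-1}(U_i)\to U_i\times\mathbb{P}^m$ over $U_i$ such that over every affine open $\mathrm{Spec}\,A\subseteq U_i\cap U_j$ the automorphism $h_i\circ h_j^{-1}$ of $\mathrm{Spec}\,A\times\mathbb{P}^m$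 is induced by an $A$-linear automorphism of $A[x_0,\dots,x_m]$. *)

theory Defs
  imports
    "HOL-Analysis.Function_Topology"
    "HOL-Algebra.Generated_Groups"
    "HOL-Combinatorics.Transposition"
    "Jordan_Normal_Form.Determinant"
    "Jordan_Normal_Form.DL_Submatrix"
begin

section \<open>Complex varieties as spaces with functions\<close>

text \<open>
  A variety is the set of its closed points, with its Zariski topology and, for each open set,
  the regular complex-valued functions on it. \<open>reg X U f\<close> says that \<open>U\<close> is open and that the
  restriction of the total function \<open>f\<close> to \<open>U\<close> is regular.
\<close>

record 'a fspace =
  ztop :: "'a topology"
  reg :: "'a set \<Rightarrow> ('a \<Rightarrow> complex) \<Rightarrow> bool"

abbreviation points :: "'a fspace \<Rightarrow> 'a set" where
  "points X \<equiv> topspace (ztop X)"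

definition space_with_functions :: "'a fspace \<Rightarrow> bool" where
  "space_with_functions X \<longleftrightarrow>
     (\<forall>U f. reg X U f \<longrightarrow> openin (ztop X) U) \<and>
     (\<forall>U c. openin (ztop X) U \<longrightarrow> reg X U (\<lambda>_. c)) \<and>
     (\<forall>U f g. reg X U f \<longrightarrow> reg X U g \<longrightarrow>
        reg X U (\<lambda>x. f x + g x) \<and> reg X U (\<lambda>x. f x * g x)) \<and>
     (\<forall>U f. reg X U f \<longrightarrow>
        openin (ztop X) {x \<in> U. f x \<noteq> 0} \<and> reg X {x \<in> U. f x \<noteq> 0} (\<lambda>x. inverse (f x))) \<and>
     (\<forall>U V f g. reg X U f \<longrightarrow> openin (ztop X) V \<longrightarrow> V \<subseteq> U \<longrightarrow> (\<forall>x\<in>V. g x = f x) \<longrightarrow> reg X V g) \<and>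
     (\<forall>U f. openin (ztop X) U \<longrightarrow> (\<forall>x\<in>U. \<exists>V\<subseteq>U. x \<in> V \<and> reg X V f) \<longrightarrow> reg X U f)"

text \<open>
  The space with functions generated by a set \<open>B\<close> of pairs \<open>(D, f)\<close>: the sets \<open>D\<close> generate the
  topology, and the regular functions are those which locally agree with some \<open>f\<close>.
\<close>

definition fspace_from :: "('a set \<times> ('a \<Rightarrow> complex)) set \<Rightarrow> 'a fspace" where
  "fspace_from B = (let T = topology_generated_by (fst ` B) in
     \<lparr>ztop = T,
      reg = (\<lambda>U f. openin T U \<and>
        (\<forall>x\<in>U. \<exists>W D g. openin T W \<and> x \<in> W \<and> W \<subseteq> U \<and> (D, g) \<in> B \<and> W \<subseteq> D \<and> (\<forall>y\<in>W. f y = g y)))\<rparr>)"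

definition subspace :: "'a fspace \<Rightarrow> 'a set \<Rightarrow> 'a fspace" where
  "subspace X S = fspace_from {(U \<inter> S, f) | U f. reg X U f}"

text \<open>
  The categorical product. Its topology is in general finer than the product topology: the basic
  open sets are the nonvanishing loci, on rectangles, of the functions \<open>\<Sum>i. f i x * g i y\<close>.
\<close>

definition tensor_fun :: "'a fspace \<Rightarrow> 'b fspace \<Rightarrow> 'a set \<Rightarrow> 'b set \<Rightarrow> ('a \<times> 'b \<Rightarrow> complex) \<Rightarrow> bool" where
  "tensor_fun X Y U V F \<longleftrightarrow>
     (\<exists>(N::nat) f g. (\<forall>i<N. reg X U (f i) \<and> reg Y V (g i)) \<and>
        (\<forall>x\<in>U. \<forall>y\<in>V. F (x, y) = (\<Sum>i<N. f i x * g i y)))"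

definition prod_space :: "'a fspace \<Rightarrow> 'b fspace \<Rightarrow> ('a \<times> 'b) fspace" where
  "prod_space X Y = fspace_from
     {({p \<in> U \<times> V. G p \<noteq> 0}, \<lambda>p. F p / G p) | U V F G.
        openin (ztop X) U \<and> openin (ztop Y) V \<and> tensor_fun X Y U V F \<and> tensor_fun X Y U V G}"

definition morphism :: "'a fspace \<Rightarrow> 'b fspace \<Rightarrow> ('a \<Rightarrow> 'b) \<Rightarrow> bool" where
  "morphism X Y f \<longleftrightarrow> continuous_map (ztop X) (ztop Y) f \<and>
     (\<forall>V g. reg Y V g \<longrightarrow> reg X {x \<in> points X. f x \<in> V} (g \<circ> f))"

definition isomorphism :: "'a fspace \<Rightarrow> 'b fspace \<Rightarrow> ('a \<Rightarrow> 'b) \<Rightarrow> bool" where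
  "isomorphism X Y f \<longleftrightarrow> morphism X Y f \<and>
     (\<exists>g. morphism Y X g \<and> (\<forall>x\<in>points X. g (f x) = x) \<and> (\<forall>y\<in>points Y. f (g y) = y))"


subsection \<open>Affine and projective space\<close>

text \<open>
  Coordinates are indexed by a finite set \<open>I\<close>; vectors are functions vanishing outside \<open>I\<close>.
  Since the ground field is infinite, polynomials are identified with polynomial functions.
\<close>

definition vectors :: "'i set \<Rightarrow> ('i \<Rightarrow> complex) set" where
  "vectors I = {v. \<forall>i. i \<notin> I \<longrightarrow> v i = 0}"

inductive polyfun :: "'i set \<Rightarrow> (('i \<Rightarrow> complex) \<Rightarrow> complex) \<Rightarrow> bool" for I where
  const: "polyfun I (\<lambda>_. c)"
| coord: "i \<in> I \<Longrightarrow> polyfun I (\<lambda>v. v i)"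
| add: "polyfun I F \<Longrightarrow> polyfun I G \<Longrightarrow> polyfun I (\<lambda>v. F v + G v)"
| mult: "polyfun I F \<Longrightarrow> polyfun I G \<Longrightarrow> polyfun I (\<lambda>v. F v * G v)"

inductive homfun :: "'i set \<Rightarrow> nat \<Rightarrow> (('i \<Rightarrow> complex) \<Rightarrow> complex) \<Rightarrow> bool" for I where
  zero: "homfun I d (\<lambda>_. 0)"
| const: "homfun I 0 (\<lambda>_. c)"
| coord: "i \<in> I \<Longrightarrow> homfun I 1 (\<lambda>v. v i)"
| add: "homfun I d F \<Longrightarrow> homfun I d G \<Longrightarrow> homfun I d (\<lambda>v. F v + G v)"
| mult: "homfun I d F \<Longrightarrow> homfun I e G \<Longrightarrow> homfun I (d + e) (\<lambda>v. F v * G v)"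

definition affine_space :: "'i set \<Rightarrow> ('i \<Rightarrow> complex) fspace" where
  "affine_space I = fspace_from
     {({v \<in> vectors I. G v \<noteq> 0}, \<lambda>v. F v / G v) | F G. polyfun I F \<and> polyfun I G}"

text \<open>
  A point of projective space is a punctured line through the origin, so that \<open>v \<in> x\<close> says that
  \<open>v\<close> is a vector of homogeneous coordinates of \<open>x\<close>, and \<open>\<Union>X\<close> is the punctured affine cone over
  a set \<open>X\<close> of points.
\<close>

definition line :: "('i \<Rightarrow> complex) \<Rightarrow> ('i \<Rightarrow> complex) set" where
  "line v = {(\<lambda>i. c * v i) | c. c \<noteq> 0}"

definition proj_points :: "'i set \<Rightarrow> ('i \<Rightarrow> complex) set set" where
  "proj_points I = line ` (vectors I - {\<lambda>_. 0})"

definition proj_space :: "'i set \<Rightarrow> ('i \<Rightarrow> complex) set fspace" where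
  "proj_space I = fspace_from
     {({x \<in> proj_points I. \<forall>v\<in>x. G v \<noteq> 0}, f) | F G d f.
        homfun I d F \<and> homfun I d G \<and>
        (\<forall>x\<in>proj_points I. \<forall>v\<in>x. G v \<noteq> 0 \<longrightarrow> f x = F v / G v)}"

definition affine_variety :: "'a fspace \<Rightarrow> bool" where
  "affine_variety X \<longleftrightarrow> space_with_functions X \<and>
     (\<exists>(n::nat) Z f. closedin (ztop (affine_space {..<n})) Z \<and>
        isomorphism X (subspace (affine_space {..<n}) Z) f)"

definition affine_open :: "'a fspace \<Rightarrow> 'a set \<Rightarrow> bool" where
  "affine_open X U \<longleftrightarrow> openin (ztop X) U \<and> affine_variety (subspace X U)"

text \<open>Varieties are reduced and separated of finite type, but need not be irreducible.\<close>

definition variety :: "'a fspace \<Rightarrow> bool" where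
  "variety X \<longleftrightarrow> space_with_functions X \<and>
     (\<exists>\<U>. finite \<U> \<and> \<Union>\<U> = points X \<and> (\<forall>U\<in>\<U>. affine_open X U)) \<and>
     closedin (ztop (prod_space X X)) {(x, x) | x. x \<in> points X}"


subsection \<open>Projective bundles\<close>

text \<open>
  The transition condition: over an affine open \<open>V = Spec A\<close>, a linear automorphism of
  \<open>A[x_0, \<dots>, x_m]\<close> is given by an invertible matrix \<open>a\<close> over \<open>A\<close>, and induces the map
  \<open>(z, [v]) \<mapsto> (z, [a(z) v])\<close> of \<open>V \<times> P^m\<close>. This map has to be \<open>h \<circ> h'^{-1}\<close>.
\<close>

definition invertible_over :: "'b fspace \<Rightarrow> 'b set \<Rightarrow> nat \<Rightarrow> (nat \<Rightarrow> nat \<Rightarrow> 'b \<Rightarrow> complex) \<Rightarrow> bool" where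
  "invertible_over Z V m a \<longleftrightarrow> (\<forall>i\<le>m. \<forall>j\<le>m. reg Z V (a i j)) \<and>
     (\<exists>b. (\<forall>i\<le>m. \<forall>j\<le>m. reg Z V (b i j)) \<and>
        (\<forall>z\<in>V. \<forall>i\<le>m. \<forall>j\<le>m.
           (\<Sum>l\<le>m. a i l z * b l j z) = (if i = j then 1 else 0) \<and>
           (\<Sum>l\<le>m. b i l z * a l j z) = (if i = j then 1 else 0)))"

definition projective_bundle :: "nat \<Rightarrow> 'a fspace \<Rightarrow> 'b fspace \<Rightarrow> ('a \<Rightarrow> 'b) \<Rightarrow> bool" where
  "projective_bundle m Y Z \<phi> \<longleftrightarrow> morphism Y Z \<phi> \<and>
     (\<exists>\<T> :: ('b set \<times> ('a \<Rightarrow> 'b \<times> (nat \<Rightarrow> complex) set)) set.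
        (\<forall>(U, h)\<in>\<T>. openin (ztop Z) U \<and>
           isomorphism (subspace Y {y \<in> points Y. \<phi> y \<in> U})
             (prod_space (subspace Z U) (proj_space {..m})) h \<and>
           (\<forall>y\<in>points Y. \<phi> y \<in> U \<longrightarrow> fst (h y) = \<phi> y)) \<and>
        \<Union>(fst ` \<T>) = points Z \<and>
        (\<forall>(U, h)\<in>\<T>. \<forall>(U', h')\<in>\<T>. \<forall>V. affine_open Z V \<and> V \<subseteq> U \<inter> U' \<longrightarrow>
           (\<exists>a. invertible_over Z V m a \<and>
              (\<forall>y\<in>points Y. \<phi> y \<in> V \<longrightarrow>
                 (\<forall>v\<in>snd (h' y).
                    (\<lambda>i. if i \<le> m then \<Sum>j\<le>m. a i j (\<phi> y) * v j else 0) \<in> snd (h y))))))"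


section \<open>Geometric invariant theory\<close>

text \<open>
  A section over \<open>X \<subseteq> P(I)\<close> of the restriction of \<open>O(d)\<close> is a function on the punctured cone
  over \<open>X\<close> which is locally a quotient of homogeneous polynomials whose degrees differ by \<open>d\<close>.
\<close>

definition section_of :: "'i set \<Rightarrow> ('i \<Rightarrow> complex) set set \<Rightarrow> nat \<Rightarrow> (('i \<Rightarrow> complex) \<Rightarrow> complex) \<Rightarrow> bool" where
  "section_of I X d s \<longleftrightarrow>
     (\<forall>x\<in>X. \<exists>U e F G. openin (ztop (proj_space I)) U \<and> x \<in> U \<and>
        homfun I (d + e) F \<and> homfun I e G \<and>
        (\<forall>v\<in>\<Union>(U \<inter> X). G v \<noteq> 0 \<and> s v = F v / G v))"

text \<open>
  Semistable points for \<open>O(N)\<close> restricted to \<open>X\<close>. The linearization is given by the set \<open>A\<close> of all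
  linear maps of the cone which lift elements of the acting group; different lifts of the same
  element are supposed to differ by \<open>N\<close>-th roots of unity, and so to agree on \<open>O(N)\<close>.
\<close>

definition semistable :: "'i set \<Rightarrow> ('i \<Rightarrow> complex) set set \<Rightarrow> nat \<Rightarrow>
    (('i \<Rightarrow> complex) \<Rightarrow> ('i \<Rightarrow> complex)) set \<Rightarrow> ('i \<Rightarrow> complex) set set" where
  "semistable I X N A = {x \<in> X. \<exists>m\<ge>1. \<exists>s. section_of I X (N * m) s \<and>
     (\<forall>a\<in>A. \<forall>v\<in>\<Union>X. s (a v) = s v) \<and> (\<forall>v\<in>x. s v \<noteq> 0)}"

definition invariant_set :: "'g set \<Rightarrow> ('g \<Rightarrow> 'a \<Rightarrow> 'a) \<Rightarrow> 'a set \<Rightarrow> bool" where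
  "invariant_set H act W \<longleftrightarrow> (\<forall>h\<in>H. \<forall>x\<in>W. act h x \<in> W)"

text \<open>
  Seshadri's good quotients. This is the sense in which the semistable locus has a quotient; a
  good quotient is a categorical quotient, and so is determined up to unique isomorphism.
\<close>

definition good_quotient :: "'g set \<Rightarrow> ('g \<Rightarrow> 'a \<Rightarrow> 'a) \<Rightarrow> 'a fspace \<Rightarrow> 'b fspace \<Rightarrow> ('a \<Rightarrow> 'b) \<Rightarrow> bool" where
  "good_quotient H act X Y \<pi> \<longleftrightarrow> variety Y \<and> morphism X Y \<pi> \<and> \<pi> ` points X = points Y \<and>
     (\<forall>h\<in>H. \<forall>x\<in>points X. \<pi> (act h x) = \<pi> x) \<and>
     (\<forall>V. affine_open Y V \<longrightarrow> affine_open X {x \<in> points X. \<pi> x \<in> V}) \<and>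
     (\<forall>V F. openin (ztop Y) V \<longrightarrow>
        (reg X {x \<in> points X. \<pi> x \<in> V} F \<and>
           (\<forall>h\<in>H. \<forall>x\<in>points X. \<pi> x \<in> V \<longrightarrow> F (act h x) = F x)) =
        (\<exists>f. reg Y V f \<and> (\<forall>x\<in>points X. \<pi> x \<in> V \<longrightarrow> F x = f (\<pi> x)))) \<and>
     (\<forall>W. closedin (ztop X) W \<and> invariant_set H act W \<longrightarrow> closedin (ztop Y) (\<pi> ` W)) \<and>
     (\<forall>W W'. closedin (ztop X) W \<and> invariant_set H act W \<and>
        closedin (ztop X) W' \<and> invariant_set H act W' \<and> W \<inter> W' = {} \<longrightarrow> \<pi> ` W \<inter> \<pi> ` W' = {})"


section \<open>Schubert varieties in the Grassmannian\<close>

text \<open>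
  Indices are 0-based: the \<open>i\<close>-th standard basis vector of \<open>C^n\<close> (\<open>1 \<le> i \<le> n\<close>) has index \<open>i - 1\<close>.
\<close>

definition SL :: "nat \<Rightarrow> complex mat monoid" where
  "SL n = \<lparr>carrier = {g \<in> carrier_mat n n. det g = 1}, monoid.mult = (*), one = 1\<^sub>m n\<rparr>"

definition SL_center :: "nat \<Rightarrow> complex mat set" where
  "SL_center n = {g \<in> carrier (SL n). \<exists>c. g = c \<cdot>\<^sub>m 1\<^sub>m n}"

definition PSL :: "nat \<Rightarrow> complex mat set monoid" where
  "PSL n = SL n Mod SL_center n"

definition borel :: "nat \<Rightarrow> complex mat set set" where
  "borel n = {C \<in> carrier (PSL n). \<exists>g\<in>C. upper_triangular g}"

text \<open>The elements of the normalizer of the diagonal torus which represent the permutation \<open>w\<close>.\<close>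

definition weyl_rep :: "nat \<Rightarrow> (nat \<Rightarrow> nat) \<Rightarrow> complex mat set set" where
  "weyl_rep n w = {C \<in> carrier (PSL n). \<exists>g\<in>C. \<forall>i<n. \<forall>j<n. g $$ (i, j) \<noteq> 0 \<longrightarrow> i = w j}"

text \<open>
  The class in \<open>PSL n\<close> of \<open>diag(t, \<dots>, t, 1, \<dots>, 1)\<close> with \<open>j\<close> entries \<open>t\<close>: all its scalar
  multiples of determinant \<open>1\<close>.
\<close>

definition one_ps :: "nat \<Rightarrow> nat \<Rightarrow> complex \<Rightarrow> complex mat set" where
  "one_ps n j t = {g \<in> carrier (SL n).
     \<exists>c. g = c \<cdot>\<^sub>m mat n n (\<lambda>(a, b). if a = b then (if a < j then t else 1) else 0)}"

definition plucker_index :: "nat \<Rightarrow> nat \<Rightarrow> nat set set" where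
  "plucker_index n k = {S. S \<subseteq> {..<n} \<and> card S = k}"

text \<open>The action of a matrix on the \<open>k\<close>-th exterior power of \<open>C^n\<close>.\<close>

definition ext_pow :: "nat \<Rightarrow> nat \<Rightarrow> complex mat \<Rightarrow> (nat set \<Rightarrow> complex) \<Rightarrow> (nat set \<Rightarrow> complex)" where
  "ext_pow n k g v = (\<lambda>S. if S \<in> plucker_index n k
     then \<Sum>R\<in>plucker_index n k. det (submatrix g S R) * v R else 0)"

text \<open>
  The action of \<open>PSL n\<close> on the points of the projective space of the exterior power: the matrices
  in a class \<open>C\<close> differ by scalars, so that the right-hand side is again a punctured line.
\<close>

definition psl_act :: "nat \<Rightarrow> nat \<Rightarrow> complex mat set \<Rightarrow> (nat set \<Rightarrow> complex) set \<Rightarrow> (nat set \<Rightarrow> complex) set" where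
  "psl_act n k C x = {ext_pow n k g v | g v. g \<in> C \<and> v \<in> x}"

text \<open>The coset of the identity in \<open>G/Q\<close>: the span of the first \<open>k\<close> standard basis vectors.\<close>

definition base_point :: "nat \<Rightarrow> (nat set \<Rightarrow> complex) set" where
  "base_point k = line (\<lambda>S. if S = {..<k} then 1 else 0)"

definition grassmannian :: "nat \<Rightarrow> nat \<Rightarrow> (nat set \<Rightarrow> complex) set set" where
  "grassmannian n k = {psl_act n k C (base_point k) | C. C \<in> carrier (PSL n)}"

definition schubert :: "nat \<Rightarrow> nat \<Rightarrow> (nat \<Rightarrow> nat) \<Rightarrow> (nat set \<Rightarrow> complex) set set" where
  "schubert n k w =
     ztop (subspace (proj_space (plucker_index n k)) (grassmannian n k)) closure_of
       {psl_act n k b (psl_act n k c (base_point k)) | b c. b \<in> borel n \<and> c \<in> weyl_rep n w}"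

definition simple_reflection :: "nat \<Rightarrow> nat \<Rightarrow> nat" where
  "simple_reflection i = Transposition.transpose (i - 1) i"

definition comp_list :: "('a \<Rightarrow> 'a) list \<Rightarrow> 'a \<Rightarrow> 'a" where
  "comp_list fs = foldr (\<circ>) fs id"

text \<open>The product of the blocks \<open>s_{jq} \<dots> s_j\<close>, for \<open>j = 1, \<dots>, k\<close> from left to right.\<close>

definition minimal_w :: "nat \<Rightarrow> nat \<Rightarrow> nat \<Rightarrow> nat" where
  "minimal_w q k = comp_list
     (map (\<lambda>j. comp_list (map simple_reflection (rev [j..<j * q + 1]))) [1..<k + 1])"


section \<open>The varieties \<open>Y_k\<close>\<close>

definition T_J :: "nat \<Rightarrow> nat \<Rightarrow> complex mat set set" where
  "T_J q k = generate (PSL (k * q + 1)) {one_ps (k * q + 1) (j * q) t | j t. 1 \<le> j \<and> j \<le> k \<and> t \<noteq> 0}"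

definition X_ss :: "nat \<Rightarrow> nat \<Rightarrow> (nat set \<Rightarrow> complex) set set" where
  "X_ss q k = (let n = k * q + 1 in
     semistable (plucker_index n k) (schubert n k (minimal_w q k)) n (ext_pow n k ` \<Union>(T_J q k)))"

text \<open>\<open>Y\<close> is a GIT quotient of the semistable locus by \<open>T_J\<close>, with some quotient map.\<close>

definition is_Y :: "nat \<Rightarrow> nat \<Rightarrow> 'a fspace \<Rightarrow> bool" where
  "is_Y q k Y \<longleftrightarrow> (\<exists>\<pi>. good_quotient (T_J q k) (psl_act (k * q + 1) k)
     (subspace (proj_space (plucker_index (k * q + 1) k)) (X_ss q k)) Y \<pi>)"

end

(*
  By the Hilbert-Mumford inequality for one-parameter subgroups scaling a union of blocks, a
  semistable point of X(w) lies in the open cell, hence has a unique echelon matrix with k columns;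
  the j-th column has its pivot in the first row of block j + 1 and its other entries x_j in the
  earlier blocks. Semistability amounts to x_j being nonzero for every j; for the converse, exchanging
  pivots along a path of nonzero entries yields an explicit monomial invariant. So the semistable
  locus is a product of punctured affine spaces, on which the torus acts with x_{j,i} of weight
  u_{block i} / u_{j+1}. Orbits are closed, hence are the fibres of the quotient map, and forgetting
  the last column, on which the last torus factor acts by scalars, is the projective bundle.
*)
theory Submission
  imports Defs
begin

section \<open>Spaces with functions\<close>

text \<open>Rows are grouped into blocks by \<open>i div q\<close>: blocks 0 to k - 1 have q rows,
  block k is the single row k * q, and the torus consists of the classes of diagonal matrices that
  are constant on blocks. The obstacle to the bundle is that only the last torus factor scales the
  last column uniformly; the other factors move its entries by different weights. The entries are
  therefore multiplied by monomials in the earlier columns (\<open>weight_fun\<close>) which make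
  all weights equal. A monomial is usable only where a chosen entry of every earlier column is
  nonzero; the choices index the charts, and the quotients of the monomials for two choices are the
  diagonal entries of the transition matrix. \<open>Y\<close> is known only through the axioms of a
  good quotient, so every function or map on it comes by descent from the semistable locus. Limits
  over the complex numbers serve both for the closure of the Schubert cell and for the contraction
  by one-parameter subgroups. The fibre dimension is a count: column r - 1 has r * q rows above its
  pivot, r - 1 of them are pivot rows, and r * (q - 1) + 1 free entries remain.\<close>

lemma fspace_from_ztop: "ztop (fspace_from B) = topology_generated_by (fst ` B)"
  by (simp add: fspace_from_def Let_def)

lemma reg_fspace_from:
  "reg (fspace_from B) U f \<longleftrightarrow> openin (ztop (fspace_from B)) U \<and>
     (\<forall>x\<in>U. \<exists>W D g. openin (ztop (fspace_from B)) W \<and> x \<in> W \<and> W \<subseteq> U \<and> (D, g) \<in> B \<and> W \<subseteq> D \<and>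
        (\<forall>y\<in>W. f y = g y))"
  by (simp add: fspace_from_def Let_def)

lemma points_fspace_from: "points (fspace_from B) = \<Union>(fst ` B)"
  by (simp add: fspace_from_ztop topology_generated_by_topspace)

lemma openin_fspace_from: "(D, g) \<in> B \<Longrightarrow> openin (ztop (fspace_from B)) D"
  unfolding fspace_from_ztop by (rule topology_generated_by_Basis) force

lemma reg_fspace_fromI: "(D, g) \<in> B \<Longrightarrow> reg (fspace_from B) D g"
  unfolding reg_fspace_from using openin_fspace_from by blast

section \<open>Rules for regular functions\<close>

context
  fixes X :: "'a fspace"
  assumes swf: "space_with_functions X"
begin

lemmas swf_axioms = swf[unfolded space_with_functions_def]

lemmas sheaf_axioms = swf_axioms[THEN conjunct2, THEN conjunct2]

lemma reg_openin: "reg X U f \<Longrightarrow> openin (ztop X) U"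
  using swf_axioms[THEN conjunct1] by (elim allE impE)

lemma reg_const: "openin (ztop X) U \<Longrightarrow> reg X U (\<lambda>_. c)"
  using swf_axioms[THEN conjunct2, THEN conjunct1] by (elim allE impE)

lemma reg_add: "reg X U f \<Longrightarrow> reg X U g \<Longrightarrow> reg X U (\<lambda>x. f x + g x)"
  and reg_mult: "reg X U f \<Longrightarrow> reg X U g \<Longrightarrow> reg X U (\<lambda>x. f x * g x)"
  using sheaf_axioms[THEN conjunct1, rule_format, of U f g] by simp_all

lemma openin_nonzero: "reg X U f \<Longrightarrow> openin (ztop X) {x \<in> U. f x \<noteq> 0}"
  and reg_inverse_nonzero: "reg X U f \<Longrightarrow> reg X {x \<in> U. f x \<noteq> 0} (\<lambda>x. inverse (f x))"
  using sheaf_axioms[THEN conjunct2, THEN conjunct1, rule_format, of U f] by simp_all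

lemma reg_restrict:
  "reg X U f \<Longrightarrow> openin (ztop X) V \<Longrightarrow> V \<subseteq> U \<Longrightarrow> (\<And>x. x \<in> V \<Longrightarrow> g x = f x) \<Longrightarrow> reg X V g"
  using sheaf_axioms[THEN conjunct2, THEN conjunct2, THEN conjunct1, rule_format, of U f V g] .

lemma reg_local:
  "openin (ztop X) U \<Longrightarrow> (\<And>x. x \<in> U \<Longrightarrow> \<exists>V\<subseteq>U. x \<in> V \<and> reg X V f) \<Longrightarrow> reg X U f"
  using sheaf_axioms[THEN conjunct2, THEN conjunct2, THEN conjunct2, rule_format, of U f] .

lemma reg_subset: "reg X U f \<Longrightarrow> openin (ztop X) V \<Longrightarrow> V \<subseteq> U \<Longrightarrow> reg X V f"
  by (rule reg_restrict) auto

lemma reg_cong: "reg X U f \<Longrightarrow> (\<And>x. x \<in> U \<Longrightarrow> g x = f x) \<Longrightarrow> reg X U g"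
  by (rule reg_restrict) (auto dest: reg_openin)

lemma reg_inverse: "reg X U f \<Longrightarrow> (\<And>x. x \<in> U \<Longrightarrow> f x \<noteq> 0) \<Longrightarrow> reg X U (\<lambda>x. inverse (f x))"
  using reg_inverse_nonzero[of U f] by (subgoal_tac "{x \<in> U. f x \<noteq> 0} = U") auto

lemma reg_divide:
  "reg X U f \<Longrightarrow> reg X U g \<Longrightarrow> (\<And>x. x \<in> U \<Longrightarrow> g x \<noteq> 0) \<Longrightarrow> reg X U (\<lambda>x. f x / g x)"
  unfolding divide_inverse by (intro reg_mult reg_inverse)

lemma reg_uminus: "reg X U f \<Longrightarrow> reg X U (\<lambda>x. - f x)"
  using reg_mult[OF reg_const[of U "-1"], of f] by (simp add: reg_openin)

lemma reg_diff: "reg X U f \<Longrightarrow> reg X U g \<Longrightarrow> reg X U (\<lambda>x. f x - g x)"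
  using reg_add[of U f "\<lambda>x. - g x"] reg_uminus[of U g] by simp

lemma reg_sum:
  "openin (ztop X) U \<Longrightarrow> (\<And>i. i \<in> I \<Longrightarrow> reg X U (f i)) \<Longrightarrow> reg X U (\<lambda>x. \<Sum>i\<in>I. f i x)"
  by (induction I rule: infinite_finite_induct) (auto intro: reg_const reg_add)

lemma reg_prod:
  "openin (ztop X) U \<Longrightarrow> (\<And>i. i \<in> I \<Longrightarrow> reg X U (f i)) \<Longrightarrow> reg X U (\<lambda>x. \<Prod>i\<in>I. f i x)"
  by (induction I rule: infinite_finite_induct) (auto intro: reg_const reg_mult)

text \<open>By the Leibniz formula the determinant is a polynomial in its entries.\<close>

lemma reg_det:
  assumes "openin (ztop X) U" "\<And>i j. i < m \<Longrightarrow> j < m \<Longrightarrow> reg X U (a i j)"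
  shows "reg X U (\<lambda>x. det (mat m m (\<lambda>(i, j). a i j x)))"
proof -
  have *: "det (mat m m (\<lambda>(i, j). a i j x)) =
      (\<Sum>p | p permutes {0..<m}. signof p * (\<Prod>i = 0..<m. a i (p i) x))" for x
  proof -
    have "p i < m" if "p permutes {0..<m}" "i < m" for p i
      using permutes_in_image[OF that(1), of i] that(2) by simp
    then show ?thesis
      by (subst det_def'[of _ m]) (auto intro!: sum.cong prod.cong)
  qed
  have **: "p i < m" if "p permutes {0..<m}" "i < m" for p i
    using permutes_in_image[OF that(1), of i] that(2) by simp
  show ?thesis unfolding *
    by (intro reg_sum reg_mult reg_const reg_prod assms) (auto simp: **)
qed

text \<open>Forms are built from constants and coordinates by sums and products, all of which
  preserve regularity after substitution.\<close>

lemma reg_homfun: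
  assumes "homfun I d F" "openin (ztop X) U" "\<And>i. i \<in> I \<Longrightarrow> reg X U (m i)"
  shows "reg X U (\<lambda>x. F (\<lambda>i. m i x))"
  using assms(1)
  by (induction rule: homfun.induct) (auto intro: reg_const reg_add reg_mult assms)

lemma closedin_zero: 
  assumes "reg X (points X) f" shows "closedin (ztop X) {x \<in> points X. f x = 0}"
proof -
  have "points X - {x \<in> points X. f x = 0} = {x \<in> points X. f x \<noteq> 0}" by auto
  then show ?thesis using openin_nonzero[OF assms] unfolding closedin_def by auto
qed

end

text \<open>Restriction and gluing are built into the definition of regularity, so only constants
  and the algebraic operations have to be checked, and only near a given point. The witness
  \<open>h\<close> has to agree with the sum, product or inverse on \<open>C\<close> cut down to the
  given domains, so common denominators may be used freely.\<close>

lemma space_with_functions_fspace_from: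
  assumes const: "\<And>x c. x \<in> \<Union>(fst ` B) \<Longrightarrow> \<exists>D g. (D, g) \<in> B \<and> x \<in> D \<and> (\<forall>y\<in>D. g y = c)"
    and add: "\<And>D f E g x. (D, f) \<in> B \<Longrightarrow> (E, g) \<in> B \<Longrightarrow> x \<in> D \<Longrightarrow> x \<in> E \<Longrightarrow>
       \<exists>C h. (C, h) \<in> B \<and> x \<in> C \<and> (\<forall>y\<in>C \<inter> D \<inter> E. h y = f y + g y)"
    and mult: "\<And>D f E g x. (D, f) \<in> B \<Longrightarrow> (E, g) \<in> B \<Longrightarrow> x \<in> D \<Longrightarrow> x \<in> E \<Longrightarrow>
       \<exists>C h. (C, h) \<in> B \<and> x \<in> C \<and> (\<forall>y\<in>C \<inter> D \<inter> E. h y = f y * g y)"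
    and inv: "\<And>D f x. (D, f) \<in> B \<Longrightarrow> x \<in> D \<Longrightarrow> f x \<noteq> 0 \<Longrightarrow>
       \<exists>C h. (C, h) \<in> B \<and> x \<in> C \<and> (\<forall>y\<in>C \<inter> D. f y \<noteq> 0 \<and> h y = inverse (f y))"
  shows "space_with_functions (fspace_from B)"
proof -
  define X where "X = fspace_from B"
  note reg = reg_fspace_from[of B, folded X_def]
  note op = openin_fspace_from[of _ _ B, folded X_def]
  have pts: "points X = \<Union>(fst ` B)" by (simp add: X_def points_fspace_from)
  have "space_with_functions X"
    unfolding space_with_functions_def
  proof (intro conjI allI impI)
    fix U f assume "reg X U f" then show "openin (ztop X) U" by (simp add: reg)
  next
    fix U and c :: complex assume U: "openin (ztop X) U"
    show "reg X U (\<lambda>_. c)" unfolding reg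
    proof (intro conjI ballI U)
      fix x assume x: "x \<in> U"
      then have "x \<in> \<Union>(fst ` B)" using openin_subset[OF U] pts by auto
      from const[OF this] obtain D g where D: "(D, g) \<in> B" "x \<in> D" "\<forall>y\<in>D. g y = c" by blast
      show "\<exists>W D g. openin (ztop X) W \<and> x \<in> W \<and> W \<subseteq> U \<and> (D, g) \<in> B \<and> W \<subseteq> D \<and> (\<forall>y\<in>W. c = g y)"
        by (rule exI[of _ "U \<inter> D"], rule exI[of _ D], rule exI[of _ g])
           (use D U x op in \<open>auto simp: subset_eq intro: openin_Int\<close>)
    qed
  next
    fix U f g assume f: "reg X U f" and g: "reg X U g"
    have U: "openin (ztop X) U" using f by (simp add: reg)
    show "reg X U (\<lambda>x. f x + g x)" unfolding reg
    proof (intro conjI ballI U)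
      fix x assume x: "x \<in> U"
      from f x obtain W D f' where 1: "openin (ztop X) W" "x \<in> W" "W \<subseteq> U" "(D, f') \<in> B" "W \<subseteq> D"
        "\<forall>y\<in>W. f y = f' y" unfolding reg by blast
      from g x obtain W' D' g' where 2: "openin (ztop X) W'" "x \<in> W'" "W' \<subseteq> U" "(D', g') \<in> B" "W' \<subseteq> D'"
        "\<forall>y\<in>W'. g y = g' y" unfolding reg by blast
      from add[OF 1(4) 2(4)] 1 2 obtain C h where h: "(C, h) \<in> B" "x \<in> C"
        "\<forall>y\<in>C \<inter> D \<inter> D'. h y = f' y + g' y" by blast
      show "\<exists>W D h. openin (ztop X) W \<and> x \<in> W \<and> W \<subseteq> U \<and> (D, h) \<in> B \<and> W \<subseteq> D \<and> (\<forall>y\<in>W. f y + g y = h y)"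
        by (rule exI[of _ "W \<inter> W' \<inter> C"], rule exI[of _ C], rule exI[of _ h])
           (use 1 2 h op in \<open>auto simp: subset_eq intro!: openin_Int\<close>)
    qed
    show "reg X U (\<lambda>x. f x * g x)" unfolding reg
    proof (intro conjI ballI U)
      fix x assume x: "x \<in> U"
      from f x obtain W D f' where 1: "openin (ztop X) W" "x \<in> W" "W \<subseteq> U" "(D, f') \<in> B" "W \<subseteq> D"
        "\<forall>y\<in>W. f y = f' y" unfolding reg by blast
      from g x obtain W' D' g' where 2: "openin (ztop X) W'" "x \<in> W'" "W' \<subseteq> U" "(D', g') \<in> B" "W' \<subseteq> D'"
        "\<forall>y\<in>W'. g y = g' y" unfolding reg by blast
      from mult[OF 1(4) 2(4)] 1 2 obtain C h where h: "(C, h) \<in> B" "x \<in> C"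
        "\<forall>y\<in>C \<inter> D \<inter> D'. h y = f' y * g' y" by blast
      show "\<exists>W D h. openin (ztop X) W \<and> x \<in> W \<and> W \<subseteq> U \<and> (D, h) \<in> B \<and> W \<subseteq> D \<and> (\<forall>y\<in>W. f y * g y = h y)"
        by (rule exI[of _ "W \<inter> W' \<inter> C"], rule exI[of _ C], rule exI[of _ h])
           (use 1 2 h op in \<open>auto simp: subset_eq intro!: openin_Int\<close>)
    qed
  next
    fix U f assume f: "reg X U f"
    have U: "openin (ztop X) U" using f by (simp add: reg)
    have *: "\<exists>W D h. openin (ztop X) W \<and> x \<in> W \<and> W \<subseteq> {x \<in> U. f x \<noteq> 0} \<and> (D, h) \<in> B \<and> W \<subseteq> D \<and>
        (\<forall>y\<in>W. inverse (f y) = h y)" if x: "x \<in> U" "f x \<noteq> 0" for x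
    proof -
      from f x obtain W D f' where 1: "openin (ztop X) W" "x \<in> W" "W \<subseteq> U" "(D, f') \<in> B" "W \<subseteq> D"
        "\<forall>y\<in>W. f y = f' y" unfolding reg by blast
      have "x \<in> D" "f' x \<noteq> 0" using 1(2,5,6) x(2) by auto
      from inv[OF 1(4) this] obtain C h where h: "(C, h) \<in> B" "x \<in> C"
        "\<forall>y\<in>C \<inter> D. f' y \<noteq> 0 \<and> h y = inverse (f' y)" by blast
      show ?thesis
        by (rule exI[of _ "W \<inter> C"], rule exI[of _ C], rule exI[of _ h])
           (use 1 h op[OF h(1)] in \<open>auto simp: subset_eq intro!: openin_Int\<close>)
    qed
    show 1: "openin (ztop X) {x \<in> U. f x \<noteq> 0}"
    proof (rule iffD2[OF openin_subopen], rule ballI)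
      fix x assume "x \<in> {x \<in> U. f x \<noteq> 0}"
      then show "\<exists>W. openin (ztop X) W \<and> x \<in> W \<and> W \<subseteq> {x \<in> U. f x \<noteq> 0}" using *[of x] by auto
    qed
    show "reg X {x \<in> U. f x \<noteq> 0} (\<lambda>x. inverse (f x))"
      unfolding reg using 1 by (intro conjI ballI *) auto
  next
    fix U V f g assume a: "reg X U f" "openin (ztop X) V" "V \<subseteq> U" "\<forall>x\<in>V. g x = f x"
    show "reg X V g" unfolding reg
    proof (intro conjI ballI a)
      fix x assume x: "x \<in> V"
      with a obtain W D f' where 1: "openin (ztop X) W" "x \<in> W" "W \<subseteq> U" "(D, f') \<in> B" "W \<subseteq> D"
        "\<forall>y\<in>W. f y = f' y" unfolding reg by blast
      show "\<exists>W D h. openin (ztop X) W \<and> x \<in> W \<and> W \<subseteq> V \<and> (D, h) \<in> B \<and> W \<subseteq> D \<and> (\<forall>y\<in>W. g y = h y)"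
        by (rule exI[of _ "W \<inter> V"], rule exI[of _ D], rule exI[of _ f'])
           (use 1 x a in \<open>auto simp: subset_eq intro!: openin_Int\<close>)
    qed
  next
    fix U f assume a: "openin (ztop X) U" "\<forall>x\<in>U. \<exists>V\<subseteq>U. x \<in> V \<and> reg X V f"
    show "reg X U f" unfolding reg
    proof (intro conjI ballI a)
      fix x assume "x \<in> U"
      with a obtain V where V: "V \<subseteq> U" "x \<in> V" "reg X V f" by blast
      then obtain W D f' where 1: "openin (ztop X) W" "x \<in> W" "W \<subseteq> V" "(D, f') \<in> B" "W \<subseteq> D"
        "\<forall>y\<in>W. f y = f' y" unfolding reg by blast
      show "\<exists>W D h. openin (ztop X) W \<and> x \<in> W \<and> W \<subseteq> U \<and> (D, h) \<in> B \<and> W \<subseteq> D \<and> (\<forall>y\<in>W. f y = h y)"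
        by (rule exI[of _ "W"], rule exI[of _ D], rule exI[of _ f'])
           (use 1 V in auto)
    qed
  qed
  then show ?thesis by (simp add: X_def)
qed

section \<open>Morphisms of spaces with functions\<close>

lemma morphism_openin:
  "morphism X Y f \<Longrightarrow> openin (ztop Y) V \<Longrightarrow> openin (ztop X) {x \<in> points X. f x \<in> V}"
  unfolding morphism_def by (auto intro: openin_continuous_map_preimage)

lemma morphism_points: "morphism X Y f \<Longrightarrow> x \<in> points X \<Longrightarrow> f x \<in> points Y"
  unfolding morphism_def continuous_map_def by auto

lemma morphism_reg: "morphism X Y f \<Longrightarrow> reg Y V g \<Longrightarrow> reg X {x \<in> points X. f x \<in> V} (\<lambda>x. g (f x))"
  unfolding morphism_def by (auto simp: o_def)

lemma morphismI:
  assumes "\<And>x. x \<in> points X \<Longrightarrow> f x \<in> points Y"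
    and "\<And>V. openin (ztop Y) V \<Longrightarrow> openin (ztop X) {x \<in> points X. f x \<in> V}"
    and "\<And>V g. reg Y V g \<Longrightarrow> reg X {x \<in> points X. f x \<in> V} (\<lambda>x. g (f x))"
  shows "morphism X Y f"
  unfolding morphism_def continuous_map_def using assms by (auto simp: o_def)

text \<open>Only generators and small neighbourhoods have to be tested: the sets \<open>V\<close>
  show that preimages of generators are open, and every regular function of the target agrees
  locally with a generator.\<close>

lemma morphism_fspace_fromI:
  assumes Z: "space_with_functions Z"
    and pts: "\<And>z. z \<in> points Z \<Longrightarrow> f z \<in> \<Union>(fst ` B)"
    and loc: "\<And>D g z. (D, g) \<in> B \<Longrightarrow> z \<in> points Z \<Longrightarrow> f z \<in> D \<Longrightarrow>
      \<exists>V. z \<in> V \<and> V \<subseteq> {z \<in> points Z. f z \<in> D} \<and> reg Z V (\<lambda>z. g (f z))"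
  shows "morphism Z (fspace_from B) f"
proof -
  have op: "openin (ztop Z) {z \<in> points Z. f z \<in> D}" if "(D, g) \<in> B" for D g
  proof (rule iffD2[OF openin_subopen], rule ballI)
    fix z assume "z \<in> {z \<in> points Z. f z \<in> D}"
    with loc[OF that, of z] reg_openin[OF Z]
    show "\<exists>V. openin (ztop Z) V \<and> z \<in> V \<and> V \<subseteq> {z \<in> points Z. f z \<in> D}" by blast
  qed
  have rg: "reg Z {z \<in> points Z. f z \<in> D} (\<lambda>z. g (f z))" if "(D, g) \<in> B" for D g
  proof (rule reg_local[OF Z op[OF that]])
    fix z assume "z \<in> {z \<in> points Z. f z \<in> D}"
    with loc[OF that, of z]
    show "\<exists>V\<subseteq>{z \<in> points Z. f z \<in> D}. z \<in> V \<and> reg Z V (\<lambda>z. g (f z))" by blast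
  qed
  have cont: "continuous_map (ztop Z) (ztop (fspace_from B)) f"
    unfolding fspace_from_ztop continuous_on_generated_topo_iff
  proof (intro conjI allI impI)
    fix U assume "U \<in> fst ` B"
    then obtain g where "(U, g) \<in> B" by force
    moreover have "f -` U \<inter> points Z = {z \<in> points Z. f z \<in> U}" by auto
    ultimately show "openin (ztop Z) (f -` U \<inter> points Z)" using op[of U g] by simp
  next
    show "f ` points Z \<subseteq> \<Union> (fst ` B)" using pts by auto
  qed
  note op' = openin_continuous_map_preimage[OF cont]
  show ?thesis
    unfolding morphism_def
  proof (intro conjI allI impI cont)
    fix V g assume g: "reg (fspace_from B) V g"
    show "reg Z {z \<in> points Z. f z \<in> V} (g \<circ> f)"
    proof (rule reg_local[OF Z])
      show "openin (ztop Z) {z \<in> points Z. f z \<in> V}"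
        using g by (intro op') (simp add: reg_fspace_from)
      fix z assume z: "z \<in> {z \<in> points Z. f z \<in> V}"
      with g obtain W D h where W: "openin (ztop (fspace_from B)) W" "f z \<in> W" "W \<subseteq> V" "(D, h) \<in> B" "W \<subseteq> D"
        "\<forall>y\<in>W. g y = h y" unfolding reg_fspace_from by blast
      have "reg Z {z \<in> points Z. f z \<in> W} (g \<circ> f)"
        by (rule reg_restrict[OF Z rg[OF W(4)] op'[OF W(1)]]) (use W in auto)
      then show "\<exists>V'\<subseteq>{z \<in> points Z. f z \<in> V}. z \<in> V' \<and> reg Z V' (g \<circ> f)"
        using W z by (intro exI[of _ "{z \<in> points Z. f z \<in> W}"]) auto
    qed
  qed
qed

lemma morphism_compose:
  assumes "space_with_functions X" "morphism X Y f" "morphism Y Z g"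
  shows "morphism X Z (\<lambda>x. g (f x))"
proof (rule morphismI)
  fix x assume "x \<in> points X" then show "g (f x) \<in> points Z"
    using assms(2,3) by (blast intro: morphism_points)
next
  fix V assume "openin (ztop Z) V"
  from morphism_openin[OF assms(2) morphism_openin[OF assms(3) this]]
  show "openin (ztop X) {x \<in> points X. g (f x) \<in> V}"
    by (rule back_subst[of "openin (ztop X)"]) (use assms(2) in \<open>auto intro: morphism_points\<close>)
next
  fix V h assume "reg Z V h"
  from morphism_reg[OF assms(2) morphism_reg[OF assms(3) this]]
  show "reg X {x \<in> points X. g (f x) \<in> V} (\<lambda>x. h (g (f x)))"
    by (rule back_subst[of "\<lambda>S. reg X S (\<lambda>x. h (g (f x)))"]) (use assms(2) in \<open>auto intro: morphism_points\<close>)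
qed

lemma morphism_cong:
  assumes X: "space_with_functions X" and f: "morphism X Y f" and eq: "\<And>x. x \<in> points X \<Longrightarrow> g x = f x"
  shows "morphism X Y g"
proof (rule morphismI)
  fix x assume "x \<in> points X" then show "g x \<in> points Y"
    using f eq by (auto intro: morphism_points)
next
  fix V assume "openin (ztop Y) V"
  from morphism_openin[OF f this]
  show "openin (ztop X) {x \<in> points X. g x \<in> V}"
    by (rule back_subst[of "openin (ztop X)"]) (use eq in auto)
next
  fix V h assume h: "reg Y V h"
  have *: "{x \<in> points X. g x \<in> V} = {x \<in> points X. f x \<in> V}" using eq by auto
  show "reg X {x \<in> points X. g x \<in> V} (\<lambda>x. h (g x))"
    unfolding * by (rule reg_cong[OF X morphism_reg[OF f h]]) (use eq in auto)
qed

section \<open>Subspaces with the induced structure\<close>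

lemma subspace_generators: "(D, f) \<in> {(U \<inter> S, f) | U f. reg X U f} \<longleftrightarrow> (\<exists>U. D = U \<inter> S \<and> reg X U f)"
  by auto

lemma reg_subspaceI: "reg X U f \<Longrightarrow> reg (subspace X S) (U \<inter> S) f"
  unfolding subspace_def by (rule reg_fspace_fromI) auto

text \<open>The traces on \<open>S\<close> of open sets of \<open>X\<close> are already closed under
  finite intersections and arbitrary unions, so generating a topology from them adds
  nothing.\<close>

lemma openin_subspace:
  assumes X: "space_with_functions X"
  shows "openin (ztop (subspace X S)) W \<longleftrightarrow> (\<exists>U. openin (ztop X) U \<and> W = U \<inter> S)"
proof
  assume "\<exists>U. openin (ztop X) U \<and> W = U \<inter> S"
  then obtain U where U: "openin (ztop X) U" "W = U \<inter> S" by blast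
  have "(W, \<lambda>_. 0) \<in> {(U \<inter> S, f) | U f. reg X U f}"
    unfolding subspace_generators using U reg_const[OF X U(1), of 0] by blast
  then show "openin (ztop (subspace X S)) W"
    unfolding subspace_def by (rule openin_fspace_from)
next
  assume "openin (ztop (subspace X S)) W"
  then have "generate_topology_on (fst ` {(U \<inter> S, f) | U f. reg X U f}) W"
    unfolding subspace_def fspace_from_ztop openin_topology_generated_by_iff .
  then show "\<exists>U. openin (ztop X) U \<and> W = U \<inter> S"
  proof induction
    case Empty then show ?case by (intro exI[of _ "{}"]) auto
  next
    case (Int a b)
    then obtain U V where "openin (ztop X) U" "a = U \<inter> S" "openin (ztop X) V" "b = V \<inter> S" by blast
    then show ?case by (intro exI[of _ "U \<inter> V"]) auto
  next
    case (UN K)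
    \<comment> \<open>All open sets with trace in \<open>K\<close> are taken at once, which avoids
      choosing one for each member of \<open>K\<close>.\<close>
    define \<U> where "\<U> = {U. openin (ztop X) U \<and> U \<inter> S \<in> K}"
    have "\<Union>K = \<Union>\<U> \<inter> S" using UN unfolding \<U>_def by blast
    moreover have "openin (ztop X) (\<Union>\<U>)" unfolding \<U>_def by auto
    ultimately show ?case by blast
  next
    case (Basis s)
    then obtain U f where "s = U \<inter> S" "reg X U f" by auto
    then show ?case using reg_openin[OF X, of U f] by blast
  qed
qed

lemma points_subspace:
  assumes X: "space_with_functions X"
  shows "points (subspace X S) = points X \<inter> S"
proof -
  have "points (subspace X S) \<subseteq> points X \<inter> S"
    using openin_subspace[OF X, of S "points (subspace X S)"] openin_subset by auto
  moreover have "openin (ztop (subspace X S)) (points X \<inter> S)"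
    using openin_subspace[OF X] by blast
  ultimately show ?thesis using openin_subset by blast
qed

lemma closedin_subspace:
  assumes X: "space_with_functions X" and C: "closedin (ztop X) C"
  shows "closedin (ztop (subspace X S)) (C \<inter> S)"
proof -
  have "points X \<inter> S - C \<inter> S = (points X - C) \<inter> S" by auto
  then show ?thesis
    using C openin_subspace[OF X, of S "(points X - C) \<inter> S"] closedin_subset[OF C]
    unfolding closedin_def points_subspace[OF X] by auto
qed

lemma space_with_functions_subspace:
  assumes X: "space_with_functions X"
  shows "space_with_functions (subspace X S)"
  unfolding subspace_def
proof (rule space_with_functions_fspace_from, unfold subspace_generators)
  fix x and c :: complex assume "x \<in> \<Union> (fst ` {(U \<inter> S, f) |U f. reg X U f})"
  then obtain U f where "x \<in> U \<inter> S" "reg X U f" by auto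
  then show "\<exists>D g. (\<exists>U. D = U \<inter> S \<and> reg X U g) \<and> x \<in> D \<and> (\<forall>y\<in>D. g y = c)"
    by (intro exI[of _ "U \<inter> S"] exI[of _ "\<lambda>_. c"]) (auto dest: reg_openin[OF X] intro: reg_const[OF X])
next
  fix D f E g x
  assume "\<exists>U. D = U \<inter> S \<and> reg X U f" "\<exists>U. E = U \<inter> S \<and> reg X U g" and x: "x \<in> D" "x \<in> E"
  then obtain U V where U: "D = U \<inter> S" "reg X U f" and V: "E = V \<inter> S" "reg X V g" by blast
  have o: "openin (ztop X) (U \<inter> V)" using U V by (auto dest: reg_openin[OF X])
  have f: "reg X (U \<inter> V) f" and g: "reg X (U \<inter> V) g"
    by (rule reg_subset[OF X U(2) o], simp) (rule reg_subset[OF X V(2) o], simp)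
  show "\<exists>C h. (\<exists>U. C = U \<inter> S \<and> reg X U h) \<and> x \<in> C \<and> (\<forall>y\<in>C \<inter> D \<inter> E. h y = f y + g y)"
    using reg_add[OF X f g] x U V
    by (intro exI[of _ "U \<inter> V \<inter> S"] exI[of _ "\<lambda>x. f x + g x"]) auto
  show "\<exists>C h. (\<exists>U. C = U \<inter> S \<and> reg X U h) \<and> x \<in> C \<and> (\<forall>y\<in>C \<inter> D \<inter> E. h y = f y * g y)"
    using reg_mult[OF X f g] x U V
    by (intro exI[of _ "U \<inter> V \<inter> S"] exI[of _ "\<lambda>x. f x * g x"]) auto
next
  fix D f x assume "\<exists>U. D = U \<inter> S \<and> reg X U f" and x: "x \<in> D" "f x \<noteq> 0"
  then obtain U where U: "D = U \<inter> S" "reg X U f" by blast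
  show "\<exists>C h. (\<exists>U. C = U \<inter> S \<and> reg X U h) \<and> x \<in> C \<and> (\<forall>y\<in>C \<inter> D. f y \<noteq> 0 \<and> h y = inverse (f y))"
    using reg_inverse_nonzero[OF X U(2)] x U
    by (intro exI[of _ "{x \<in> U. f x \<noteq> 0} \<inter> S"] exI[of _ "\<lambda>x. inverse (f x)"]) auto
qed

lemma morphism_into_subspace:
  assumes Z: "space_with_functions Z" and f: "morphism Z X f" and S: "\<And>z. z \<in> points Z \<Longrightarrow> f z \<in> S"
    and X: "space_with_functions X"
  shows "morphism Z (subspace X S) f"
  unfolding subspace_def
proof (rule morphism_fspace_fromI[OF Z], unfold subspace_generators)
  fix z assume z: "z \<in> points Z"
  have "reg X (points X) (\<lambda>_. 0)" by (rule reg_const[OF X]) simp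
  moreover have "f z \<in> points X \<inter> S" using z f S by (auto intro: morphism_points)
  ultimately have "(points X \<inter> S, \<lambda>_. 0) \<in> {(U \<inter> S, f) |U f. reg X U f}" "f z \<in> points X \<inter> S"
    by blast+
  then show "f z \<in> \<Union> (fst ` {(U \<inter> S, f) |U f. reg X U f})"
    by (metis (no_types, lifting) UN_I fst_conv)
next
  fix D g z assume "\<exists>U. D = U \<inter> S \<and> reg X U g" and z: "z \<in> points Z" "f z \<in> D"
  then obtain U where U: "D = U \<inter> S" "reg X U g" by blast
  show "\<exists>V. z \<in> V \<and> V \<subseteq> {z \<in> points Z. f z \<in> D} \<and> reg Z V (\<lambda>z. g (f z))"
    using morphism_reg[OF f U(2)] U z S by (intro exI[of _ "{x \<in> points Z. f x \<in> U}"]) auto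
qed

lemma morphism_inclusion:
  assumes X: "space_with_functions X"
  shows "morphism (subspace X S) X (\<lambda>x. x)"
proof (rule morphismI)
  fix x assume "x \<in> points (subspace X S)" then show "x \<in> points X" by (simp add: points_subspace[OF X])
next
  fix V assume V: "openin (ztop X) V"
  have "{x \<in> points (subspace X S). x \<in> V} = V \<inter> S"
    using openin_subset[OF V] by (auto simp: points_subspace[OF X])
  then show "openin (ztop (subspace X S)) {x \<in> points (subspace X S). x \<in> V}"
    using V openin_subspace[OF X] by metis
next
  fix V g assume g: "reg X V g"
  have "{x \<in> points (subspace X S). x \<in> V} = V \<inter> S"
    using openin_subset[OF reg_openin[OF X g]] by (auto simp: points_subspace[OF X])
  then show "reg (subspace X S) {x \<in> points (subspace X S). x \<in> V} g"
    using reg_subspaceI[OF g, of S] by simp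
qed

lemma morphism_restrict:
  assumes "space_with_functions X" "morphism X Y f"
  shows "morphism (subspace X S) Y f"
  using morphism_compose[OF space_with_functions_subspace morphism_inclusion] assms by blast

text \<open>When \<open>S\<close> is open, the local representatives of a function on the subspace
  live on sets which are open in \<open>X\<close> itself, so gluing in \<open>X\<close>
  applies.\<close>

lemma reg_subspace_open:
  assumes X: "space_with_functions X" and S: "openin (ztop X) S"
  shows "reg (subspace X S) V f \<longleftrightarrow> reg X V f \<and> V \<subseteq> S"
proof
  assume "reg X V f \<and> V \<subseteq> S"
  then show "reg (subspace X S) V f" using reg_subspaceI[of X V f S] by (simp add: Int_absorb2)
next
  assume r: "reg (subspace X S) V f"
  then have o: "openin (ztop (subspace X S)) V"
    unfolding subspace_def by (simp add: reg_fspace_from)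
  then have VS: "V \<subseteq> S" using points_subspace[OF X, of S] openin_subset by blast
  have sub: "openin (ztop X) W" if "openin (ztop (subspace X S)) W" for W
    using that S openin_subspace[OF X] by auto
  have "reg X V f"
  proof (rule reg_local[OF X sub[OF o]])
    fix x assume x: "x \<in> V"
    with r obtain W D g where "openin (ztop (subspace X S)) W" "x \<in> W" "W \<subseteq> V"
      "(D, g) \<in> {(U \<inter> S, f) | U f. reg X U f}" "W \<subseteq> D" "\<forall>y\<in>W. f y = g y"
      unfolding subspace_def reg_fspace_from by blast
    then obtain U where W: "openin (ztop (subspace X S)) W" "x \<in> W" "W \<subseteq> V" "W \<subseteq> U"
      "reg X U g" "\<forall>y\<in>W. f y = g y" by blast
    have "reg X W f" by (rule reg_restrict[OF X W(5) sub[OF W(1)] W(4)]) (use W in auto)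
    then show "\<exists>W\<subseteq>V. x \<in> W \<and> reg X W f" using W by blast
  qed
  with VS show "reg X V f \<and> V \<subseteq> S" by blast
qed

lemma morphism_local:
  assumes X: "space_with_functions X"
    and loc: "\<And>x. x \<in> points X \<Longrightarrow> \<exists>V. openin (ztop X) V \<and> x \<in> V \<and> morphism (subspace X V) Y f"
  shows "morphism X Y f"
proof -
  have pts: "points (subspace X V) = V" if "openin (ztop X) V" for V
    using points_subspace[OF X, of V] openin_subset[OF that] by auto
  show ?thesis
  proof (rule morphismI)
    fix x assume "x \<in> points X"
    from loc[OF this] show "f x \<in> points Y" using pts morphism_points by metis
  next
    fix W assume W: "openin (ztop Y) W"
    show "openin (ztop X) {x \<in> points X. f x \<in> W}"
    proof (rule iffD2[OF openin_subopen], rule ballI)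
      fix x assume x: "x \<in> {x \<in> points X. f x \<in> W}"
      then obtain V where V: "openin (ztop X) V" "x \<in> V" "morphism (subspace X V) Y f" using loc by blast
      have "openin (ztop (subspace X V)) {x \<in> V. f x \<in> W}"
        using morphism_openin[OF V(3) W] by (simp add: pts V)
      then have "openin (ztop X) {x \<in> V. f x \<in> W}"
        using openin_subspace[OF X] V(1) by auto
      then show "\<exists>T. openin (ztop X) T \<and> x \<in> T \<and> T \<subseteq> {x \<in> points X. f x \<in> W}"
        using x V openin_subset[OF V(1)] by (intro exI[of _ "{x \<in> V. f x \<in> W}"]) auto
    qed
    note op = this
  next
    fix W g assume g: "reg Y W g"
    have *: "\<exists>V'\<subseteq>{x \<in> points X. f x \<in> W}. x \<in> V' \<and> reg X V' (\<lambda>x. g (f x))"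
      if x: "x \<in> {x \<in> points X. f x \<in> W}" for x
    proof -
      obtain V where V: "openin (ztop X) V" "x \<in> V" "morphism (subspace X V) Y f" using loc x by blast
      have "reg (subspace X V) {x \<in> V. f x \<in> W} (\<lambda>x. g (f x))"
        using morphism_reg[OF V(3) g] by (simp add: pts V)
      then have "reg X {x \<in> V. f x \<in> W} (\<lambda>x. g (f x))"
        using reg_subspace_open[OF X V(1)] by auto
      then show ?thesis
        using x V openin_subset[OF V(1)] by (intro exI[of _ "{x \<in> V. f x \<in> W}"]) auto
    qed
    show "reg X {x \<in> points X. f x \<in> W} (\<lambda>x. g (f x))"
    proof (rule reg_local[OF X])
      show "openin (ztop X) {x \<in> points X. f x \<in> W}"
      proof (rule iffD2[OF openin_subopen], rule ballI)
        fix x assume "x \<in> {x \<in> points X. f x \<in> W}"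
        from *[OF this] show "\<exists>T. openin (ztop X) T \<and> x \<in> T \<and> T \<subseteq> {x \<in> points X. f x \<in> W}"
          by (blast dest: reg_openin[OF X])
      qed
    qed (rule *)
  qed
qed

section \<open>Products\<close>

lemma tensor_fun_const:
  assumes "space_with_functions X" "space_with_functions Y" "openin (ztop X) U" "openin (ztop Y) V"
  shows "tensor_fun X Y U V (\<lambda>_. c)"
  unfolding tensor_fun_def
  by (rule exI[of _ "1::nat"], rule exI[of _ "\<lambda>_ _. c"], rule exI[of _ "\<lambda>_ _. 1"])
     (auto intro: reg_const assms)

lemma tensor_fun_fst:
  assumes "space_with_functions Y" "openin (ztop Y) V" "reg X U f"
  shows "tensor_fun X Y U V (\<lambda>p. f (fst p))"
  unfolding tensor_fun_def
  by (rule exI[of _ "1::nat"], rule exI[of _ "\<lambda>_. f"], rule exI[of _ "\<lambda>_ _. 1"])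
     (auto intro: reg_const assms)

lemma tensor_fun_snd:
  assumes "space_with_functions X" "openin (ztop X) U" "reg Y V f"
  shows "tensor_fun X Y U V (\<lambda>p. f (snd p))"
  unfolding tensor_fun_def
  by (rule exI[of _ "1::nat"], rule exI[of _ "\<lambda>_ _. 1"], rule exI[of _ "\<lambda>_. f"])
     (auto intro: reg_const assms)

lemma tensor_fun_subset:
  assumes "space_with_functions X" "space_with_functions Y" "tensor_fun X Y U V F"
    "openin (ztop X) U'" "openin (ztop Y) V'" "U' \<subseteq> U" "V' \<subseteq> V"
  shows "tensor_fun X Y U' V' F"
proof -
  from assms(3) obtain N :: nat and f g where *: "\<forall>i<N. reg X U (f i) \<and> reg Y V (g i)"
    "\<forall>x\<in>U. \<forall>y\<in>V. F (x, y) = (\<Sum>i<N. f i x * g i y)" unfolding tensor_fun_def by blast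
  show ?thesis unfolding tensor_fun_def
    by (rule exI[of _ N], rule exI[of _ f], rule exI[of _ g])
       (use * assms reg_subset[OF assms(1)] reg_subset[OF assms(2)] in blast)
qed

lemma tensor_fun_add:
  assumes "tensor_fun X Y U V F" "tensor_fun X Y U V G"
  shows "tensor_fun X Y U V (\<lambda>p. F p + G p)"
proof -
  from assms(1) obtain N :: nat and f g where 1: "\<forall>i<N. reg X U (f i) \<and> reg Y V (g i)"
    "\<forall>x\<in>U. \<forall>y\<in>V. F (x, y) = (\<Sum>i<N. f i x * g i y)" unfolding tensor_fun_def by blast
  from assms(2) obtain M :: nat and f' g' where 2: "\<forall>i<M. reg X U (f' i) \<and> reg Y V (g' i)"
    "\<forall>x\<in>U. \<forall>y\<in>V. G (x, y) = (\<Sum>i<M. f' i x * g' i y)" unfolding tensor_fun_def by blast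
  \<comment> \<open>The two families are concatenated; indices from \<open>N\<close> on belong to
    the second sum.\<close>
  define f2 where "f2 i = (if i < N then f i else f' (i - N))" for i
  define g2 where "g2 i = (if i < N then g i else g' (i - N))" for i
  have "(\<Sum>i<N+M. f2 i x * g2 i y) = (\<Sum>i<N. f i x * g i y) + (\<Sum>i<M. f' i x * g' i y)" for x y
  proof -
    have "x \<in> (+) N ` {..<M}" if "x < N + M" "\<not> x < N" for x
      using that by (intro image_eqI[of _ _ "x - N"]) auto
    then have "{..<N+M} = {..<N} \<union> (+) N ` {..<M}" by auto
    moreover have "{..<N} \<inter> (+) N ` {..<M} = {}" by auto
    ultimately have "(\<Sum>i<N+M. f2 i x * g2 i y) = (\<Sum>i<N. f2 i x * g2 i y) + (\<Sum>i\<in>(+) N ` {..<M}. f2 i x * g2 i y)"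
      by (simp add: sum.union_disjoint)
    also have "(\<Sum>i<N. f2 i x * g2 i y) = (\<Sum>i<N. f i x * g i y)" by (simp add: f2_def g2_def)
    also have "(\<Sum>i\<in>(+) N ` {..<M}. f2 i x * g2 i y) = (\<Sum>i<M. f' i x * g' i y)"
      by (subst sum.reindex) (auto simp: f2_def g2_def)
    finally show ?thesis .
  qed
  moreover have "\<forall>i<N+M. reg X U (f2 i) \<and> reg Y V (g2 i)"
    using 1 2 by (auto simp: f2_def g2_def)
  ultimately show ?thesis unfolding tensor_fun_def
    using 1(2) 2(2) by (intro exI[of _ "N + M"] exI[of _ f2] exI[of _ g2]) auto
qed

lemma tensor_fun_mult:
  assumes X: "space_with_functions X" and Y: "space_with_functions Y"
    and "tensor_fun X Y U V F" "tensor_fun X Y U V G"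
  shows "tensor_fun X Y U V (\<lambda>p. F p * G p)"
proof -
  from assms(3) obtain N :: nat and f g where 1: "\<forall>i<N. reg X U (f i) \<and> reg Y V (g i)"
    "\<forall>x\<in>U. \<forall>y\<in>V. F (x, y) = (\<Sum>i<N. f i x * g i y)" unfolding tensor_fun_def by blast
  from assms(4) obtain M :: nat and f' g' where 2: "\<forall>i<M. reg X U (f' i) \<and> reg Y V (g' i)"
    "\<forall>x\<in>U. \<forall>y\<in>V. G (x, y) = (\<Sum>i<M. f' i x * g' i y)" unfolding tensor_fun_def by blast
  have b: "i div M < N" "i mod M < M" if "i < N * M" for i
    using that by (auto simp: less_mult_imp_div_less intro!: mod_less_divisor gr0I)
  \<comment> \<open>A pair of indices (i, j) is encoded as i * M + j and recovered by
    \<open>div\<close> and \<open>mod\<close>.\<close>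
  define f2 where "f2 i = (\<lambda>x. f (i div M) x * f' (i mod M) x)" for i
  define g2 where "g2 i = (\<lambda>y. g (i div M) y * g' (i mod M) y)" for i
  have "(\<Sum>i<N*M. f2 i x * g2 i y) = (\<Sum>i<N. f i x * g i y) * (\<Sum>i<M. f' i x * g' i y)" for x y
  proof -
    have "(\<Sum>i<N. f i x * g i y) * (\<Sum>i<M. f' i x * g' i y) =
        (\<Sum>(i,j)\<in>{..<N}\<times>{..<M}. (f i x * g i y) * (f' j x * g' j y))"
      by (simp add: sum_product sum.cartesian_product)
    also have "\<dots> = (\<Sum>i<N*M. f2 i x * g2 i y)"
    proof (rule sum.reindex_bij_witness[of _ "\<lambda>i. (i div M, i mod M)" "\<lambda>(i,j). i * M + j"], goal_cases)
      case (2 a)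
      then obtain i j where "a = (i, j)" "i < N" "j < M" by auto
      moreover from this have "i * M + j < N * M"
      proof -
        have "i * M + j < Suc i * M" using \<open>j < M\<close> by simp
        also have "\<dots> \<le> N * M" using \<open>i < N\<close> by (intro mult_right_mono) auto
        finally show ?thesis .
      qed
      ultimately show ?case by simp
    qed (auto simp: b f2_def g2_def)
    finally show ?thesis by simp
  qed
  moreover have "\<forall>i<N*M. reg X U (f2 i) \<and> reg Y V (g2 i)"
    using 1 2 b unfolding f2_def g2_def by (auto intro!: reg_mult[OF X] reg_mult[OF Y])
  ultimately show ?thesis unfolding tensor_fun_def
    using 1(2) 2(2) by (intro exI[of _ "N * M"] exI[of _ f2] exI[of _ g2]) auto
qed

definition prod_gen :: "'a fspace \<Rightarrow> 'b fspace \<Rightarrow> (('a \<times> 'b) set \<times> ('a \<times> 'b \<Rightarrow> complex)) set" where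
  "prod_gen X Y = {({p \<in> U \<times> V. G p \<noteq> 0}, \<lambda>p. F p / G p) | U V F G.
        openin (ztop X) U \<and> openin (ztop Y) V \<and> tensor_fun X Y U V F \<and> tensor_fun X Y U V G}"

lemma prod_space_gen: "prod_space X Y = fspace_from (prod_gen X Y)"
  unfolding prod_space_def prod_gen_def ..

lemma prod_genI:
  "openin (ztop X) U \<Longrightarrow> openin (ztop Y) V \<Longrightarrow> tensor_fun X Y U V F \<Longrightarrow> tensor_fun X Y U V G \<Longrightarrow>
   ({p \<in> U \<times> V. G p \<noteq> 0}, \<lambda>p. F p / G p) \<in> prod_gen X Y"
  unfolding prod_gen_def by blast

lemma prod_genE:
  assumes "(D, f) \<in> prod_gen X Y"
  obtains U V F G where "D = {p \<in> U \<times> V. G p \<noteq> 0}" "f = (\<lambda>p. F p / G p)"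
    "openin (ztop X) U" "openin (ztop Y) V" "tensor_fun X Y U V F" "tensor_fun X Y U V G"
  using assms unfolding prod_gen_def by blast

context
  fixes X :: "'a fspace" and Y :: "'b fspace"
  assumes X: "space_with_functions X" and Y: "space_with_functions Y"
begin

lemma prod_gen_rectangle:
  assumes "openin (ztop X) U" "openin (ztop Y) V" "tensor_fun X Y U V F"
  shows "(U \<times> V, F) \<in> prod_gen X Y"
  using prod_genI[OF assms tensor_fun_const[OF X Y assms(1,2), of 1]] by simp

lemma points_prod_space: "points (prod_space X Y) = points X \<times> points Y"
proof
  show "points (prod_space X Y) \<subseteq> points X \<times> points Y"
    unfolding prod_space_gen points_fspace_from
    by (auto elim!: prod_genE dest!: openin_subset)
  have "(points X \<times> points Y, \<lambda>_. 0) \<in> prod_gen X Y"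
    by (intro prod_gen_rectangle tensor_fun_const X Y) auto
  then show "points X \<times> points Y \<subseteq> points (prod_space X Y)"
    unfolding prod_space_gen points_fspace_from by force
qed

lemma space_with_functions_prod: "space_with_functions (prod_space X Y)"
  unfolding prod_space_gen
proof (rule space_with_functions_fspace_from)
  fix x and c :: complex assume x: "x \<in> \<Union> (fst ` prod_gen X Y)"
  then have "x \<in> points X \<times> points Y" using points_prod_space unfolding prod_space_gen points_fspace_from by simp
  moreover have "(points X \<times> points Y, \<lambda>_. c) \<in> prod_gen X Y"
    by (intro prod_gen_rectangle tensor_fun_const X Y) auto
  ultimately show "\<exists>D g. (D, g) \<in> prod_gen X Y \<and> x \<in> D \<and> (\<forall>y\<in>D. g y = c)" by blast
next
  fix D f E g x assume D: "(D, f) \<in> prod_gen X Y" and E: "(E, g) \<in> prod_gen X Y" and x: "x \<in> D" "x \<in> E"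
  from D obtain U V F G where D: "D = {p \<in> U \<times> V. G p \<noteq> 0}" "f = (\<lambda>p. F p / G p)"
    "openin (ztop X) U" "openin (ztop Y) V" "tensor_fun X Y U V F" "tensor_fun X Y U V G" by (rule prod_genE)
  from E obtain U' V' F' G' where E: "E = {p \<in> U' \<times> V'. G' p \<noteq> 0}" "g = (\<lambda>p. F' p / G' p)"
    "openin (ztop X) U'" "openin (ztop Y) V'" "tensor_fun X Y U' V' F'" "tensor_fun X Y U' V' G'" by (rule prod_genE)
  let ?U = "U \<inter> U'" and ?V = "V \<inter> V'"
  have o: "openin (ztop X) ?U" "openin (ztop Y) ?V" using D E by auto
  note s = tensor_fun_subset[OF X Y _ o]
  have t: "tensor_fun X Y ?U ?V F" "tensor_fun X Y ?U ?V G" "tensor_fun X Y ?U ?V F'" "tensor_fun X Y ?U ?V G'"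
    using D E by (auto intro: s)
  note g = prod_genI[OF o _ tensor_fun_mult[OF X Y t(2) t(4)]]
  show "\<exists>C h. (C, h) \<in> prod_gen X Y \<and> x \<in> C \<and> (\<forall>y\<in>C \<inter> D \<inter> E. h y = f y + g y)"
    by (rule exI, rule exI, rule conjI, rule g[OF tensor_fun_add[OF tensor_fun_mult[OF X Y t(1) t(4)] tensor_fun_mult[OF X Y t(3) t(2)]]])
       (use x D E in \<open>auto simp: field_simps\<close>)
  show "\<exists>C h. (C, h) \<in> prod_gen X Y \<and> x \<in> C \<and> (\<forall>y\<in>C \<inter> D \<inter> E. h y = f y * g y)"
    by (rule exI, rule exI, rule conjI, rule g[OF tensor_fun_mult[OF X Y t(1) t(3)]])
       (use x D E in auto)
next
  fix D f x assume "(D, f) \<in> prod_gen X Y" and x: "x \<in> D" "f x \<noteq> 0"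
  then obtain U V F G where D: "D = {p \<in> U \<times> V. G p \<noteq> 0}" "f = (\<lambda>p. F p / G p)"
    "openin (ztop X) U" "openin (ztop Y) V" "tensor_fun X Y U V F" "tensor_fun X Y U V G" by (auto elim: prod_genE)
  show "\<exists>C h. (C, h) \<in> prod_gen X Y \<and> x \<in> C \<and> (\<forall>y\<in>C \<inter> D. f y \<noteq> 0 \<and> h y = inverse (f y))"
    by (rule exI, rule exI, rule conjI, rule prod_genI[OF D(3,4) D(6,5)]) (use x D in auto)
qed

lemma morphism_fst: "morphism (prod_space X Y) X fst"
proof (rule morphismI)
  fix x assume "x \<in> points (prod_space X Y)" then show "fst x \<in> points X"
    by (auto simp: points_prod_space)
next
  fix V assume V: "openin (ztop X) V"
  have *: "{x \<in> points (prod_space X Y). fst x \<in> V} = V \<times> points Y"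
    using openin_subset[OF V] by (auto simp: points_prod_space)
  have "(V \<times> points Y, \<lambda>_. 0) \<in> prod_gen X Y"
    by (intro prod_gen_rectangle tensor_fun_const X Y V) auto
  then show "openin (ztop (prod_space X Y)) {x \<in> points (prod_space X Y). fst x \<in> V}"
    unfolding * unfolding prod_space_gen by (rule openin_fspace_from)
next
  fix V g assume g: "reg X V g"
  have *: "{x \<in> points (prod_space X Y). fst x \<in> V} = V \<times> points Y"
    using openin_subset[OF reg_openin[OF X g]] by (auto simp: points_prod_space)
  have "(V \<times> points Y, \<lambda>p. g (fst p)) \<in> prod_gen X Y"
    by (intro prod_gen_rectangle tensor_fun_fst Y g reg_openin[OF X g]) auto
  then show "reg (prod_space X Y) {x \<in> points (prod_space X Y). fst x \<in> V} (\<lambda>p. g (fst p))"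
    unfolding * unfolding prod_space_gen by (rule reg_fspace_fromI)
qed

lemma morphism_snd: "morphism (prod_space X Y) Y snd"
proof (rule morphismI)
  fix x assume "x \<in> points (prod_space X Y)" then show "snd x \<in> points Y"
    by (auto simp: points_prod_space)
next
  fix V assume V: "openin (ztop Y) V"
  have *: "{x \<in> points (prod_space X Y). snd x \<in> V} = points X \<times> V"
    using openin_subset[OF V] by (auto simp: points_prod_space)
  have "(points X \<times> V, \<lambda>_. 0) \<in> prod_gen X Y"
    by (intro prod_gen_rectangle tensor_fun_const X Y V) auto
  then show "openin (ztop (prod_space X Y)) {x \<in> points (prod_space X Y). snd x \<in> V}"
    unfolding * unfolding prod_space_gen by (rule openin_fspace_from)
next
  fix V g assume g: "reg Y V g"
  have *: "{x \<in> points (prod_space X Y). snd x \<in> V} = points X \<times> V"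
    using openin_subset[OF reg_openin[OF Y g]] by (auto simp: points_prod_space)
  have "(points X \<times> V, \<lambda>p. g (snd p)) \<in> prod_gen X Y"
    by (intro prod_gen_rectangle tensor_fun_snd X g reg_openin[OF Y g]) auto
  then show "reg (prod_space X Y) {x \<in> points (prod_space X Y). snd x \<in> V} (\<lambda>p. g (snd p))"
    unfolding * unfolding prod_space_gen by (rule reg_fspace_fromI)
qed

lemma reg_tensor_pullback:
  assumes Z: "space_with_functions Z" and f: "morphism Z X f" and g: "morphism Z Y g"
    and F: "tensor_fun X Y U V F" and U: "openin (ztop X) U" and V: "openin (ztop Y) V"
  shows "reg Z ({z \<in> points Z. f z \<in> U} \<inter> {z \<in> points Z. g z \<in> V}) (\<lambda>z. F (f z, g z))"
proof -
  let ?W = "{z \<in> points Z. f z \<in> U} \<inter> {z \<in> points Z. g z \<in> V}"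
  from F obtain N :: nat and a b where ab: "\<forall>i<N. reg X U (a i) \<and> reg Y V (b i)"
    "\<forall>x\<in>U. \<forall>y\<in>V. F (x, y) = (\<Sum>i<N. a i x * b i y)" unfolding tensor_fun_def by blast
  have o: "openin (ztop Z) ?W" using morphism_openin[OF f U] morphism_openin[OF g V] by auto
  have "reg Z ?W (\<lambda>z. \<Sum>i<N. a i (f z) * b i (g z))"
  proof (intro reg_sum[OF Z] reg_mult[OF Z] o)
    fix i assume "i \<in> {..<N}"
    then have *: "reg X U (a i)" "reg Y V (b i)" using ab by auto
    show "reg Z ?W (\<lambda>z. a i (f z))" by (rule reg_subset[OF Z morphism_reg[OF f *(1)] o]) auto
    show "reg Z ?W (\<lambda>z. b i (g z))" by (rule reg_subset[OF Z morphism_reg[OF g *(2)] o]) auto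
  qed
  then show ?thesis by (rule reg_cong[OF Z]) (use ab in auto)
qed

text \<open>A quotient of tensor functions pulls back to a quotient of regular functions on the open
  set where the pulled back denominator is nonzero. Together with the two projections this is the
  universal property of the product, whose topology is in general finer than the product
  topology.\<close>

lemma morphism_pair:
  assumes Z: "space_with_functions Z" and f: "morphism Z X f" and g: "morphism Z Y g"
  shows "morphism Z (prod_space X Y) (\<lambda>z. (f z, g z))"
  unfolding prod_space_gen
proof (rule morphism_fspace_fromI[OF Z])
  fix z assume "z \<in> points Z"
  then have "(f z, g z) \<in> points (prod_space X Y)"
    using morphism_points[OF f] morphism_points[OF g] by (simp add: points_prod_space)
  then show "(f z, g z) \<in> \<Union> (fst ` prod_gen X Y)" unfolding prod_space_gen points_fspace_from .
next
  fix D h z assume "(D, h) \<in> prod_gen X Y" and z: "z \<in> points Z" "(f z, g z) \<in> D"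
  then obtain U V F G where D: "D = {p \<in> U \<times> V. G p \<noteq> 0}" "h = (\<lambda>p. F p / G p)"
    "openin (ztop X) U" "openin (ztop Y) V" "tensor_fun X Y U V F" "tensor_fun X Y U V G" by (auto elim: prod_genE)
  let ?W = "{z \<in> points Z. f z \<in> U} \<inter> {z \<in> points Z. g z \<in> V}"
  let ?W' = "{z \<in> ?W. G (f z, g z) \<noteq> 0}"
  note r = reg_tensor_pullback[OF Z f g _ D(3,4)]
  have o: "openin (ztop Z) ?W'" by (rule openin_nonzero[OF Z r[OF D(6)]])
  have "reg Z ?W' (\<lambda>z. F (f z, g z) / G (f z, g z))"
    by (intro reg_divide[OF Z] reg_subset[OF Z r[OF D(5)] o] reg_subset[OF Z r[OF D(6)] o]) auto
  then show "\<exists>V. z \<in> V \<and> V \<subseteq> {z \<in> points Z. (f z, g z) \<in> D} \<and> reg Z V (\<lambda>z. h (f z, g z))"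
    using z D by (intro exI[of _ ?W']) auto
qed

end

section \<open>Projective space\<close>

lemma line_self: "v \<in> line v"
  unfolding line_def by (auto intro!: exI[of _ 1])

lemma lineE: assumes "w \<in> line v" obtains c where "c \<noteq> 0" "w = (\<lambda>i. c * v i)"
  using assms unfolding line_def by auto

lemma lineI: "c \<noteq> 0 \<Longrightarrow> (\<lambda>i. c * v i) \<in> line v"
  unfolding line_def by auto

lemma line_eq: assumes "w \<in> line v" shows "line w = line v"
proof -
  from assms obtain c where c: "c \<noteq> 0" "w = (\<lambda>i. c * v i)" by (rule lineE)
  show ?thesis
  proof (intro equalityI subsetI)
    fix x assume "x \<in> line w"
    then obtain d where "d \<noteq> 0" "x = (\<lambda>i. d * w i)" by (rule lineE)
    then show "x \<in> line v" using c lineI[of "d * c" v] by (simp add: mult.assoc)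
  next
    fix x assume "x \<in> line v"
    then obtain d where "d \<noteq> 0" "x = (\<lambda>i. d * v i)" by (rule lineE)
    then show "x \<in> line w" using c lineI[of "d / c" w] by simp
  qed
qed

lemma line_scale: "c \<noteq> 0 \<Longrightarrow> line (\<lambda>i. c * v i) = line v"
  by (rule line_eq) (rule lineI)

lemma proj_points_line: "x \<in> proj_points I \<Longrightarrow> v \<in> x \<Longrightarrow> x = line v"
  unfolding proj_points_def using line_eq by blast

lemma proj_points_vector:
  assumes "x \<in> proj_points I" "v \<in> x"
  shows "v \<in> vectors I" "v \<noteq> (\<lambda>_. 0)"
  using assms unfolding proj_points_def vectors_def line_def by (auto simp: fun_eq_iff)

lemma line_in_proj_points: "v \<in> vectors I \<Longrightarrow> v i \<noteq> 0 \<Longrightarrow> line v \<in> proj_points I"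
  unfolding proj_points_def by auto

lemma proj_points_nonempty: "x \<in> proj_points I \<Longrightarrow> \<exists>v. v \<in> x"
  unfolding proj_points_def using line_self by auto

lemma proj_points_some: "x \<in> proj_points I \<Longrightarrow> (SOME v. v \<in> x) \<in> x"
  by (rule someI_ex[OF proj_points_nonempty])

lemma homfun_scale: "homfun I d F \<Longrightarrow> F (\<lambda>i. c * v i) = c ^ d * F v"
  by (induction rule: homfun.induct) (simp_all add: algebra_simps power_add)

lemma homfun_tendsto:
  assumes "homfun I d F" "\<And>i. i \<in> I \<Longrightarrow> ((\<lambda>t. g t i) \<longlongrightarrow> g0 i) A"
  shows "((\<lambda>t. F (g t)) \<longlongrightarrow> F g0) A"
  using assms(1) by (induction rule: homfun.induct) (auto intro!: tendsto_intros assms)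

lemma homfun_nonzero_line:
  "homfun I d G \<Longrightarrow> x \<in> proj_points I \<Longrightarrow> v \<in> x \<Longrightarrow> G v \<noteq> 0 \<Longrightarrow> w \<in> x \<Longrightarrow> G w \<noteq> 0"
  using proj_points_line[of x I v] by (auto elim!: lineE simp: homfun_scale)

lemma homfun_quotient_line:
  assumes "homfun I d F" "homfun I d G" "x \<in> proj_points I" "v \<in> x" "w \<in> x"
  shows "F w / G w = F v / G v"
proof -
  from assms proj_points_line obtain c where "c \<noteq> 0" "w = (\<lambda>i. c * v i)" by (metis lineE)
  then show ?thesis using assms by (simp add: homfun_scale)
qed

definition proj_gen :: "'i set \<Rightarrow> (('i \<Rightarrow> complex) set set \<times> (('i \<Rightarrow> complex) set \<Rightarrow> complex)) set" where
  "proj_gen I = {({x \<in> proj_points I. \<forall>v\<in>x. G v \<noteq> 0}, f) | F G d f.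
        homfun I d F \<and> homfun I d G \<and>
        (\<forall>x\<in>proj_points I. \<forall>v\<in>x. G v \<noteq> 0 \<longrightarrow> f x = F v / G v)}"

lemma proj_space_gen: "proj_space I = fspace_from (proj_gen I)"
  unfolding proj_space_def proj_gen_def ..

lemma proj_genE:
  assumes "(D, f) \<in> proj_gen I"
  obtains F G d where "D = {x \<in> proj_points I. \<forall>v\<in>x. G v \<noteq> 0}" "homfun I d F" "homfun I d G"
    "\<And>x v. x \<in> proj_points I \<Longrightarrow> v \<in> x \<Longrightarrow> G v \<noteq> 0 \<Longrightarrow> f x = F v / G v"
  using assms unfolding proj_gen_def by blast

text \<open>A quotient of two forms of equal degree is constant on a line, so the arbitrary
  representative chosen by \<open>SOME\<close> does no harm.\<close>

lemma proj_quotient: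
  assumes "homfun I d F" "homfun I d G" "x \<in> proj_points I" "v \<in> x"
  shows "F (SOME v. v \<in> x) / G (SOME v. v \<in> x) = F v / G v"
  by (rule homfun_quotient_line[OF assms someI[of "\<lambda>v. v \<in> x", OF assms(4)]])

lemma proj_genI:
  assumes "homfun I d F" "homfun I d G"
  shows "({x \<in> proj_points I. \<forall>v\<in>x. G v \<noteq> 0}, \<lambda>x. F (SOME v. v \<in> x) / G (SOME v. v \<in> x)) \<in> proj_gen I"
proof -
  have "\<forall>x\<in>proj_points I. \<forall>v\<in>x. G v \<noteq> 0 \<longrightarrow> F (SOME v. v \<in> x) / G (SOME v. v \<in> x) = F v / G v"
    using proj_quotient[OF assms] by blast
  with assms show ?thesis unfolding proj_gen_def by blast
qed

lemma proj_points_coord: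
  assumes "x \<in> proj_points I"
  obtains i where "i \<in> I" "\<forall>v\<in>x. v i \<noteq> 0"
proof -
  from assms obtain u where u: "x = line u" "u \<in> vectors I" "u \<noteq> (\<lambda>_. 0)"
    unfolding proj_points_def by auto
  then obtain i where "u i \<noteq> 0" by auto
  then have "i \<in> I" "\<forall>v\<in>x. v i \<noteq> 0" using u by (auto simp: vectors_def elim!: lineE)
  then show ?thesis using that by blast
qed

lemma points_proj_space: "points (proj_space I) = proj_points I"
proof
  show "points (proj_space I) \<subseteq> proj_points I"
    unfolding proj_space_gen points_fspace_from by (auto elim!: proj_genE)
  have "(proj_points I, \<lambda>x. 1) \<in> proj_gen I"
    using proj_genI[OF homfun.const[of I 1] homfun.const[of I 1]] by simp
  then show "proj_points I \<subseteq> points (proj_space I)"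
    unfolding proj_space_gen points_fspace_from by force
qed

text \<open>Numerator and denominator of a generator have the same degree, and this survives the
  passage to a common denominator, where the degrees of two generators add.\<close>

lemma space_with_functions_proj: "space_with_functions (proj_space I)"
  unfolding proj_space_gen
proof (rule space_with_functions_fspace_from)
  fix x and c :: complex assume "x \<in> \<Union> (fst ` proj_gen I)"
  then have "x \<in> proj_points I" using points_proj_space unfolding proj_space_gen points_fspace_from by blast
  then obtain i where i: "i \<in> I" "\<forall>v\<in>x. v i \<noteq> 0" by (rule proj_points_coord)
  have 1: "homfun I 1 (\<lambda>v. v i)" by (rule homfun.coord[OF i(1)])
  have 2: "homfun I 1 (\<lambda>v. c * v i)" using homfun.mult[OF homfun.const[of I c] 1] by simp
  show "\<exists>D g. (D, g) \<in> proj_gen I \<and> x \<in> D \<and> (\<forall>y\<in>D. g y = c)"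
  proof (rule exI, rule exI, intro conjI, rule proj_genI[OF 2 1])
    show "x \<in> {x \<in> proj_points I. \<forall>v\<in>x. v i \<noteq> 0}" using i \<open>x \<in> proj_points I\<close> by auto
    show "\<forall>y\<in>{x \<in> proj_points I. \<forall>v\<in>x. v i \<noteq> 0}. c * (SOME v. v \<in> y) i / (SOME v. v \<in> y) i = c"
    proof
      fix y assume y: "y \<in> {x \<in> proj_points I. \<forall>v\<in>x. v i \<noteq> 0}"
      then have "(SOME v. v \<in> y) \<in> y" by (auto intro: proj_points_some)
      then show "c * (SOME v. v \<in> y) i / (SOME v. v \<in> y) i = c" using y by auto
    qed
  qed
next
  fix D f E g x assume D: "(D, f) \<in> proj_gen I" and E: "(E, g) \<in> proj_gen I" and x: "x \<in> D" "x \<in> E"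
  from D obtain F G d where D: "D = {x \<in> proj_points I. \<forall>v\<in>x. G v \<noteq> 0}" "homfun I d F" "homfun I d G"
    "\<And>x v. x \<in> proj_points I \<Longrightarrow> v \<in> x \<Longrightarrow> G v \<noteq> 0 \<Longrightarrow> f x = F v / G v" by (rule proj_genE) blast
  from E obtain F' G' e where E: "E = {x \<in> proj_points I. \<forall>v\<in>x. G' v \<noteq> 0}" "homfun I e F'" "homfun I e G'"
    "\<And>x v. x \<in> proj_points I \<Longrightarrow> v \<in> x \<Longrightarrow> G' v \<noteq> 0 \<Longrightarrow> g x = F' v / G' v" by (rule proj_genE) blast
  have G: "homfun I (d + e) (\<lambda>v. G v * G' v)" by (rule homfun.mult[OF D(3) E(3)])
  have "homfun I (d + e) (\<lambda>v. F v * G' v + F' v * G v)"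
    using homfun.add[OF homfun.mult[OF D(2) E(3)]] homfun.mult[OF E(2) D(3)] by (simp add: add.commute)
  note g1 = this
  show "\<exists>C h. (C, h) \<in> proj_gen I \<and> x \<in> C \<and> (\<forall>y\<in>C \<inter> D \<inter> E. h y = f y + g y)"
  proof (rule exI, rule exI, intro conjI, rule proj_genI[OF g1 G])
    show "x \<in> {x \<in> proj_points I. \<forall>v\<in>x. G v * G' v \<noteq> 0}" using x D E by auto
    show "\<forall>y\<in>{x \<in> proj_points I. \<forall>v\<in>x. G v * G' v \<noteq> 0} \<inter> D \<inter> E.
       (F (SOME v. v \<in> y) * G' (SOME v. v \<in> y) + F' (SOME v. v \<in> y) * G (SOME v. v \<in> y)) /
       (G (SOME v. v \<in> y) * G' (SOME v. v \<in> y)) = f y + g y"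
    proof
      fix y assume y: "y \<in> {x \<in> proj_points I. \<forall>v\<in>x. G v * G' v \<noteq> 0} \<inter> D \<inter> E"
      then have s: "(SOME v. v \<in> y) \<in> y" by (auto intro: proj_points_some)
      have "G (SOME v. v \<in> y) \<noteq> 0" "G' (SOME v. v \<in> y) \<noteq> 0" using y s by auto
      then show "(F (SOME v. v \<in> y) * G' (SOME v. v \<in> y) + F' (SOME v. v \<in> y) * G (SOME v. v \<in> y)) /
         (G (SOME v. v \<in> y) * G' (SOME v. v \<in> y)) = f y + g y"
        using D(4)[OF _ s] E(4)[OF _ s] y by (simp add: add_frac_eq)
    qed
  qed
  show "\<exists>C h. (C, h) \<in> proj_gen I \<and> x \<in> C \<and> (\<forall>y\<in>C \<inter> D \<inter> E. h y = f y * g y)"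
  proof (rule exI, rule exI, intro conjI, rule proj_genI[OF homfun.mult[OF D(2) E(2)] G])
    show "x \<in> {x \<in> proj_points I. \<forall>v\<in>x. G v * G' v \<noteq> 0}" using x D E by auto
    show "\<forall>y\<in>{x \<in> proj_points I. \<forall>v\<in>x. G v * G' v \<noteq> 0} \<inter> D \<inter> E.
       F (SOME v. v \<in> y) * F' (SOME v. v \<in> y) / (G (SOME v. v \<in> y) * G' (SOME v. v \<in> y)) = f y * g y"
    proof
      fix y assume y: "y \<in> {x \<in> proj_points I. \<forall>v\<in>x. G v * G' v \<noteq> 0} \<inter> D \<inter> E"
      then have s: "(SOME v. v \<in> y) \<in> y" by (auto intro: proj_points_some)
      have "G (SOME v. v \<in> y) \<noteq> 0" "G' (SOME v. v \<in> y) \<noteq> 0" using y s by auto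
      then show "F (SOME v. v \<in> y) * F' (SOME v. v \<in> y) / (G (SOME v. v \<in> y) * G' (SOME v. v \<in> y)) = f y * g y"
        using D(4)[OF _ s] E(4)[OF _ s] y by simp
    qed
  qed
next
  fix D f x assume "(D, f) \<in> proj_gen I" and x: "x \<in> D" "f x \<noteq> 0"
  then obtain F G d where D: "D = {x \<in> proj_points I. \<forall>v\<in>x. G v \<noteq> 0}" "homfun I d F" "homfun I d G"
    "\<And>x v. x \<in> proj_points I \<Longrightarrow> v \<in> x \<Longrightarrow> G v \<noteq> 0 \<Longrightarrow> f x = F v / G v" by (auto elim!: proj_genE)
  show "\<exists>C h. (C, h) \<in> proj_gen I \<and> x \<in> C \<and> (\<forall>y\<in>C \<inter> D. f y \<noteq> 0 \<and> h y = inverse (f y))"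
  proof (rule exI, rule exI, intro conjI, rule proj_genI[OF D(3) D(2)])
    show "x \<in> {x \<in> proj_points I. \<forall>v\<in>x. F v \<noteq> 0}"
      using x D(1) D(4)[of x] by fastforce
    show "\<forall>y\<in>{x \<in> proj_points I. \<forall>v\<in>x. F v \<noteq> 0} \<inter> D. f y \<noteq> 0 \<and>
       G (SOME v. v \<in> y) / F (SOME v. v \<in> y) = inverse (f y)"
    proof
      fix y assume y: "y \<in> {x \<in> proj_points I. \<forall>v\<in>x. F v \<noteq> 0} \<inter> D"
      then have s: "(SOME v. v \<in> y) \<in> y" by (auto intro: proj_points_some)
      then have "F (SOME v. v \<in> y) \<noteq> 0" "G (SOME v. v \<in> y) \<noteq> 0" using y D(1) by auto
      then show "f y \<noteq> 0 \<and> G (SOME v. v \<in> y) / F (SOME v. v \<in> y) = inverse (f y)"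
        using D(4)[OF _ s] y by simp
    qed
  qed
qed

lemma reg_proj_quotient:
  assumes "homfun I d F" "homfun I d G"
    and "\<And>x v. x \<in> proj_points I \<Longrightarrow> v \<in> x \<Longrightarrow> G v \<noteq> 0 \<Longrightarrow> f x = F v / G v"
  shows "reg (proj_space I) {x \<in> proj_points I. \<forall>v\<in>x. G v \<noteq> 0} f"
proof -
  have "({x \<in> proj_points I. \<forall>v\<in>x. G v \<noteq> 0}, f) \<in> proj_gen I"
    unfolding proj_gen_def using assms by blast
  then show ?thesis unfolding proj_space_gen by (rule reg_fspace_fromI)
qed

lemma openin_proj_nonzero:
  "homfun I d G \<Longrightarrow> openin (ztop (proj_space I)) {x \<in> proj_points I. \<forall>v\<in>x. G v \<noteq> 0}"
  by (rule reg_openin[OF space_with_functions_proj reg_proj_quotient]) auto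

lemma closedin_proj_zero:
  assumes "homfun I d G"
  shows "closedin (ztop (proj_space I)) {x \<in> proj_points I. \<forall>v\<in>x. G v = 0}"
proof -
  have "proj_points I - {x \<in> proj_points I. \<forall>v\<in>x. G v = 0} = {x \<in> proj_points I. \<forall>v\<in>x. G v \<noteq> 0}"
    using homfun_nonzero_line[OF assms] proj_points_nonempty by blast
  then show ?thesis
    using openin_proj_nonzero[OF assms] unfolding closedin_def points_proj_space by auto
qed

text \<open>Homogeneous coordinates that are regular near each point suffice: a generator of
  projective space pulls back to the quotient of two forms evaluated at \<open>m\<close>. Different
  neighbourhoods may use different \<open>m\<close>, since only membership in the line
  \<open>f y\<close> is required.\<close>

lemma morphism_projI:
  assumes Z: "space_with_functions Z"
    and pts: "\<And>z. z \<in> points Z \<Longrightarrow> f z \<in> proj_points I"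
    and loc: "\<And>z. z \<in> points Z \<Longrightarrow> \<exists>V m. openin (ztop Z) V \<and> z \<in> V \<and> (\<forall>i\<in>I. reg Z V (m i)) \<and>
      (\<forall>y\<in>V. (\<lambda>i. if i \<in> I then m i y else 0) \<in> f y)"
  shows "morphism Z (proj_space I) f"
  unfolding proj_space_gen
proof (rule morphism_fspace_fromI[OF Z])
  fix z assume "z \<in> points Z"
  from pts[OF this] show "f z \<in> \<Union> (fst ` proj_gen I)"
    unfolding points_proj_space[symmetric] proj_space_gen points_fspace_from .
next
  fix D g z assume "(D, g) \<in> proj_gen I" and z: "z \<in> points Z" "f z \<in> D"
  then obtain F G d where D: "D = {x \<in> proj_points I. \<forall>v\<in>x. G v \<noteq> 0}" "homfun I d F" "homfun I d G"
    "\<And>x v. x \<in> proj_points I \<Longrightarrow> v \<in> x \<Longrightarrow> G v \<noteq> 0 \<Longrightarrow> g x = F v / G v" by (auto elim!: proj_genE)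
  from loc[OF z(1)] obtain V m where V: "openin (ztop Z) V" "z \<in> V" "\<And>i. i \<in> I \<Longrightarrow> reg Z V (m i)"
    "\<And>y. y \<in> V \<Longrightarrow> (\<lambda>i. if i \<in> I then m i y else 0) \<in> f y" by blast
  define u where "u y = (\<lambda>i. if i \<in> I then m i y else 0)" for y
  have u: "u y \<in> f y" if "y \<in> V" for y using V(4)[OF that] by (simp add: u_def)
  have VZ: "V \<subseteq> points Z" using openin_subset[OF V(1)] .
  have r: "reg Z V (\<lambda>y. H (u y))" if "homfun I e H" for e H
    unfolding u_def by (rule reg_homfun[OF Z that V(1)]) (simp add: V(3) if_distrib)
  let ?W = "{y \<in> V. G (u y) \<noteq> 0}"
  have o: "openin (ztop Z) ?W" by (rule openin_nonzero[OF Z r[OF D(3)]])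
  have "reg Z ?W (\<lambda>y. F (u y) / G (u y))"
    by (intro reg_divide[OF Z] reg_subset[OF Z r[OF D(2)] o] reg_subset[OF Z r[OF D(3)] o]) auto
  then have "reg Z ?W (\<lambda>y. g (f y))"
  proof (rule reg_cong[OF Z])
    fix y assume y: "y \<in> ?W"
    then have "f y \<in> proj_points I" "u y \<in> f y" "G (u y) \<noteq> 0" using pts VZ u by auto
    then show "g (f y) = F (u y) / G (u y)" by (rule D(4))
  qed
  moreover have "?W \<subseteq> {y \<in> points Z. f y \<in> D}"
  proof
    fix y assume y: "y \<in> ?W"
    then have "f y \<in> proj_points I" using pts VZ by blast
    then show "y \<in> {y \<in> points Z. f y \<in> D}"
      using homfun_nonzero_line[OF D(3) _ u[of y]] y VZ unfolding D(1) by auto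
  qed
  moreover have "z \<in> ?W" using z u V(2) unfolding D(1) by auto
  ultimately show "\<exists>V. z \<in> V \<and> V \<subseteq> {z \<in> points Z. f z \<in> D} \<and> reg Z V (\<lambda>z. g (f z))"
    by (intro exI[of _ ?W] conjI)
qed

text \<open>Nonvanishing of a form persists under coordinatewise convergence, so a Zariski open set
  around the limit is eventually entered. In this way limits over the complex numbers show
  membership in Zariski closures.\<close>

lemma eventually_line_in_open:
  assumes U: "openin (ztop (proj_space I)) U" and g0: "line g0 \<in> U"
    and g: "\<And>t. g t \<in> vectors I" and lim: "\<And>i. i \<in> I \<Longrightarrow> ((\<lambda>t. g t i) \<longlongrightarrow> g0 i) A"
  shows "\<forall>\<^sub>F t in A. line (g t) \<in> U"
proof -
  from U have "generate_topology_on (fst ` proj_gen I) U"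
    unfolding proj_space_gen fspace_from_ztop openin_topology_generated_by_iff .
  then show ?thesis using g0
  proof induction
    case Empty then show ?case by simp
  next
    case (Int a b) then show ?case by (auto intro: eventually_conj)
  next
    case (UN K) then obtain k where "k \<in> K" "line g0 \<in> k" by auto
    with UN have "\<forall>\<^sub>F t in A. line (g t) \<in> k" by blast
    then show ?case by eventually_elim (use \<open>k \<in> K\<close> in blast)
  next
    case (Basis s)
    then obtain f where "(s, f) \<in> proj_gen I" by auto
    then obtain F G d where s: "s = {x \<in> proj_points I. \<forall>v\<in>x. G v \<noteq> 0}" "homfun I d G"
      by (auto elim!: proj_genE)
    have "line g0 \<in> proj_points I" "G g0 \<noteq> 0" using Basis s line_self by auto
    \<comment> \<open>A nonzero coordinate of the limit keeps \<open>g t\<close> nonzero, so that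
      its line is a point of projective space at all.\<close>
    then obtain i where i: "i \<in> I" "g0 i \<noteq> 0" by (metis proj_points_coord line_self)
    have "\<forall>\<^sub>F t in A. G (g t) \<noteq> 0"
      by (rule tendsto_imp_eventually_ne[OF homfun_tendsto[OF s(2) lim] \<open>G g0 \<noteq> 0\<close>])
    moreover have "\<forall>\<^sub>F t in A. g t i \<noteq> 0"
      by (rule tendsto_imp_eventually_ne[OF lim[OF i(1)] i(2)])
    ultimately show ?case
    proof eventually_elim
      case (elim t)
      then show ?case using line_in_proj_points[OF g elim(2)] homfun_nonzero_line[OF s(2) _ line_self]
        unfolding s(1) by auto
    qed
  qed
qed

section \<open>Minors\<close>

text \<open>The rows are listed by a function which need not be increasing, so that a row can be
  replaced or permuted without sorting; the columns are always the first \<open>k\<close>.\<close>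

definition minor :: "nat \<Rightarrow> (nat \<Rightarrow> nat \<Rightarrow> complex) \<Rightarrow> (nat \<Rightarrow> nat) \<Rightarrow> complex" where
  "minor k A \<rho> = det (mat k k (\<lambda>(a, b). A (\<rho> a) b))"

lemma permutes_lessThan: "p permutes {0..<k} \<Longrightarrow> a < k \<Longrightarrow> p a < k" for a k :: nat
  using permutes_in_image[of p "{0..<k}" a] by simp

lemma minor_leibniz:
  "minor k A \<rho> = (\<Sum>p | p permutes {0..<k}. signof p * (\<Prod>a = 0..<k. A (\<rho> a) (p a)))"
  unfolding minor_def
  by (subst det_def'[of _ k]) (auto intro!: sum.cong prod.cong simp: permutes_lessThan)

lemma minor_cong: "(\<And>a b. a < k \<Longrightarrow> b < k \<Longrightarrow> A (\<rho> a) b = B (\<sigma> a) b) \<Longrightarrow> minor k A \<rho> = minor k B \<sigma>"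
  unfolding minor_def by (rule arg_cong[of _ _ det], rule cong_mat) auto

lemma minor_permute:
  assumes "p permutes {0..<k}"
  shows "minor k A (\<lambda>a. \<rho> (p a)) = signof p * minor k A \<rho>"
proof -
  let ?M = "mat k k (\<lambda>(a, b). A (\<rho> a) b)"
  have "mat k k (\<lambda>(i, j). ?M $$ (p i, j)) = mat k k (\<lambda>(a, b). A (\<rho> (p a)) b)"
    by (rule cong_mat) (auto simp: permutes_lessThan[OF assms])
  then show ?thesis
    using det_permute_rows[of ?M k p] assms unfolding minor_def by simp
qed

text \<open>A nonzero Leibniz term is a perfect matching of the selected rows with the columns
  through nonzero entries. Vanishing statements about Pluecker coordinates are read off from such
  matchings.\<close>

lemma minor_nonzero_matching:
  assumes "minor k A \<rho> \<noteq> 0"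
  obtains p where "p permutes {0..<k}" "\<And>a. a < k \<Longrightarrow> A (\<rho> a) (p a) \<noteq> 0"
proof -
  from assms obtain p where "p permutes {0..<k}" "signof p * (\<Prod>a = 0..<k. A (\<rho> a) (p a)) \<noteq> 0"
    unfolding minor_leibniz by (auto elim: sum.not_neutral_contains_not_neutral)
  then show ?thesis using that by auto
qed

lemma minor_nonzero_inj:
  assumes "minor k A \<rho> \<noteq> 0"
  shows "inj_on \<rho> {..<k}"
proof (rule inj_onI, rule ccontr)
  fix a b assume ab: "a \<in> {..<k}" "b \<in> {..<k}" "\<rho> a = \<rho> b" "a \<noteq> b"
  let ?M = "mat k k (\<lambda>(a, b). A (\<rho> a) b)"
  have "row ?M a = row ?M b" using ab by (intro eq_vecI) auto
  then have "det ?M = 0" using ab by (intro det_identical_rows[of ?M k a b]) auto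
  with assms show False by (simp add: minor_def)
qed

text \<open>Every Leibniz term uses each selected row and each column exactly once.\<close>

lemma minor_scale:
  "minor k (\<lambda>i j. r i * A i j * c j) \<rho> = (\<Prod>a<k. r (\<rho> a)) * (\<Prod>b<k. c b) * minor k A \<rho>"
proof -
  have "(\<Prod>a = 0..<k. r (\<rho> a) * A (\<rho> a) (p a) * c (p a)) =
      (\<Prod>a<k. r (\<rho> a)) * (\<Prod>b<k. c b) * (\<Prod>a = 0..<k. A (\<rho> a) (p a))"
    if "p permutes {0..<k}" for p
    using prod.permute[OF that, of c] by (simp add: prod.distrib lessThan_atLeast0 o_def)
  then show ?thesis
    unfolding minor_leibniz sum_distrib_left by (intro sum.cong) (auto simp: mult_ac)
qed

lemma minor_diagonal:
  assumes "\<And>p. p permutes {0..<k} \<Longrightarrow> (\<And>a. a < k \<Longrightarrow> A (\<rho> a) (p a) \<noteq> 0) \<Longrightarrow> p = id"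
  shows "minor k A \<rho> = (\<Prod>a<k. A (\<rho> a) a)"
proof -
  have "signof p * (\<Prod>a = 0..<k. A (\<rho> a) (p a)) = 0" if "p permutes {0..<k}" "p \<noteq> id" for p
    using assms[OF that(1)] that(2) by auto
  then have "minor k A \<rho> = (\<Sum>p\<in>{id}. signof p * (\<Prod>a = 0..<k. A (\<rho> a) (p a)))"
    unfolding minor_leibniz
    by (intro sum.mono_neutral_right finite_permutations) (auto simp: permutes_id)
  then show ?thesis by (simp add: lessThan_atLeast0 sign_id)
qed

text \<open>The normal form of a matrix on the affine chart of the Grassmannian where the minor of
  the rows \<open>\<sigma>\<close> is nonzero.\<close>

definition unit_rows :: "nat \<Rightarrow> (nat \<Rightarrow> nat \<Rightarrow> complex) \<Rightarrow> (nat \<Rightarrow> nat) \<Rightarrow> bool" where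
  "unit_rows k A \<sigma> \<longleftrightarrow> (\<forall>a<k. \<forall>b<k. A (\<sigma> a) b = (if a = b then 1 else 0))"

text \<open>All selected rows except the new one are unit vectors, which forces the matching of rows
  and columns to be the identity. Hence the entries of a normalised matrix are themselves minors,
  which gives both coordinate functions and exchange arguments.\<close>

lemma minor_replace_row:
  assumes "unit_rows k A \<sigma>" "l < k"
  shows "minor k A (\<sigma>(l := i)) = A i l"
proof -
  have "minor k A (\<sigma>(l := i)) = (\<Prod>a<k. A ((\<sigma>(l := i)) a) a)"
  proof (rule minor_diagonal)
    fix p assume p: "p permutes {0..<k}" and nz: "\<And>a. a < k \<Longrightarrow> A ((\<sigma>(l := i)) a) (p a) \<noteq> 0"
    have fix1: "p a = a" if "a \<noteq> l" for a
    proof (cases "a < k")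
      case True
      then show ?thesis using nz[OF True] that assms(1) permutes_lessThan[OF p True]
        by (auto simp: unit_rows_def split: if_splits)
    next
      case False then show ?thesis using p by (auto simp: permutes_def)
    qed
    have "p l = l"
    proof (rule ccontr)
      assume "p l \<noteq> l"
      then have "p (p l) = p l" by (rule fix1)
      then show False using permutes_inj[OF p] \<open>p l \<noteq> l\<close> by (auto dest: injD)
    qed
    with fix1 show "p = id" by (metis eq_id_iff)
  qed
  also have "\<dots> = A i l * (\<Prod>a\<in>{..<k} - {l}. A ((\<sigma>(l := i)) a) a)"
    using assms(2) by (subst prod.remove[of _ l]) auto
  also have "(\<Prod>a\<in>{..<k} - {l}. A ((\<sigma>(l := i)) a) a) = 1"
    using assms(1) by (intro prod.neutral) (auto simp: unit_rows_def)
  finally show ?thesis by (simp only: mult_1_right)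
qed

lemma minor_unit_rows:
  assumes "unit_rows k A \<sigma>" shows "minor k A \<sigma> = 1"
proof -
  have "mat k k (\<lambda>(a, b). A (\<sigma> a) b) = 1\<^sub>m k"
    using assms by (intro eq_matI) (auto simp: unit_rows_def)
  then show ?thesis by (simp add: minor_def)
qed

lemma minor_mult_right:
  assumes "h \<in> carrier_mat k k"
  shows "minor k (\<lambda>i j. \<Sum>l<k. A i l * h $$ (l, j)) \<rho> = minor k A \<rho> * det h"
proof -
  let ?M = "mat k k (\<lambda>(a, b). A (\<rho> a) b)"
  have "mat k k (\<lambda>(a, b). \<Sum>l<k. A (\<rho> a) l * h $$ (l, b)) = ?M * h"
    using assms by (intro eq_matI) (auto simp: scalar_prod_def lessThan_atLeast0)
  then show ?thesis using det_mult[of ?M k h] assms by (simp add: minor_def)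
qed

text \<open>Multiplication on the right by the inverse of the square submatrix on the rows
  \<open>\<sigma>\<close> multiplies all minors by the same constant, so the point of the
  Grassmannian is unchanged.\<close>

lemma minor_normalise:
  assumes "minor k A \<sigma> \<noteq> 0"
  obtains B c where "c \<noteq> 0" "unit_rows k B \<sigma>" "\<And>\<rho>. minor k A \<rho> = c * minor k B \<rho>"
    "\<And>i. (\<And>l. l < k \<Longrightarrow> A i l = 0) \<Longrightarrow> (\<And>l. l < k \<Longrightarrow> B i l = 0)"
proof -
  let ?M = "mat k k (\<lambda>(a, b). A (\<sigma> a) b)"
  define h where "h = (1 / minor k A \<sigma>) \<cdot>\<^sub>m adj_mat ?M"
  have h: "h \<in> carrier_mat k k" using adj_mat[of ?M k] by (simp add: h_def)
  define B where "B = (\<lambda>i j. \<Sum>l<k. A i l * h $$ (l, j))"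
  have mm: "?M * h = 1\<^sub>m k"
    using adj_mat[of ?M k] assms unfolding h_def minor_def
    by (subst mult_smult_distrib) auto
  have u: "unit_rows k B \<sigma>"
    unfolding unit_rows_def
  proof (intro allI impI)
    fix a b assume ab: "a < k" "b < k"
    have "B (\<sigma> a) b = (?M * h) $$ (a, b)"
      using h ab by (simp add: B_def scalar_prod_def lessThan_atLeast0)
    then show "B (\<sigma> a) b = (if a = b then 1 else 0)" using ab by (simp add: mm)
  qed
  have m: "minor k B \<rho> = minor k A \<rho> * det h" for \<rho>
    unfolding B_def by (rule minor_mult_right[OF h])
  have d: "minor k A \<sigma> * det h = 1" using m[of \<sigma>] minor_unit_rows[OF u] by simp
  show ?thesis
  proof (rule that[of "minor k A \<sigma>" B])
    show "minor k A \<rho> = minor k A \<sigma> * minor k B \<rho>" for \<rho>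
      using d by (simp add: m mult_ac)
    show "B i l = 0" if "\<And>l. l < k \<Longrightarrow> A i l = 0" "l < k" for i l
      using that by (simp add: B_def)
  qed (use assms u in auto)
qed

lemma minor_tendsto:
  assumes "\<And>a b. a < k \<Longrightarrow> b < k \<Longrightarrow> ((\<lambda>t. A t (\<rho> a) b) \<longlongrightarrow> B (\<rho> a) b) F"
  shows "((\<lambda>t. minor k (A t) \<rho>) \<longlongrightarrow> minor k B \<rho>) F"
  unfolding minor_leibniz
  by (intro tendsto_intros assms) (auto intro: permutes_lessThan)

lemma reg_minor:
  assumes "space_with_functions X" "openin (ztop X) U"
    and "\<And>a b. a < k \<Longrightarrow> b < k \<Longrightarrow> reg X U (\<lambda>x. A x (\<rho> a) b)"
  shows "reg X U (\<lambda>x. minor k (A x) \<rho>)"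
  unfolding minor_def by (rule reg_det[OF assms(1,2), of k "\<lambda>a b x. A x (\<rho> a) b"]) (use assms in auto)

section \<open>Increasing enumeration of index sets\<close>

lemma pick_props:
  assumes "finite S" "card S = k"
  shows "pick S ` {..<k} = S" "strict_mono_on {..<k} (pick S)" "inj_on (pick S) {..<k}"
proof -
  show m: "strict_mono_on {..<k} (pick S)"
    using assms pick_mono_le[of _ S] by (auto simp: strict_mono_on_def)
  then show i: "inj_on (pick S) {..<k}" by (rule strict_mono_on_imp_inj_on)
  have "pick S ` {..<k} \<subseteq> S" using assms pick_in_set_le[of _ S] by auto
  moreover have "card (pick S ` {..<k}) = card S" using card_image[OF i] assms by simp
  ultimately show "pick S ` {..<k} = S" using card_subset_eq[OF assms(1)] by blast
qed

lemma inj_on_pick_permutation: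
  assumes "inj_on \<rho> {..<k}"
  obtains p where "p permutes {0..<k}" "\<And>a. a < k \<Longrightarrow> \<rho> a = pick (\<rho> ` {..<k}) (p a)"
proof -
  let ?S = "\<rho> ` {..<k}"
  have S: "finite ?S" "card ?S = k" using card_image[OF assms] by auto
  note pp = pick_props[OF S]
  define g where "g = the_inv_into {..<k} (pick ?S)"
  define p where "p a = (if a < k then g (\<rho> a) else a)" for a
  have bg: "bij_betw g ?S {..<k}"
    unfolding g_def using bij_betw_the_inv_into[of "pick ?S" "{..<k}" ?S] pp by (auto simp: bij_betw_def)
  have "bij_betw (g \<circ> \<rho>) {..<k} {..<k}"
    using bij_betw_trans[OF inj_on_imp_bij_betw[OF assms] bg] .
  then have b: "bij_betw p {..<k} {..<k}"
    by (rule bij_betw_cong[THEN iffD1, rotated]) (simp add: p_def)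
  have pm: "p permutes {0..<k}"
    by (rule bij_imp_permutes) (use b in \<open>auto simp: lessThan_atLeast0 p_def\<close>)
  have "\<rho> a = pick ?S (p a)" if "a < k" for a
    using that f_the_inv_into_f[OF pp(3), of "\<rho> a"] pp(1) by (simp add: p_def g_def)
  with pm that show ?thesis by blast
qed

text \<open>The sign \<open>e\<close> depends on the order of the rows only and not on the matrix,
  so it can serve as a constant coefficient of a linear form in the Pluecker coordinates.\<close>

lemma minor_image:
  assumes "inj_on \<rho> {..<k}"
  obtains e :: complex where "e * e = 1" "\<And>A. minor k A \<rho> = e * minor k A (pick (\<rho> ` {..<k}))"
proof -
  obtain p where p: "p permutes {0..<k}" "\<And>a. a < k \<Longrightarrow> \<rho> a = pick (\<rho> ` {..<k}) (p a)"
    using inj_on_pick_permutation[OF assms] by blast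
  have "minor k A \<rho> = signof p * minor k A (pick (\<rho> ` {..<k}))" for A
    unfolding minor_permute[OF p(1), symmetric] by (rule minor_cong) (simp add: p(2))
  moreover have "signof p * signof p = (1::complex)" by (simp add: sign_def)
  ultimately show ?thesis using that by blast
qed

text \<open>If w j < s j, then \<open>p\<close> maps the k - j indices from j on injectively into
  the k - j - 1 indices beyond j, which is impossible. This turns a matching into the componentwise
  comparison of index sets.\<close>

lemma strict_mono_matching_le:
  fixes s w :: "nat \<Rightarrow> nat"
  assumes s: "strict_mono_on {..<k} s" and w: "strict_mono_on {..<k} w"
    and p: "p permutes {0..<k}" and le: "\<And>a. a < k \<Longrightarrow> s a \<le> w (p a)" and j: "j < k"
  shows "s j \<le> w j"
proof (rule ccontr)
  assume "\<not> s j \<le> w j"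
  then have lt: "w j < s j" by simp
  have "p a \<in> {j<..<k}" if "a \<in> {j..<k}" for a
  proof -
    have "s j \<le> s a" using that j strict_mono_on_leD[OF s, of j a] by auto
    with lt le[of a] that have "w j < w (p a)" by auto
    moreover have "p a < k" using permutes_lessThan[OF p] that by auto
    ultimately show ?thesis using j strict_mono_on_leD[OF w, of "p a" j]
      by (metis greaterThanLessThan_iff lessThan_iff not_le)
  qed
  then have "p ` {j..<k} \<subseteq> {j<..<k}" by auto
  then have "card (p ` {j..<k}) \<le> card {j<..<k}" by (rule card_mono[rotated]) simp
  moreover have "card (p ` {j..<k}) = k - j"
    using permutes_inj_on[OF p] by (simp add: card_image)
  ultimately show False using j by simp
qed

section \<open>The projective special linear group\<close>

lemma SL_simps [simp]:
  "carrier (SL n) = {g \<in> carrier_mat n n. det g = 1}"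
  "monoid.mult (SL n) = (*)" "one (SL n) = 1\<^sub>m n"
  by (simp_all add: SL_def)

lemma smult_smult_times: "a \<cdot>\<^sub>m (b \<cdot>\<^sub>m A) = (a * b) \<cdot>\<^sub>m (A :: 'a :: semigroup_mult mat)"
  by (rule eq_matI) (auto simp: mult.assoc)

lemma one_smult_mat: "1 \<cdot>\<^sub>m A = (A :: 'a :: monoid_mult mat)"
  by (rule eq_matI) auto

lemma SL_group: "Group.group (SL n)"
proof (rule groupI)
  fix x y assume "x \<in> carrier (SL n)" "y \<in> carrier (SL n)"
  then show "x \<otimes>\<^bsub>SL n\<^esub> y \<in> carrier (SL n)" using det_mult[of x n y] by (auto intro: mult_carrier_mat)
next
  fix x assume x: "x \<in> carrier (SL n)"
  then have a: "adj_mat x \<in> carrier_mat n n" "adj_mat x * x = 1\<^sub>m n"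
    using adj_mat[of x n] by auto
  have "det (adj_mat x) * det x = 1" using det_mult[of "adj_mat x" n x] a x by simp
  with a x show "\<exists>y\<in>carrier (SL n). y \<otimes>\<^bsub>SL n\<^esub> x = \<one>\<^bsub>SL n\<^esub>" by (intro bexI[of _ "adj_mat x"]) auto
qed (auto simp: assoc_mult_mat[of _ n n _ n _ n])

lemma SL_center_eq: "SL_center n = {c \<cdot>\<^sub>m 1\<^sub>m n | c. c ^ n = 1}"
  by (auto simp: SL_center_def)

lemma SL_center_normal: "normal (SL_center n) (SL n)"
proof -
  interpret G: Group.group "SL n" by (rule SL_group)
  have "subgroup (SL_center n) (SL n)"
  proof (rule G.subgroupI)
    show "SL_center n \<subseteq> carrier (SL n)" by (auto simp: SL_center_def)
    show "SL_center n \<noteq> {}" by (auto simp: SL_center_eq intro: exI[of _ 1])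
  next
    fix a assume "a \<in> SL_center n"
    then obtain c where c: "a = c \<cdot>\<^sub>m 1\<^sub>m n" "c ^ n = 1" by (auto simp: SL_center_eq)
    have "inv\<^bsub>SL n\<^esub> a = inverse c \<cdot>\<^sub>m 1\<^sub>m n"
    proof (rule G.inv_equality)
      show "inverse c \<cdot>\<^sub>m 1\<^sub>m n \<otimes>\<^bsub>SL n\<^esub> a = \<one>\<^bsub>SL n\<^esub>"
      \<comment> \<open>For n = 0 even the scalar 0 satisfies the condition c ^ n = 1, but there is
        only the empty matrix.\<close>
      proof (cases "n = 0")
        case False
        then have "c \<noteq> 0" using c by (auto simp: power_0_left)
        then show ?thesis
          by (simp add: c mult_smult_distrib[of _ n n _ n] mult_smult_assoc_mat[of _ n n _ n]
              smult_smult_times one_smult_mat)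
      qed (auto simp: c intro!: eq_matI)
    qed (auto simp: c power_inverse)
    then show "inv\<^bsub>SL n\<^esub> a \<in> SL_center n" using c by (auto simp: SL_center_eq power_inverse)
  next
    fix a b assume "a \<in> SL_center n" "b \<in> SL_center n"
    then obtain c d where c: "a = c \<cdot>\<^sub>m 1\<^sub>m n" "c ^ n = 1" "b = d \<cdot>\<^sub>m 1\<^sub>m n" "d ^ n = 1" by (auto simp: SL_center_eq)
    have "a * b = (c * d) \<cdot>\<^sub>m 1\<^sub>m n"
      by (simp add: c mult_smult_distrib[of _ n n _ n] mult_smult_assoc_mat[of _ n n _ n] smult_smult_times mult.commute)
    then show "a \<otimes>\<^bsub>SL n\<^esub> b \<in> SL_center n" using c by (auto simp: SL_center_eq power_mult_distrib)
  qed
  then show ?thesis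
  proof (rule G.normalI, intro ballI)
    fix x assume "x \<in> carrier (SL n)"
    then have x: "x \<in> carrier_mat n n" by simp
    have "h * x = x * h" if "h \<in> SL_center n" for h
      using that x by (auto simp: SL_center_eq mult_smult_distrib[of _ n n _ n] mult_smult_assoc_mat[of _ n n _ n])
    then show "SL_center n #>\<^bsub>SL n\<^esub> x = x <#\<^bsub>SL n\<^esub> SL_center n"
      by (auto simp: r_coset_def l_coset_def)
  qed
qed

lemma PSL_group: "Group.group (PSL n)"
  unfolding PSL_def by (rule normal.factorgroup_is_group[OF SL_center_normal])

lemma center_coset:
  assumes "g \<in> carrier_mat n n"
  shows "SL_center n #>\<^bsub>SL n\<^esub> g = {c \<cdot>\<^sub>m g | c. c ^ n = 1}"
proof -
  have "c \<cdot>\<^sub>m 1\<^sub>m n * g = c \<cdot>\<^sub>m g" for c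
    using assms by (simp add: mult_smult_assoc_mat[of _ n n _ n])
  then show ?thesis by (auto simp: r_coset_def SL_center_eq)
qed

lemma PSL_carrier: "carrier (PSL n) = (\<lambda>g. {c \<cdot>\<^sub>m g | c. c ^ n = 1}) ` carrier (SL n)"
  unfolding PSL_def carrier_FactGroup by (rule image_cong) (auto simp: center_coset)

lemma PSL_coset:
  assumes C: "C \<in> carrier (PSL n)" and g: "g \<in> C" and n: "n > 0"
  shows "g \<in> carrier (SL n)" "C = {c \<cdot>\<^sub>m g | c. c ^ n = 1}"
proof -
  from C obtain h where h: "h \<in> carrier_mat n n" "det h = 1" "C = {c \<cdot>\<^sub>m h | c. c ^ n = 1}"
    unfolding PSL_carrier by auto
  with g obtain c where c: "g = c \<cdot>\<^sub>m h" "c ^ n = 1" by auto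
  then have c0: "c \<noteq> 0" using n by (auto simp: power_0_left)
  show "g \<in> carrier (SL n)" using h c by simp
  show "C = {c \<cdot>\<^sub>m g | c. c ^ n = 1}"
  proof (intro equalityI subsetI)
    fix x assume "x \<in> C"
    then obtain d where d: "x = d \<cdot>\<^sub>m h" "d ^ n = 1" using h by auto
    then have "x = (d / c) \<cdot>\<^sub>m g" using c0 by (simp add: c smult_smult_times)
    moreover have "(d / c) ^ n = 1" using c d by (simp add: power_divide)
    ultimately show "x \<in> {c \<cdot>\<^sub>m g | c. c ^ n = 1}" by blast
  next
    fix x assume "x \<in> {c \<cdot>\<^sub>m g | c. c ^ n = 1}"
    then obtain d where d: "x = d \<cdot>\<^sub>m g" "d ^ n = 1" by auto
    then have "x = (d * c) \<cdot>\<^sub>m h" by (simp add: c smult_smult_times)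
    moreover have "(d * c) ^ n = 1" using c d by (simp add: power_mult_distrib)
    ultimately show "x \<in> C" using h by blast
  qed
qed

lemma PSL_class:
  assumes "g \<in> carrier (SL n)"
  obtains C where "C \<in> carrier (PSL n)" "g \<in> C" "C = {c \<cdot>\<^sub>m g | c. c ^ n = 1}"
proof -
  have "g = 1 \<cdot>\<^sub>m g" by auto
  then have "g \<in> {c \<cdot>\<^sub>m g | c. c ^ n = 1}" by (metis (mono_tags, lifting) mem_Collect_eq power_one)
  then show ?thesis using that assms unfolding PSL_carrier by blast
qed

section \<open>Pluecker vectors and the action on them\<close>

lemma plucker_indexD: "S \<in> plucker_index n k \<Longrightarrow> finite S \<and> card S = k \<and> S \<subseteq> {..<n}"
  by (auto simp: plucker_index_def intro: finite_subset)

lemma finite_plucker_index: "finite (plucker_index n k)"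
  by (rule finite_subset[of _ "Pow {..<n}"]) (auto simp: plucker_index_def)

lemma pick_plucker:
  assumes "S \<in> plucker_index n k"
  shows "pick S ` {..<k} = S" "strict_mono_on {..<k} (pick S)" "inj_on (pick S) {..<k}"
    "\<And>a. a < k \<Longrightarrow> pick S a < n" "\<And>a. a < k \<Longrightarrow> pick S a \<in> S"
proof -
  note S = plucker_indexD[OF assms]
  show p: "pick S ` {..<k} = S" "strict_mono_on {..<k} (pick S)" "inj_on (pick S) {..<k}"
    using pick_props[of S k] S by auto
  show i: "pick S a \<in> S" if "a < k" for a using p(1) that by blast
  show "pick S a < n" if "a < k" for a using i[OF that] S by auto
qed

lemma pick_lessThan: "b < k \<Longrightarrow> pick {..<k} b = b"
  using pick_card_in_set[of b "{..<k}"] by (simp add: Collect_conj_eq lessThan_def[symmetric] Int_absorb1 min_def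
      set_eq_iff)

lemma det_submatrix:
  assumes "g \<in> carrier_mat n n" "S \<in> plucker_index n k" "R \<in> plucker_index n k"
  shows "det (submatrix g S R) = minor k (\<lambda>i b. g $$ (i, pick R b)) (pick S)"
proof -
  have "{i. i < n \<and> i \<in> S} = S" "{i. i < n \<and> i \<in> R} = R"
    using assms by (auto simp: plucker_index_def)
  then show ?thesis
    using assms plucker_indexD unfolding minor_def submatrix_def by fastforce
qed

lemma ext_pow_scale:
  assumes g: "g \<in> carrier_mat n n"
  shows "ext_pow n k (c \<cdot>\<^sub>m g) (\<lambda>S. d * v S) = (\<lambda>S. c ^ k * d * ext_pow n k g v S)"
proof
  fix S
  have "det (submatrix (c \<cdot>\<^sub>m g) S R) = c ^ k * det (submatrix g S R)"
    if "S \<in> plucker_index n k" "R \<in> plucker_index n k" for R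
  proof -
    have "minor k (\<lambda>i b. (c \<cdot>\<^sub>m g) $$ (i, pick R b)) (pick S) =
        minor k (\<lambda>i b. 1 * g $$ (i, pick R b) * c) (pick S)"
      using g pick_plucker[OF that(1)] pick_plucker[OF that(2)] by (intro minor_cong) simp
    also have "\<dots> = c ^ k * minor k (\<lambda>i b. g $$ (i, pick R b)) (pick S)"
      unfolding minor_scale by simp
    finally show ?thesis using g that by (simp add: det_submatrix[of _ n _ k])
  qed
  then show "ext_pow n k (c \<cdot>\<^sub>m g) (\<lambda>S. d * v S) S = c ^ k * d * ext_pow n k g v S"
    unfolding ext_pow_def by (auto simp: sum_distrib_left mult_ac intro!: sum.cong)
qed

text \<open>Representatives of a class differ by scalars, which act on the exterior power by their
  \<open>k\<close>-th powers; hence a single representative determines the image of a line.\<close>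

lemma psl_act_line:
  assumes C: "C \<in> carrier (PSL n)" and g: "g \<in> C" and n: "n > 0"
  shows "psl_act n k C (line v) = line (ext_pow n k g v)"
proof (intro equalityI subsetI)
  note gC = PSL_coset[OF C g n]
  fix x assume "x \<in> psl_act n k C (line v)"
  then obtain c d where "c ^ n = 1" "d \<noteq> 0" "x = ext_pow n k (c \<cdot>\<^sub>m g) (\<lambda>S. d * v S)"
    unfolding psl_act_def using gC(2) by (auto elim!: lineE)
  moreover from this have "c \<noteq> 0" using n by (auto simp: power_0_left)
  ultimately show "x \<in> line (ext_pow n k g v)"
    using gC(1) lineI[of "c ^ k * d" "ext_pow n k g v"] by (simp add: ext_pow_scale)
next
  note gC = PSL_coset[OF C g n]
  fix x assume "x \<in> line (ext_pow n k g v)"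
  then obtain d where d: "d \<noteq> 0" "x = (\<lambda>S. d * ext_pow n k g v S)" by (rule lineE)
  have g1: "1 \<cdot>\<^sub>m g = g" by auto
  then have "x = ext_pow n k g (\<lambda>S. d * v S)"
    using d ext_pow_scale[of g n k 1 d v] gC(1) by simp
  then show "x \<in> psl_act n k C (line v)"
    unfolding psl_act_def using g lineI[OF d(1)] by blast
qed

text \<open>The Pluecker vector of the span of the first \<open>k\<close> columns of
  \<open>A\<close>, where \<open>A\<close> is read as a matrix with \<open>n\<close> rows.\<close>

definition plu :: "nat \<Rightarrow> nat \<Rightarrow> (nat \<Rightarrow> nat \<Rightarrow> complex) \<Rightarrow> nat set \<Rightarrow> complex" where
  "plu n k A = (\<lambda>S. if S \<in> plucker_index n k then minor k A (pick S) else 0)"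

lemma plu_vectors: "plu n k A \<in> vectors (plucker_index n k)"
  by (simp add: plu_def vectors_def)

lemma lessThan_plucker: "k \<le> n \<Longrightarrow> {..<k} \<in> plucker_index n k"
  by (auto simp: plucker_index_def)

lemma psl_act_base_point:
  assumes C: "C \<in> carrier (PSL n)" and g: "g \<in> C" and n: "n > 0" and k: "k \<le> n"
  shows "psl_act n k C (base_point k) = line (plu n k (\<lambda>i j. g $$ (i, j)))"
proof -
  have gc: "g \<in> carrier_mat n n" using PSL_coset[OF C g n] by simp
  have "ext_pow n k g (\<lambda>S. if S = {..<k} then 1 else 0) = plu n k (\<lambda>i j. g $$ (i, j))"
  proof
    fix S
    have "minor k (\<lambda>i b. g $$ (i, pick {..<k} b)) (pick S) = minor k (\<lambda>i j. g $$ (i, j)) (pick S)"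
      by (rule minor_cong) (simp add: pick_lessThan)
    then show "ext_pow n k g (\<lambda>S. if S = {..<k} then 1 else 0) S = plu n k (\<lambda>i j. g $$ (i, j)) S"
      using lessThan_plucker[OF k] finite_plucker_index[of n k] gc
      by (simp add: ext_pow_def plu_def if_distrib[of "\<lambda>x. _ * x"] det_submatrix cong: if_cong)
  qed
  then show ?thesis unfolding base_point_def by (simp add: psl_act_line[OF C g n])
qed

section \<open>Diagonal matrices\<close>

definition diagm :: "nat \<Rightarrow> (nat \<Rightarrow> complex) \<Rightarrow> complex mat" where
  "diagm n u = mat n n (\<lambda>(a, b). if a = b then u a else 0)"

lemma diagm_carrier [simp]: "diagm n u \<in> carrier_mat n n"
  by (simp add: diagm_def)

lemma det_diagm: "det (diagm n u) = (\<Prod>a<n. u a)"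
proof -
  have "minor n (\<lambda>i j. u i * (if i = j then 1 else 0) * 1) id = (\<Prod>a<n. u a)"
    unfolding minor_scale by (simp add: minor_unit_rows unit_rows_def)
  moreover have "minor n (\<lambda>i j. u i * (if i = j then 1 else 0) * 1) id = det (diagm n u)"
    unfolding minor_def diagm_def by (rule arg_cong[of _ _ det], rule cong_mat) auto
  ultimately show ?thesis by simp
qed

lemma smult_diagm: "c \<cdot>\<^sub>m diagm n u = diagm n (\<lambda>a. c * u a)"
  by (rule eq_matI) (auto simp: diagm_def)

lemma mult_diagm: "diagm n u * diagm n v = diagm n (\<lambda>a. u a * v a)"
proof (rule eq_matI)
  fix i j assume "i < dim_row (diagm n (\<lambda>a. u a * v a))" "j < dim_col (diagm n (\<lambda>a. u a * v a))"
  then have ij: "i < n" "j < n" by (auto simp: diagm_def)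
  have "(\<Sum>l\<in>{0..<n}. (if i = l then u i else 0) * (if l = j then v l else 0)) =
      (\<Sum>l\<in>{0..<n}. if l = i then (if i = j then u i * v i else 0) else 0)"
    by (rule sum.cong) auto
  with ij show "(diagm n u * diagm n v) $$ (i, j) = diagm n (\<lambda>a. u a * v a) $$ (i, j)"
    by (auto simp: diagm_def scalar_prod_def)
qed (auto simp: diagm_def)

lemma diagm_one: "diagm n (\<lambda>_. 1) = 1\<^sub>m n"
  by (rule eq_matI) (auto simp: diagm_def)

lemma diagm_cong: "(\<And>a. a < n \<Longrightarrow> u a = v a) \<Longrightarrow> diagm n u = diagm n v"
  unfolding diagm_def by (rule cong_mat) auto

text \<open>On the exterior power a diagonal matrix is diagonal again: a nonzero minor with rows
  \<open>S\<close> and columns \<open>R\<close> would match \<open>S\<close> into \<open>R\<close>,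
  and both have \<open>k\<close> elements.\<close>

lemma ext_pow_diagm:
  assumes v: "v \<in> vectors (plucker_index n k)"
  shows "ext_pow n k (diagm n u) v = (\<lambda>S. (\<Prod>i\<in>S. u i) * v S)"
proof
  fix S
  show "ext_pow n k (diagm n u) v S = (\<Prod>i\<in>S. u i) * v S"
  proof (cases "S \<in> plucker_index n k")
    case False then show ?thesis using v by (simp add: ext_pow_def vectors_def)
  next
    case S: True
    have d: "det (submatrix (diagm n u) S R) = (if S = R then \<Prod>i\<in>S. u i else 0)"
      if R: "R \<in> plucker_index n k" for R
    proof -
      have eq: "det (submatrix (diagm n u) S R) =
          minor k (\<lambda>i b. u i * (if i = pick R b then 1 else 0) * 1) (pick S)"
        unfolding det_submatrix[OF diagm_carrier S R]
        using pick_plucker[OF S] pick_plucker[OF R] by (intro minor_cong) (simp add: diagm_def)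
      show ?thesis
      proof (cases "S = R")
        case True
        have "unit_rows k (\<lambda>i b. if i = pick S b then 1 else 0) (pick S)"
          using inj_onD[OF pick_plucker(3)[OF S]] by (auto simp: unit_rows_def)
        moreover have "(\<Prod>i\<in>S. u i) = (\<Prod>a<k. u (pick S a))"
          by (subst pick_plucker(1)[OF S, symmetric]) (simp add: prod.reindex[OF pick_plucker(3)[OF S]])
        ultimately show ?thesis unfolding eq minor_scale using True by (simp add: minor_unit_rows)
      next
        case False
        have "minor k (\<lambda>i b. if i = pick R b then (1::complex) else 0) (pick S) = 0"
        proof (rule ccontr)
          assume nz: "minor k (\<lambda>i b. if i = pick R b then (1::complex) else 0) (pick S) \<noteq> 0"
          obtain p where p: "p permutes {0..<k}" "\<And>a. a < k \<Longrightarrow> (if pick S a = pick R (p a) then (1::complex) else 0) \<noteq> 0"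
            using minor_nonzero_matching[OF nz] by blast
          have "pick S a \<in> R" if "a < k" for a
          proof -
            have "pick S a = pick R (p a)" using p(2)[OF that] by (auto split: if_splits)
            then show ?thesis using pick_plucker(5)[OF R permutes_lessThan[OF p(1) that]] by simp
          qed
          then have "pick S ` {..<k} \<subseteq> R" by auto
          then have "S \<subseteq> R" by (simp only: pick_plucker(1)[OF S])
          then show False
            using False plucker_indexD[OF S] plucker_indexD[OF R] card_subset_eq[of R S] by auto
        qed
        then show ?thesis unfolding eq minor_scale using False by simp
      qed
    qed
    then show ?thesis
      using S finite_plucker_index[of n k]
      by (simp add: ext_pow_def if_distrib[of "\<lambda>x. x * _"] cong: if_cong)
  qed
qed

section \<open>The torus\<close>

text \<open>Supplies the scalar that brings an invertible matrix to determinant 1.\<close>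

lemma complex_nth_root:
  assumes "z \<noteq> 0" "n > 0"
  obtains c :: complex where "c ^ n = z" "c \<noteq> 0"
proof -
  have "card {c. c ^ n = z} = n" by (rule card_nth_roots[OF assms])
  then have "{c. c ^ n = z} \<noteq> {}" using assms(2) by (metis card.empty less_irrefl)
  then obtain c where "c ^ n = z" by blast
  then show ?thesis using that[of c] assms by (auto simp: power_0_left)
qed

lemma PSL_mult: "monoid.mult (PSL n) = set_mult (SL n)"
  unfolding PSL_def by simp

lemma PSL_one: "one (PSL n) = SL_center n"
  unfolding PSL_def by simp

lemma SL_inv_diagm:
  assumes "\<And>a. u a \<noteq> 0" "det (diagm n u) = 1"
  shows "inv\<^bsub>SL n\<^esub> (diagm n u) = diagm n (\<lambda>a. inverse (u a))"
proof (rule group.inv_equality[OF SL_group])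
  have d: "diagm n (\<lambda>a. inverse (u a)) * diagm n u = 1\<^sub>m n"
    unfolding mult_diagm diagm_one[symmetric] using assms(1) by (intro diagm_cong) simp
  then show "diagm n (\<lambda>a. inverse (u a)) \<otimes>\<^bsub>SL n\<^esub> diagm n u = \<one>\<^bsub>SL n\<^esub>" by simp
  show "diagm n u \<in> carrier (SL n)" using assms(2) by simp
  have "det (diagm n (\<lambda>a. inverse (u a))) = 1"
    using assms(2) by (simp add: det_diagm prod_inversef[unfolded o_def])
  then show "diagm n (\<lambda>a. inverse (u a)) \<in> carrier (SL n)" by simp
qed

lemma one_ps_eq:
  "one_ps n j t = {g \<in> carrier (SL n). \<exists>c. g = diagm n (\<lambda>a. c * (if a < j then t else 1))}"
  unfolding one_ps_def diagm_def[symmetric] using smult_diagm by simp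

context
  fixes q k n :: nat
  assumes q: "q > 0" and n: "n = k * q + 1"
begin

text \<open>After rescaling by an \<open>n\<close>-th root of the inverse determinant the diagonal
  matrix lies in \<open>SL\<close>; any other admissible scaling differs by an \<open>n\<close>-th
  root of unity, so the set is exactly one coset of the centre.\<close>

lemma one_ps_PSL:
  assumes "t \<noteq> 0"
  shows "one_ps n j t \<in> carrier (PSL n)"
proof -
  let ?d = "\<lambda>a. if a < j then t else 1"
  have p: "(\<Prod>a<n. ?d a) \<noteq> 0" using assms by auto
  obtain c where c: "c ^ n = inverse (\<Prod>a<n. ?d a)" "c \<noteq> 0"
    using complex_nth_root[of "inverse (\<Prod>a<n. ?d a)" n] p n by auto
  have e: "(\<Prod>a<n. e * ?d a) = e ^ n * (\<Prod>a<n. ?d a)" for e by (simp add: prod.distrib)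
  have g: "diagm n (\<lambda>a. c * ?d a) \<in> carrier (SL n)"
    using p by (simp add: det_diagm e c)
  have "one_ps n j t = {d \<cdot>\<^sub>m diagm n (\<lambda>a. c * ?d a) | d. d ^ n = 1}"
  proof (intro equalityI subsetI)
    fix h assume "h \<in> one_ps n j t"
    then obtain b where b: "h = diagm n (\<lambda>a. b * ?d a)" "det h = 1" unfolding one_ps_eq by auto
    then have "b ^ n * (\<Prod>a<n. ?d a) = 1" by (simp add: det_diagm e)
    then have "(b / c) ^ n = 1" using p by (simp add: power_divide c field_simps)
    moreover have "h = (b / c) \<cdot>\<^sub>m diagm n (\<lambda>a. c * ?d a)"
      unfolding b smult_diagm using c(2) by (intro diagm_cong) simp
    ultimately show "h \<in> {d \<cdot>\<^sub>m diagm n (\<lambda>a. c * ?d a) | d. d ^ n = 1}" by blast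
  next
    fix h assume "h \<in> {d \<cdot>\<^sub>m diagm n (\<lambda>a. c * ?d a) | d. d ^ n = 1}"
    then obtain d where d: "d ^ n = 1" "h = diagm n (\<lambda>a. d * c * ?d a)"
      by (auto simp: smult_diagm mult.assoc)
    then have "h \<in> carrier (SL n)" using g by (simp add: det_diagm e power_mult_distrib)
    then show "h \<in> one_ps n j t" unfolding one_ps_eq using d by blast
  qed
  then show ?thesis unfolding PSL_carrier using g by blast
qed

text \<open>The generator with index j * q scales precisely the blocks below \<open>j\<close>, where
  the block of a row is its quotient by \<open>q\<close>.\<close>

lemma block_less: "a < j * q \<longleftrightarrow> a div q < j"
  using q by (simp add: less_mult_imp_div_less div_less_iff_less_mult)

lemma block_bound: "a < n \<Longrightarrow> a div q \<le> k"
  using q by (simp add: n less_Suc_eq_le div_le_mono2) (metis div_le_mono nonzero_mult_div_cancel_right not_gr0)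

text \<open>Classes of invertible diagonal matrices that are constant on blocks contain the
  generators and are closed under products and inverses.\<close>

lemma T_J_class:
  assumes "C \<in> T_J q k"
  shows "C \<in> carrier (PSL n)" "\<And>g. g \<in> C \<Longrightarrow> \<exists>u. (\<forall>b. u b \<noteq> 0) \<and> g = diagm n (\<lambda>a. u (a div q))"
proof -
  interpret P: Group.group "PSL n" by (rule PSL_group)
  have n0: "n > 0" by (simp add: n)
  let ?gen = "{one_ps (k * q + 1) (j * q) t | j t. 1 \<le> j \<and> j \<le> k \<and> t \<noteq> 0}"
  have gens: "C \<in> carrier (PSL n) \<and> (\<forall>g\<in>C. \<exists>u. (\<forall>b. u b \<noteq> 0) \<and> g = diagm n (\<lambda>a. u (a div q)))"
    if "C \<in> ?gen" for C
  proof -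
    from that obtain j t where C: "C = one_ps n (j * q) t" "t \<noteq> 0" unfolding n by blast
    have "\<exists>u. (\<forall>b. u b \<noteq> 0) \<and> g = diagm n (\<lambda>a. u (a div q))" if "g \<in> C" for g
    proof -
      from that C obtain c where c: "g = diagm n (\<lambda>a. c * (if a < j * q then t else 1))" "det g = 1"
        unfolding one_ps_eq by auto
      have "c \<noteq> 0"
      proof
        assume "c = 0" then have "det g = 0" using n0 by (simp add: c(1) det_diagm)
        with c(2) show False by simp
      qed
      then show ?thesis using c(1) C(2)
        by (intro exI[of _ "\<lambda>b. c * (if b < j then t else 1)"]) (simp add: block_less)
    qed
    then show ?thesis using C one_ps_PSL by simp
  qed
  have "C \<in> carrier (PSL n) \<and> (\<forall>g\<in>C. \<exists>u. (\<forall>b. u b \<noteq> 0) \<and> g = diagm n (\<lambda>a. u (a div q)))"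
    using assms unfolding T_J_def n[symmetric]
  proof (induction rule: generate.induct)
    case one
    have "\<exists>u. (\<forall>b. u b \<noteq> 0) \<and> g = diagm n (\<lambda>a. u (a div q))" if "g \<in> SL_center n" for g
    proof -
      from that obtain c where c: "g = c \<cdot>\<^sub>m 1\<^sub>m n" "c ^ n = 1" by (auto simp: SL_center_eq)
      then have "c \<noteq> 0" using n0 by (auto simp: power_0_left)
      then show ?thesis using c by (intro exI[of _ "\<lambda>_. c"]) (simp add: diagm_one[symmetric] smult_diagm)
    qed
    then show ?case using P.one_closed by (simp only: PSL_one) blast
  next
    case (incl C) then show ?case using gens[of C] unfolding n by simp
  next
    case (inv C)
    then have C: "C \<in> carrier (PSL n)" "\<And>g. g \<in> C \<Longrightarrow> \<exists>u. (\<forall>b. u b \<noteq> 0) \<and> g = diagm n (\<lambda>a. u (a div q))"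
      using gens[of C] unfolding n by auto
    \<comment> \<open>In the factor group the inverse of a coset is the set of the inverses of its
      members.\<close>
    have i: "inv\<^bsub>PSL n\<^esub> C = set_inv\<^bsub>SL n\<^esub> C"
      using normal.inv_FactGroup[OF SL_center_normal] C(1) unfolding PSL_def by blast
    have "\<exists>u. (\<forall>b. u b \<noteq> 0) \<and> g = diagm n (\<lambda>a. u (a div q))" if "g \<in> set_inv\<^bsub>SL n\<^esub> C" for g
    proof -
      from that obtain h where h: "h \<in> C" "g = inv\<^bsub>SL n\<^esub> h" unfolding SET_INV_def by blast
      from C(2)[OF h(1)] obtain u where u: "\<forall>b. u b \<noteq> 0" "h = diagm n (\<lambda>a. u (a div q))" by blast
      have "det h = 1" using PSL_coset(1)[OF C(1) h(1) n0] by simp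
      then have "g = diagm n (\<lambda>a. inverse (u (a div q)))"
        unfolding h(2) u(2) by (intro SL_inv_diagm) (use u in auto)
      then show ?thesis using u by (intro exI[of _ "\<lambda>b. inverse (u b)"]) auto
    qed
    then show ?case using P.inv_closed[OF C(1)] unfolding i by (intro conjI ballI)
  next
    case (eng C D)
    have "\<exists>u. (\<forall>b. u b \<noteq> 0) \<and> g = diagm n (\<lambda>a. u (a div q))" if "g \<in> C <#>\<^bsub>SL n\<^esub> D" for g
    proof -
      from that obtain h h' where h: "h \<in> C" "h' \<in> D" "g = h * h'" unfolding set_mult_def by auto
      from eng.IH(1) h(1) obtain u where u: "\<forall>b. u b \<noteq> 0" "h = diagm n (\<lambda>a. u (a div q))" by blast
      from eng.IH(2) h(2) obtain v where v: "\<forall>b. v b \<noteq> 0" "h' = diagm n (\<lambda>a. v (a div q))" by blast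
      from u v show ?thesis unfolding h(3) by (intro exI[of _ "\<lambda>b. u b * v b"]) (auto simp: mult_diagm)
    qed
    then show ?case using P.m_closed[of C D] eng by (simp add: PSL_mult)
  qed
  note F = this
  show "C \<in> carrier (PSL n)" using F by (rule conjunct1)
  show "\<exists>u. (\<forall>b. u b \<noteq> 0) \<and> g = diagm n (\<lambda>a. u (a div q))" if "g \<in> C" for g
    using F[THEN conjunct2] that by (rule bspec)
qed

text \<open>Induction on the block \<open>b\<close> from which on \<open>u\<close> is constant. One
  generator, suitably rescaled, is split off, so that the remaining factor is constant already from
  block \<open>b\<close> instead of \<open>Suc b\<close>.\<close>

lemma T_J_contains_diagm:
  assumes "\<And>b. u b \<noteq> 0" "(\<Prod>a<n. u (a div q)) = 1"
  shows "\<exists>C\<in>T_J q k. diagm n (\<lambda>a. u (a div q)) \<in> C"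
proof -
  have "\<exists>C\<in>T_J q k. diagm n (\<lambda>a. u (a div q)) \<in> C"
    if "b \<le> k" "\<And>b. u b \<noteq> 0" "(\<Prod>a<n. u (a div q)) = 1" "\<And>i. b \<le> i \<Longrightarrow> i \<le> k \<Longrightarrow> u i = u k" for b u
    using that
  proof (induction b arbitrary: u)
    case 0
    \<comment> \<open>A constant \<open>u\<close> gives a scalar matrix of determinant 1, hence a
      member of the centre, which is the neutral element of the group.\<close>
    have "diagm n (\<lambda>a. u (a div q)) = diagm n (\<lambda>a. u k * 1)"
    proof (rule diagm_cong)
      fix a assume "a < n"
      then show "u (a div q) = u k * 1" using 0(4)[of "a div q"] block_bound[of a] by simp
    qed
    also have "\<dots> = u k \<cdot>\<^sub>m 1\<^sub>m n" by (simp only: smult_diagm[of "u k" n "\<lambda>_. 1", symmetric] diagm_one)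
    finally have e: "diagm n (\<lambda>a. u (a div q)) = u k \<cdot>\<^sub>m 1\<^sub>m n" .
    have "diagm n (\<lambda>a. u (a div q)) \<in> carrier (SL n)" using 0(3) by (simp add: det_diagm)
    then have "diagm n (\<lambda>a. u (a div q)) \<in> SL_center n"
      using e unfolding SL_center_def by blast
    moreover have "SL_center n \<in> T_J q k"
      unfolding T_J_def n[symmetric] PSL_one[symmetric] by (rule generate.one)
    ultimately show ?case by (rule bexI)
  next
    case (Suc b)
    \<comment> \<open>Dividing the blocks up to \<open>b\<close> by this ratio moves the value of
      block \<open>b\<close> to that of block \<open>Suc b\<close>.\<close>
    define t where "t = u b / u (Suc b)"
    have t: "t \<noteq> 0" using Suc.prems(2) by (simp add: t_def)
    let ?d = "\<lambda>i. if i < Suc b then t else 1"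
    have d: "(\<Prod>a<n. ?d (a div q)) \<noteq> 0" using t by auto
    obtain c where c: "c ^ n = inverse (\<Prod>a<n. ?d (a div q))" "c \<noteq> 0"
      using complex_nth_root[of "inverse (\<Prod>a<n. ?d (a div q))" n] d n by auto
    define h where "h = diagm n (\<lambda>a. c * ?d (a div q))"
    have pc: "(\<Prod>a<n. c * ?d (a div q)) = 1" using d by (simp add: prod.distrib c)
    have h: "h \<in> one_ps n (Suc b * q) t"
      unfolding one_ps_eq h_def using pc block_less[of _ "Suc b"] by (auto simp: det_diagm)
    define v where "v i = u i / (c * ?d i)" for i
    have "\<exists>C\<in>T_J q k. diagm n (\<lambda>a. v (a div q)) \<in> C"
    proof (rule Suc.IH)
      show "b \<le> k" using Suc.prems by simp
      show "v i \<noteq> 0" for i using Suc.prems(2) c t by (auto simp: v_def)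
      show "(\<Prod>a<n. v (a div q)) = 1" using Suc.prems(3) pc by (simp add: v_def prod_dividef)
      fix i assume i: "b \<le> i" "i \<le> k"
      have "u (Suc b) = u k" using Suc.prems(1) by (intro Suc.prems(4)) auto
      moreover have "u i = u k" if "i \<noteq> b" using i that by (intro Suc.prems(4)) auto
      ultimately show "v i = v k" using i Suc.prems(1) Suc.prems(2)[of b] Suc.prems(2)[of "Suc b"]
        by (cases "i = b") (auto simp: v_def t_def)
    qed
    then obtain C where C: "C \<in> T_J q k" "diagm n (\<lambda>a. v (a div q)) \<in> C" by blast
    have "one_ps n (Suc b * q) t \<in> T_J q k"
      unfolding T_J_def n[symmetric] using Suc.prems(1) t
      by (intro generate.incl) (auto simp: n intro!: exI[of _ "Suc b"] exI[of _ t])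
    then have "one_ps n (Suc b * q) t \<otimes>\<^bsub>PSL n\<^esub> C \<in> T_J q k"
      using C(1) unfolding T_J_def n[symmetric] by (rule generate.eng)
    moreover have "diagm n (\<lambda>a. u (a div q)) = h * diagm n (\<lambda>a. v (a div q))"
      unfolding h_def mult_diagm using c t by (intro diagm_cong) (simp add: v_def)
    then have "diagm n (\<lambda>a. u (a div q)) \<in> one_ps n (Suc b * q) t \<otimes>\<^bsub>PSL n\<^esub> C"
      using h C(2) unfolding PSL_mult set_mult_def by auto
    ultimately show ?case by (rule bexI[rotated])
  qed
  from this[OF order_refl assms] show ?thesis by simp
qed

text \<open>The determinant condition is absorbed into a scalar, and scalars act trivially on
  lines.\<close>

lemma T_J_contains_scaled:
  assumes "\<And>b. u b \<noteq> 0"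
  obtains C c where "C \<in> T_J q k" "c \<noteq> 0" "diagm n (\<lambda>a. c * u (a div q)) \<in> C"
proof -
  have p: "(\<Prod>a<n. u (a div q)) \<noteq> 0" using assms by simp
  obtain c where c: "c ^ n = inverse (\<Prod>a<n. u (a div q))" "c \<noteq> 0"
    using complex_nth_root[of "inverse (\<Prod>a<n. u (a div q))" n] p n by auto
  have "\<exists>C\<in>T_J q k. diagm n (\<lambda>a. c * u (a div q)) \<in> C"
    using T_J_contains_diagm[of "\<lambda>b. c * u b"] assms c p by (simp add: prod.distrib)
  then obtain C where "C \<in> T_J q k" "diagm n (\<lambda>a. c * u (a div q)) \<in> C" by (rule bexE)
  then show ?thesis using c(2) by (intro that)
qed

end

section \<open>The Grassmannian\<close>

lemma comp_list_simps: "comp_list [] = id" "comp_list (f # fs) = f \<circ> comp_list fs"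
  by (simp_all add: comp_list_def)

lemma comp_list_append: "comp_list (fs @ gs) = comp_list fs \<circ> comp_list gs"
  by (induction fs) (simp_all add: comp_list_simps o_assoc)

lemma comp_list_permutes: "(\<And>f. f \<in> set fs \<Longrightarrow> f permutes S) \<Longrightarrow> comp_list fs permutes S"
  by (induction fs) (simp_all add: comp_list_simps permutes_id permutes_compose)

text \<open>The rightmost reflection acts first, so that a - 1 is carried up one step by each
  factor, while every index passed on the way moves down by one.\<close>

lemma simple_reflection_cycle:
  assumes "1 \<le> a" "a \<le> b"
  shows "comp_list (map simple_reflection (rev [a..<b])) x =
    (if x = a - 1 then b - 1 else if a \<le> x \<and> x < b then x - 1 else x)"
  using assms(2)
proof (induction b rule: dec_induct)
  case base then show ?case by (simp add: comp_list_simps)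
next
  case (step b)
  then have "rev [a..<Suc b] = b # rev [a..<b]" by simp
  then have E: "comp_list (map simple_reflection (rev [a..<Suc b])) x =
      simple_reflection b (if x = a - 1 then b - 1 else if a \<le> x \<and> x < b then x - 1 else x)"
    by (simp only: list.map comp_list_simps comp_apply step.IH)
  show ?case
    unfolding E using step.hyps(1) assms(1) by (auto simp: simple_reflection_def Transposition.transpose_def)
qed

lemma minimal_w_Suc:
  "minimal_w q (Suc k) x = minimal_w q k (if x = k then Suc k * q else if Suc k \<le> x \<and> x \<le> Suc k * q then x - 1 else x)"
  if "q \<ge> 1"
proof -
  have "[1..<Suc k + 1] = [1..<k + 1] @ [Suc k]" by simp
  then have "minimal_w q (Suc k) = minimal_w q k \<circ> comp_list (map simple_reflection (rev [Suc k..<Suc k * q + 1]))"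
    unfolding minimal_w_def by (simp only: map_append comp_list_append list.map comp_list_simps comp_id)
  then have "minimal_w q (Suc k) x =
      minimal_w q k (comp_list (map simple_reflection (rev [Suc k..<Suc k * q + 1])) x)" by (simp only: comp_apply)
  moreover have le: "Suc k \<le> Suc k * q + 1" using that by (cases q) auto
  have "comp_list (map simple_reflection (rev [Suc k..<Suc k * q + 1])) x =
      (if x = k then Suc k * q else if Suc k \<le> x \<and> x \<le> Suc k * q then x - 1 else x)"
    by (subst simple_reflection_cycle[OF _ le]) (auto simp del: mult_Suc)
  ultimately show ?thesis by simp
qed

lemma minimal_w_above: "q \<ge> 1 \<Longrightarrow> k * q < x \<Longrightarrow> minimal_w q k x = x"
proof (induction k)
  case 0 then show ?case by (simp add: minimal_w_def comp_list_simps)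
next
  case (Suc k)
  have "k \<le> k * q" using Suc.prems(1) by (cases q) auto
  moreover have b: "q + k * q < x" using Suc.prems(2) by simp
  ultimately have "k < x" by linarith
  then have "x \<noteq> k" "\<not> x \<le> Suc k * q" using b by auto
  then show ?case using Suc by (simp add: minimal_w_Suc)
qed

text \<open>In the induction step the last cycle sends \<open>k\<close> to (k + 1) * q, which the
  earlier cycles fix because they move only indices up to k * q. In 1-based form the values are q +
  1, 2q + 1, and so on.\<close>

lemma minimal_w_less: "q \<ge> 1 \<Longrightarrow> j < k \<Longrightarrow> minimal_w q k j = Suc j * q"
proof (induction k)
  case 0 then show ?case by simp
next
  case (Suc k)
  have "minimal_w q k (Suc k * q) = Suc k * q" using Suc.prems by (intro minimal_w_above) auto
  then show ?case using Suc by (auto simp: minimal_w_Suc less_Suc_eq)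
qed

lemma minimal_w_permutes: "minimal_w q k permutes {..<k * q + 1}"
  unfolding minimal_w_def
proof (rule comp_list_permutes)
  fix f assume "f \<in> set (map (\<lambda>j. comp_list (map simple_reflection (rev [j..<j * q + 1]))) [1..<k + 1])"
  then obtain j where j: "1 \<le> j" "j \<le> k" "f = comp_list (map simple_reflection (rev [j..<j * q + 1]))" by auto
  show "f permutes {..<k * q + 1}" unfolding j
  proof (rule comp_list_permutes)
    fix g assume "g \<in> set (map simple_reflection (rev [j..<j * q + 1]))"
    then have "g \<in> simple_reflection ` {j..<j * q + 1}" by (simp only: set_map set_rev set_upt)
    then obtain i where i: "j \<le> i" "i \<le> j * q" "g = simple_reflection i" by auto
    then have "i \<le> k * q" using j(2) by (meson le_trans mult_le_mono1)
    then show "g permutes {..<k * q + 1}"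
      unfolding i simple_reflection_def using i j by (intro permutes_swap_id) auto
  qed
qed

lemma pick_strict_mono:
  assumes f: "strict_mono_on {..<k} f" and j: "j < k"
  shows "pick (f ` {..<k}) j = f j"
proof -
  have "{a \<in> f ` {..<k}. a < f j} = f ` {..<j}"
    using j strict_mono_on_less[OF f] by (auto simp: strict_mono_on_less[OF f])
  moreover have "inj_on f {..<j}" using strict_mono_on_imp_inj_on[OF f] j by (auto intro: inj_on_subset)
  ultimately have "card {a \<in> f ` {..<k}. a < f j} = j" by (simp add: card_image)
  then show ?thesis using pick_card_in_set[of "f j" "f ` {..<k}"] j by auto
qed

section \<open>Matrices representing points of the Grassmannian\<close>

lemma plu_scale: "(\<And>\<rho>. minor k A \<rho> = c * minor k B \<rho>) \<Longrightarrow> plu n k A = (\<lambda>S. c * plu n k B S)"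
  by (auto simp: plu_def fun_eq_iff)

lemma permutes_extend:
  fixes \<sigma> :: "nat \<Rightarrow> nat"
  assumes "inj_on \<sigma> {..<k}" "\<sigma> ` {..<k} \<subseteq> {..<n}"
  obtains \<tau> where "\<tau> permutes {0..<n}" "\<And>l. l < k \<Longrightarrow> \<tau> l = \<sigma> l"
proof -
  have c: "card (\<sigma> ` {..<k}) = k" using card_image[OF assms(1)] by simp
  have kn: "k \<le> n" using card_mono[OF _ assms(2)] c by simp
  have "card {k..<n} = card ({..<n} - \<sigma> ` {..<k})"
    using card_Diff_subset[OF _ assms(2)] c by simp
  then obtain h where h: "bij_betw h {k..<n} ({..<n} - \<sigma> ` {..<k})"
    using finite_same_card_bij[of "{k..<n}" "{..<n} - \<sigma> ` {..<k}"] by auto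
  define \<tau> where "\<tau> l = (if l < k then \<sigma> l else if l < n then h l else l)" for l
  have "bij_betw \<tau> {..<k} (\<sigma> ` {..<k})"
    using inj_on_imp_bij_betw[OF assms(1)] by (rule bij_betw_cong[THEN iffD1, rotated]) (simp add: \<tau>_def)
  moreover have "bij_betw \<tau> {k..<n} ({..<n} - \<sigma> ` {..<k})"
    using h by (rule bij_betw_cong[THEN iffD1, rotated]) (simp add: \<tau>_def)
  ultimately have "bij_betw \<tau> ({..<k} \<union> {k..<n}) (\<sigma> ` {..<k} \<union> ({..<n} - \<sigma> ` {..<k}))"
    by (rule bij_betw_combine) auto
  moreover have "{..<k} \<union> {k..<n} = {0..<n}" "\<sigma> ` {..<k} \<union> ({..<n} - \<sigma> ` {..<k}) = {0..<n}"
    using kn assms(2) by auto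
  ultimately have "bij_betw \<tau> {0..<n} {0..<n}" by simp
  then have "\<tau> permutes {0..<n}" by (rule bij_imp_permutes) (use kn in \<open>auto simp: \<tau>_def\<close>)
  then show ?thesis using that by (simp add: \<tau>_def)
qed

text \<open>The \<open>k\<close> columns are completed by unit columns in the remaining rows to an
  invertible matrix of size \<open>n\<close>, which is then rescaled to determinant 1; a permutation
  extending \<open>\<sigma>\<close> says where the unit columns go.\<close>

lemma grassmannian_unit_rows:
  assumes u: "unit_rows k A \<sigma>" and \<sigma>: "inj_on \<sigma> {..<k}" "\<sigma> ` {..<k} \<subseteq> {..<n}" and n: "n > 0"
  shows "line (plu n k A) \<in> grassmannian n k"
proof -
  have kn: "k \<le> n" using card_mono[OF _ \<sigma>(2)] card_image[OF \<sigma>(1)] by simp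
  obtain \<tau> where t: "\<tau> permutes {0..<n}" "\<And>l. l < k \<Longrightarrow> \<tau> l = \<sigma> l"
    using permutes_extend[OF \<sigma>] by blast
  define G where "G i j = (if j < k then A i j else if i = \<tau> j then 1 else 0)" for i j
  have "minor n G \<tau> = (\<Prod>a<n. G (\<tau> a) a)"
  proof (rule minor_diagonal)
    fix p assume p: "p permutes {0..<n}" and nz: "\<And>a. a < n \<Longrightarrow> G (\<tau> a) (p a) \<noteq> 0"
    have 1: "p a = a" if a: "a < k" for a
    proof (cases "p a < k")
      case True then show ?thesis using nz[of a] a kn u t by (auto simp: G_def unit_rows_def split: if_splits)
    next
      case False
      then have "\<tau> a = \<tau> (p a)" using nz[of a] a kn by (auto simp: G_def split: if_splits)
      then show ?thesis using permutes_inj[OF t(1)] by (metis injD)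
    qed
    have 2: "p a = a" if a: "a \<ge> k" "a < n" for a
    proof -
      have "\<not> p a < k" using 1[of "p a"] permutes_inj[OF p] a by (metis injD not_le)
      then have "\<tau> a = \<tau> (p a)" using nz[of a] a by (auto simp: G_def split: if_splits)
      then show ?thesis using permutes_inj[OF t(1)] by (metis injD)
    qed
    show "p = id"
    proof
      fix a show "p a = id a" using 1[of a] 2[of a] permutes_not_in[OF p, of a]
        by (cases "a < k"; cases "a < n") auto
    qed
  qed
  also have "\<dots> = 1" using u t by (intro prod.neutral) (auto simp: G_def unit_rows_def)
  finally have "signof \<tau> * minor n G id = (1::complex)"
    using minor_permute[OF t(1), of G id] by (simp add: id_def)
  then have nz: "minor n G id \<noteq> 0" by auto
  define g where "g = mat n n (\<lambda>(i, j). G i j)"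
  have g: "g \<in> carrier_mat n n" "det g \<noteq> 0" using nz by (simp_all add: g_def minor_def)
  obtain c where c: "c ^ n = inverse (det g)" "c \<noteq> 0"
    using complex_nth_root[of "inverse (det g)" n] g n by auto
  have "c \<cdot>\<^sub>m g \<in> carrier (SL n)" using g c by simp
  then obtain C where C: "C \<in> carrier (PSL n)" "c \<cdot>\<^sub>m g \<in> C" by (rule PSL_class)
  have "plu n k (\<lambda>i j. (c \<cdot>\<^sub>m g) $$ (i, j)) = (\<lambda>S. c ^ k * plu n k A S)"
  proof
    fix S
    have "minor k (\<lambda>i j. (c \<cdot>\<^sub>m g) $$ (i, j)) (pick S) = c ^ k * minor k A (pick S)" if S: "S \<in> plucker_index n k"
    proof -
      have "minor k (\<lambda>i j. (c \<cdot>\<^sub>m g) $$ (i, j)) (pick S) = minor k (\<lambda>i j. 1 * A i j * c) (pick S)"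
        using pick_plucker(4)[OF S] kn by (intro minor_cong) (auto simp: g_def G_def)
      then show ?thesis unfolding minor_scale by simp
    qed
    then show "plu n k (\<lambda>i j. (c \<cdot>\<^sub>m g) $$ (i, j)) S = c ^ k * plu n k A S" by (simp add: plu_def)
  qed
  then have "psl_act n k C (base_point k) = line (plu n k A)"
    unfolding psl_act_base_point[OF C n kn] using c by (simp add: line_scale)
  then show ?thesis unfolding grassmannian_def using C by blast
qed

lemma grassmannian_form:
  assumes "x \<in> grassmannian n k" "n > 0" "k \<le> n"
  obtains A where "x = line (plu n k A)"
proof -
  from assms obtain C where C: "C \<in> carrier (PSL n)" "x = psl_act n k C (base_point k)"
    unfolding grassmannian_def by blast
  then obtain h where "h \<in> carrier (SL n)" "C = {c \<cdot>\<^sub>m h | c. c ^ n = 1}" unfolding PSL_carrier by blast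
  then have "h \<in> C" using one_smult_mat[of h] by force
  then show ?thesis using that psl_act_base_point[OF C(1) _ assms(2,3)] C(2) by simp
qed

lemma grassmannian_minor:
  assumes "minor k A \<rho> \<noteq> 0" "\<rho> ` {..<k} \<subseteq> {..<n}" "n > 0"
  shows "line (plu n k A) \<in> grassmannian n k"
proof -
  obtain B c where B: "c \<noteq> 0" "unit_rows k B \<rho>" "\<And>\<rho>. minor k A \<rho> = c * minor k B \<rho>"
    using minor_normalise[OF assms(1)] by metis
  have "line (plu n k A) = line (plu n k B)" using plu_scale[OF B(3)] B(1) by (simp add: line_scale)
  then show ?thesis using grassmannian_unit_rows[OF B(2) minor_nonzero_inj[OF assms(1)] assms(2,3)] by simp
qed

lemma plu_nonzero_image:
  assumes "minor k A \<rho> \<noteq> 0" "\<rho> ` {..<k} \<subseteq> {..<n}"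
  shows "\<rho> ` {..<k} \<in> plucker_index n k" "plu n k A (\<rho> ` {..<k}) \<noteq> 0"
proof -
  have i: "inj_on \<rho> {..<k}" by (rule minor_nonzero_inj[OF assms(1)])
  then show S: "\<rho> ` {..<k} \<in> plucker_index n k"
    using assms(2) card_image[OF i] by (simp add: plucker_index_def)
  obtain e where "\<And>A. minor k A \<rho> = e * minor k A (pick (\<rho> ` {..<k}))"
    using minor_image[OF i] by metis
  then show "plu n k A (\<rho> ` {..<k}) \<noteq> 0" using assms(1) S by (simp add: plu_def)
qed

text \<open>By \<open>minor_replace_row\<close> the coordinate of the exchanged index set is
  \<open>B i l\<close> up to a sign.\<close>

lemma unit_rows_exchange:
  assumes u: "unit_rows k B (pick S)" and S: "S \<in> plucker_index n k"
    and l: "l < k" and i: "i < n" "i \<notin> S" and nz: "B i l \<noteq> 0"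
  shows "insert i (S - {pick S l}) \<in> plucker_index n k" "plu n k B (insert i (S - {pick S l})) \<noteq> 0"
proof -
  let ?\<rho> = "(pick S)(l := i)"
  have "?\<rho> ` {..<k} = insert i (pick S ` ({..<k} - {l}))" using l by auto
  also have "pick S ` ({..<k} - {l}) = S - {pick S l}"
    using inj_on_image_set_diff[OF pick_plucker(3)[OF S], of "{..<k}" "{l}"] pick_plucker(1)[OF S] l by simp
  finally have im: "?\<rho> ` {..<k} = insert i (S - {pick S l})" .
  have m: "minor k B ?\<rho> \<noteq> 0" using minor_replace_row[OF u l] nz by simp
  have sub: "?\<rho> ` {..<k} \<subseteq> {..<n}" unfolding im using i plucker_indexD[OF S] by auto
  show "insert i (S - {pick S l}) \<in> plucker_index n k" "plu n k B (insert i (S - {pick S l})) \<noteq> 0"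
    using plu_nonzero_image[OF m sub] unfolding im by simp_all
qed

text \<open>Normalising at a nonvanishing Pluecker coordinate which is extremal for a weight function
  forces zeros, because an exchange of one index would otherwise improve the weight.\<close>

lemma extremal_normal_form:
  fixes wt :: "nat \<Rightarrow> int"
  assumes "plu n k A S0 \<noteq> 0"
  obtains S B where "S \<in> plucker_index n k" "plu n k A S \<noteq> 0" "unit_rows k B (pick S)"
    "line (plu n k B) = line (plu n k A)" "\<And>T. plu n k B T = 0 \<longleftrightarrow> plu n k A T = 0"
    "\<And>l i. l < k \<Longrightarrow> i < n \<Longrightarrow> wt i > wt (pick S l) \<Longrightarrow> B i l = 0"
    "\<And>T. plu n k A T \<noteq> 0 \<Longrightarrow> (\<Sum>i\<in>T. wt i) \<le> (\<Sum>i\<in>S. wt i)"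
proof -
  let ?Q = "{T \<in> plucker_index n k. plu n k A T \<noteq> 0}"
  have Q: "T \<in> ?Q \<longleftrightarrow> plu n k A T \<noteq> 0" for T by (auto simp: plu_def)
  have fQ: "finite ?Q" using finite_plucker_index by simp
  have "?Q \<noteq> {}" using assms Q by blast
  then have "Max (sum wt ` ?Q) \<in> sum wt ` ?Q" using fQ by (intro Max_in) auto
  then obtain S where S0: "S \<in> ?Q" "sum wt S = Max (sum wt ` ?Q)" by (metis (no_types, lifting) imageE)
  have S: "S \<in> ?Q" "sum wt T \<le> sum wt S" if "T \<in> ?Q" for T
    unfolding S0(2) using that fQ S0(1) by (auto intro!: Max_ge)
  have SP: "S \<in> plucker_index n k" and nz: "minor k A (pick S) \<noteq> 0" using S0(1) by (auto simp: plu_def)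
  obtain B c where B: "c \<noteq> 0" "unit_rows k B (pick S)" "\<And>\<rho>. minor k A \<rho> = c * minor k B \<rho>"
    using minor_normalise[OF nz] by metis
  have l: "plu n k A = (\<lambda>S. c * plu n k B S)" by (rule plu_scale[OF B(3)])
  have z: "plu n k B T = 0 \<longleftrightarrow> plu n k A T = 0" for T using B(1) by (simp add: l)
  show ?thesis
  proof (rule that[OF SP _ B(2) _ z])
    show "plu n k A S \<noteq> 0" using S0(1) by simp
    show "line (plu n k B) = line (plu n k A)" using B(1) by (simp add: l line_scale)
    show "(\<Sum>i\<in>T. wt i) \<le> (\<Sum>i\<in>S. wt i)" if "plu n k A T \<noteq> 0" for T
      by (rule S(2)) (use that Q[of T] in blast)
    fix l i assume li: "l < k" "i < n" "wt i > wt (pick S l)"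
    show "B i l = 0"
    \<comment> \<open>For \<open>i\<close> in \<open>S\<close> the row is a unit row, and its entry
      1 sits in a column other than \<open>l\<close> because the weights differ.\<close>
    proof (cases "i \<in> S")
      case True
      then obtain a where "a < k" "i = pick S a" using pick_plucker(1)[OF SP] by blast
      then show ?thesis using B(2) li by (auto simp: unit_rows_def)
    next
      case False
      show ?thesis
      proof (rule ccontr)
        assume "B i l \<noteq> 0"
        note ex = unit_rows_exchange[OF B(2) SP li(1,2) False this]
        have fin: "finite S" using plucker_indexD[OF SP] by simp
        have "(\<Sum>i\<in>insert i (S - {pick S l}). wt i) = wt i + (\<Sum>i\<in>S - {pick S l}. wt i)"
          using fin False by simp
        also have "(\<Sum>i\<in>S - {pick S l}. wt i) = (\<Sum>i\<in>S. wt i) - wt (pick S l)"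
          using fin pick_plucker(5)[OF SP li(1)] by (simp add: sum_diff1)
        finally have "(\<Sum>i\<in>insert i (S - {pick S l}). wt i) > (\<Sum>i\<in>S. wt i)" using li(3) by simp
        moreover have "insert i (S - {pick S l}) \<in> ?Q" using ex z by simp
        ultimately show False using S(2)[of "insert i (S - {pick S l})"] by linarith
      qed
    qed
  qed
qed

section \<open>The Schubert variety\<close>

text \<open>The shape of the first columns of b * w with \<open>b\<close> upper triangular: column
  \<open>j\<close> is column (j + 1) * q of \<open>b\<close>, hence zero below the pivot row (j + 1)
  * q.\<close>

definition echelon :: "nat \<Rightarrow> nat \<Rightarrow> nat \<Rightarrow> (nat \<Rightarrow> nat \<Rightarrow> complex) \<Rightarrow> bool" where
  "echelon q k n A \<longleftrightarrow> (\<forall>j<k. \<forall>i<n. Suc j * q < i \<longrightarrow> A i j = 0)"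

text \<open>The Bruhat order on index sets: comparison with the set of pivot rows (j + 1) *
  q.\<close>

definition index_le :: "nat \<Rightarrow> nat \<Rightarrow> nat set \<Rightarrow> bool" where
  "index_le q k S \<longleftrightarrow> (\<forall>j<k. pick S j \<le> Suc j * q)"

section \<open>The open cell and its closure\<close>

context
  fixes q k n :: nat
  assumes q: "q \<ge> 1" and k: "k \<ge> 1" and n: "n = k * q + 1"
begin

lemma n_pos: "n > 0" by (simp add: n)

lemma k_le_n: "k \<le> n"
  using q by (cases q) (auto simp: n)

lemma pivot_less: "j < k \<Longrightarrow> Suc j * q < n"
  using mult_le_mono1[of "Suc j" k q] unfolding n by linarith

lemma pivot_mono: "strict_mono_on {..<k} (\<lambda>j. Suc j * q)"
  using q by (auto simp: strict_mono_on_def intro!: mult_less_mono1 simp del: mult_Suc)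

definition pivot_set where "pivot_set = (\<lambda>j. Suc j * q) ` {..<k}"

lemma pivot_set_plucker: "pivot_set \<in> plucker_index n k"
  using pivot_less card_image[OF strict_mono_on_imp_inj_on[OF pivot_mono]]
  by (auto simp: pivot_set_def plucker_index_def simp del: mult_Suc)

lemma pick_pivot_set: "j < k \<Longrightarrow> pick pivot_set j = Suc j * q"
  unfolding pivot_set_def by (rule pick_strict_mono[OF pivot_mono])

text \<open>A matching for the minor of \<open>S\<close> pairs every index of \<open>S\<close> with
  a pivot row at or beyond it; by \<open>strict_mono_matching_le\<close> this remains true after
  sorting.\<close>

lemma echelon_plu:
  assumes A: "echelon q k n A" and S: "plu n k A S \<noteq> 0"
  shows "index_le q k S"
proof -
  have SP: "S \<in> plucker_index n k" and m: "minor k A (pick S) \<noteq> 0"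
    using S by (auto simp: plu_def split: if_splits)
  obtain p where p: "p permutes {0..<k}" "\<And>a. a < k \<Longrightarrow> A (pick S a) (p a) \<noteq> 0"
    using minor_nonzero_matching[OF m] by blast
  have "pick S j \<le> Suc j * q" if "j < k" for j
  proof (rule strict_mono_matching_le[OF pick_plucker(2)[OF SP] pivot_mono p(1) _ that])
    fix a assume a: "a < k"
    show "pick S a \<le> Suc (p a) * q"
      using p(2)[OF a] A pick_plucker(4)[OF SP a] permutes_lessThan[OF p(1) a]
      unfolding echelon_def by (meson not_le)
  qed
  then show ?thesis unfolding index_le_def by blast
qed

text \<open>The first \<open>k\<close> columns of a monomial matrix representing
  \<open>minimal_w\<close> are supported in the pivot rows, so every other index set has a vanishing
  minor.\<close>

lemma weyl_base_point:
  assumes c: "c \<in> weyl_rep n (minimal_w q k)"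
  obtains d where "psl_act n k c (base_point k) = line (\<lambda>S. if S = pivot_set then d else 0)"
proof -
  from c obtain g where cP: "c \<in> carrier (PSL n)" and g: "g \<in> c"
    "\<And>i j. i < n \<Longrightarrow> j < n \<Longrightarrow> g $$ (i, j) \<noteq> 0 \<Longrightarrow> i = minimal_w q k j"
    unfolding weyl_rep_def by blast
  let ?A = "\<lambda>i j. g $$ (i, j)"
  have "plu n k ?A S = 0" if "S \<noteq> pivot_set" for S
  proof (rule ccontr)
    assume "plu n k ?A S \<noteq> 0"
    then have SP: "S \<in> plucker_index n k" and m: "minor k ?A (pick S) \<noteq> 0"
      by (auto simp: plu_def split: if_splits)
    obtain p where p: "p permutes {0..<k}" "\<And>a. a < k \<Longrightarrow> ?A (pick S a) (p a) \<noteq> 0"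
      using minor_nonzero_matching[OF m] by blast
    have "pick S a \<in> pivot_set" if a: "a < k" for a
    proof -
      have "p a < k" using permutes_lessThan[OF p(1) a] .
      then have "pick S a = minimal_w q k (p a)"
        using g(2)[OF pick_plucker(4)[OF SP a] _ p(2)[OF a]] k_le_n by simp
      also have "\<dots> = Suc (p a) * q" using q \<open>p a < k\<close> by (intro minimal_w_less)
      finally show ?thesis using \<open>p a < k\<close> unfolding pivot_set_def by blast
    qed
    then have "pick S ` {..<k} \<subseteq> pivot_set" by auto
    then have "S \<subseteq> pivot_set" by (simp only: pick_plucker(1)[OF SP])
    then show False
      using card_subset_eq[of pivot_set S] that plucker_indexD[OF SP] plucker_indexD[OF pivot_set_plucker] by auto
  qed
  then have "plu n k ?A = (\<lambda>S. if S = pivot_set then plu n k ?A pivot_set else 0)" by auto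
  then show ?thesis using that psl_act_base_point[OF cP g(1) n_pos k_le_n] by metis
qed

text \<open>Applied to the basis vector of the pivot set, the exterior power selects the columns of
  \<open>g\<close> in the pivot positions.\<close>

lemma ext_pow_delta:
  assumes "g \<in> carrier_mat n n"
  shows "ext_pow n k g (\<lambda>S. if S = pivot_set then d else 0) = (\<lambda>S. d * plu n k (\<lambda>i j. g $$ (i, Suc j * q)) S)"
proof
  fix S
  have "minor k (\<lambda>i b. g $$ (i, pick pivot_set b)) (pick S) = minor k (\<lambda>i j. g $$ (i, Suc j * q)) (pick S)"
    by (rule minor_cong) (simp add: pick_pivot_set)
  then show "ext_pow n k g (\<lambda>S. if S = pivot_set then d else 0) S = d * plu n k (\<lambda>i j. g $$ (i, Suc j * q)) S"
    using pivot_set_plucker finite_plucker_index[of n k] assms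
    by (simp add: ext_pow_def plu_def if_distrib[of "\<lambda>x. _ * x"] det_submatrix cong: if_cong)
qed

lemma cell_point_vanish:
  assumes b: "b \<in> borel n" and c: "c \<in> weyl_rep n (minimal_w q k)"
    and v: "v \<in> psl_act n k b (psl_act n k c (base_point k))" and S: "v S \<noteq> 0"
  shows "index_le q k S"
proof -
  from b obtain g where bP: "b \<in> carrier (PSL n)" and g: "g \<in> b" "upper_triangular g"
    unfolding borel_def by blast
  have gc: "g \<in> carrier_mat n n" using PSL_coset(1)[OF bP g(1) n_pos] by simp
  obtain d where d: "psl_act n k c (base_point k) = line (\<lambda>S. if S = pivot_set then d else 0)"
    by (rule weyl_base_point[OF c])
  have "v \<in> line (\<lambda>S. d * plu n k (\<lambda>i j. g $$ (i, Suc j * q)) S)"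
    using v unfolding d psl_act_line[OF bP g(1) n_pos] ext_pow_delta[OF gc] .
  then have "plu n k (\<lambda>i j. g $$ (i, Suc j * q)) S \<noteq> 0" using S by (auto elim!: lineE)
  moreover have "echelon q k n (\<lambda>i j. g $$ (i, Suc j * q))"
    unfolding echelon_def
  proof (intro allI impI)
    fix j i assume "j < k" "i < n" "Suc j * q < i"
    then show "g $$ (i, Suc j * q) = 0" using g(2) gc unfolding upper_triangular_def by auto
  qed
  ultimately show ?thesis by (rule echelon_plu[rotated])
qed

text \<open>A permutation matrix may have determinant -1, so it is rescaled by an
  \<open>n\<close>-th root before its class is taken.\<close>

lemma weyl_rep_exists:
  obtains c d where "c \<in> weyl_rep n (minimal_w q k)" "d \<noteq> 0"
    "psl_act n k c (base_point k) = line (\<lambda>S. if S = pivot_set then d else 0)"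
proof -
  let ?w = "minimal_w q k"
  define P where "P i j = (if i = ?w j then 1 else 0::complex)" for i j
  have wp: "?w permutes {0..<n}" using minimal_w_permutes[of q k] by (simp add: n lessThan_atLeast0)
  have "unit_rows n P ?w"
    using permutes_inj[OF wp] by (auto simp: unit_rows_def P_def dest: injD)
  then have "signof ?w * minor n P id = (1::complex)"
    using minor_permute[OF wp, of P id] minor_unit_rows[of n P ?w] by (simp add: id_def)
  then have nz: "minor n P id \<noteq> 0" by auto
  define g where "g = mat n n (\<lambda>(i, j). P i j)"
  have g: "g \<in> carrier_mat n n" "det g \<noteq> 0" using nz by (simp_all add: g_def minor_def)
  obtain e where e: "e ^ n = inverse (det g)" "e \<noteq> 0"
    using complex_nth_root[of "inverse (det g)" n] g n_pos by auto
  have "e \<cdot>\<^sub>m g \<in> carrier (SL n)" using g e by simp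
  then obtain C where C: "C \<in> carrier (PSL n)" "e \<cdot>\<^sub>m g \<in> C" by (rule PSL_class)
  have "C \<in> weyl_rep n ?w" unfolding weyl_rep_def
    using C by (auto simp: g_def P_def intro!: bexI[of _ "e \<cdot>\<^sub>m g"] split: if_splits)
  moreover obtain d where d: "psl_act n k C (base_point k) = line (\<lambda>S. if S = pivot_set then d else 0)"
    by (rule weyl_base_point[OF \<open>C \<in> weyl_rep n ?w\<close>])
  moreover have "d \<noteq> 0"
  proof
    assume d0: "d = 0"
    let ?A = "\<lambda>i j. (e \<cdot>\<^sub>m g) $$ (i, j)"
    have "plu n k ?A \<in> line (\<lambda>S. if S = pivot_set then d else 0)"
      using d line_self unfolding psl_act_base_point[OF C n_pos k_le_n] by metis
    then have "plu n k ?A pivot_set = 0" using d0 by (auto elim!: lineE)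
    moreover have "minor k ?A (pick pivot_set) = minor k (\<lambda>i j. 1 * P i j * e) (pick pivot_set)"
      using pick_plucker(4)[OF pivot_set_plucker] k_le_n by (intro minor_cong) (auto simp: g_def)
    moreover have "minor k (\<lambda>i j. 1 * P i j * e) (pick pivot_set) = e ^ k * minor k P (pick pivot_set)"
      unfolding minor_scale by simp
    moreover have "unit_rows k P (pick pivot_set)"
      unfolding unit_rows_def
    proof (intro allI impI)
      fix a b assume "a < k" "b < k"
      then have "pick pivot_set a = ?w a" "?w a = ?w b \<longleftrightarrow> a = b"
        using q permutes_inj[OF wp] by (auto simp: pick_pivot_set minimal_w_less dest: injD simp del: mult_Suc)
      then show "P (pick pivot_set a) b = (if a = b then 1 else 0)" by (simp add: P_def)
    qed
    ultimately show False using pivot_set_plucker e(2) by (simp add: plu_def minor_unit_rows)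
  qed
  ultimately show ?thesis using that by blast
qed

text \<open>The columns of \<open>A\<close> are placed into the identity matrix at the pivot
  positions. The result is upper triangular with nonzero diagonal, so after rescaling it represents
  an element of the Borel subgroup, and this moves the torus-fixed point of the cell to the given
  point.\<close>

lemma echelon_in_cell:
  assumes A: "echelon q k n A" and piv: "\<And>j. j < k \<Longrightarrow> A (Suc j * q) j \<noteq> 0"
  obtains b c where "b \<in> borel n" "c \<in> weyl_rep n (minimal_w q k)"
    "psl_act n k b (psl_act n k c (base_point k)) = line (plu n k A)"
proof -
  \<comment> \<open>The partial inverse of the map sending a column to its pivot position.\<close>
  define col where "col m = (if \<exists>j<k. m = Suc j * q then Some (THE j. j < k \<and> m = Suc j * q) else None)" for m
  have col: "col (Suc j * q) = Some j" if "j < k" for j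
  proof -
    have "(THE j'. j' < k \<and> Suc j * q = Suc j' * q) = j"
      by (rule the_equality) (use that q in auto)
    then show ?thesis using that unfolding col_def by auto
  qed
  have col_Some: "j < k \<and> m = Suc j * q" if "col m = Some j" for m j
    using that col unfolding col_def by (metis option.distinct(1) option.inject)
  define G where "G i m = (case col m of Some j \<Rightarrow> A i j | None \<Rightarrow> if i = m then 1 else 0)" for i m
  define g where "g = mat n n (\<lambda>(i, j). G i j)"
  have up: "G i m = 0" if "i < n" "m < i" for i m
    using that A col_Some unfolding G_def echelon_def by (auto split: option.splits)
  have gc: "g \<in> carrier_mat n n" and gup: "upper_triangular g"
    using up by (auto simp: g_def upper_triangular_def)
  have dg: "G m m \<noteq> 0" for m
    using piv col_Some[of m] unfolding G_def by (auto split: option.splits)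
  have "det g = prod_list (diag_mat g)" by (rule det_upper_triangular[OF gup gc])
  also have "\<dots> \<noteq> 0" using dg by (auto simp: prod_list_zero_iff diag_mat_def g_def)
  finally have dn: "det g \<noteq> 0" .
  obtain e where e: "e ^ n = inverse (det g)" "e \<noteq> 0"
    using complex_nth_root[of "inverse (det g)" n] dn n_pos by auto
  have "e \<cdot>\<^sub>m g \<in> carrier (SL n)" using gc dn e by simp
  then obtain b where b: "b \<in> carrier (PSL n)" "e \<cdot>\<^sub>m g \<in> b" by (rule PSL_class)
  have "upper_triangular (e \<cdot>\<^sub>m g)" using gup gc unfolding upper_triangular_def by auto
  then have bB: "b \<in> borel n" using b unfolding borel_def by blast
  obtain c d where c: "c \<in> weyl_rep n (minimal_w q k)" "d \<noteq> 0"
    "psl_act n k c (base_point k) = line (\<lambda>S. if S = pivot_set then d else 0)" by (rule weyl_rep_exists)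
  have "plu n k (\<lambda>i j. (e \<cdot>\<^sub>m g) $$ (i, Suc j * q)) = (\<lambda>S. e ^ k * plu n k A S)"
  proof
    fix S
    have "minor k (\<lambda>i j. (e \<cdot>\<^sub>m g) $$ (i, Suc j * q)) (pick S) = e ^ k * minor k A (pick S)"
      if S: "S \<in> plucker_index n k"
    proof -
      have "minor k (\<lambda>i j. (e \<cdot>\<^sub>m g) $$ (i, Suc j * q)) (pick S) = minor k (\<lambda>i j. 1 * A i j * e) (pick S)"
        using pick_plucker(4)[OF S] pivot_less
        by (intro minor_cong) (auto simp: g_def G_def col simp del: mult_Suc)
      then show ?thesis unfolding minor_scale by simp
    qed
    then show "plu n k (\<lambda>i j. (e \<cdot>\<^sub>m g) $$ (i, Suc j * q)) S = e ^ k * plu n k A S" by (simp add: plu_def)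
  qed
  moreover have "psl_act n k b (psl_act n k c (base_point k)) =
      line (\<lambda>S. d * plu n k (\<lambda>i j. (e \<cdot>\<^sub>m g) $$ (i, Suc j * q)) S)"
    unfolding c(3) psl_act_line[OF b n_pos] by (subst ext_pow_delta) (use gc in auto)
  ultimately have "psl_act n k b (psl_act n k c (base_point k)) = line (\<lambda>S. (d * e ^ k) * plu n k A S)"
    by (simp add: mult.assoc)
  then have "psl_act n k b (psl_act n k c (base_point k)) = line (plu n k A)"
    using c(2) e(2) line_scale[of "d * e ^ k" "plu n k A"] by simp
  with bB c(1) show ?thesis by (rule that)
qed

lemma plu_nonzero_proj:
  assumes "plu n k A S \<noteq> 0"
  shows "line (plu n k A) \<in> proj_points (plucker_index n k)" "line (plu n k A) \<in> grassmannian n k"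
proof -
  show "line (plu n k A) \<in> proj_points (plucker_index n k)"
    by (rule line_in_proj_points[OF plu_vectors assms])
  have S: "S \<in> plucker_index n k" "minor k A (pick S) \<noteq> 0" using assms by (auto simp: plu_def split: if_splits)
  then show "line (plu n k A) \<in> grassmannian n k"
    using pick_plucker(1)[OF S(1)] plucker_indexD[OF S(1)] by (intro grassmannian_minor[OF S(2) _ n_pos]) simp
qed

text \<open>The vanishing of a Pluecker coordinate outside the Bruhat order is a closed condition
  which holds on the cell, hence on its closure.\<close>

lemma schubert_subset:
  assumes x: "x \<in> schubert n k (minimal_w q k)"
  obtains A S where "x = line (plu n k A)" "plu n k A S \<noteq> 0" "\<And>S. plu n k A S \<noteq> 0 \<Longrightarrow> index_le q k S"
proof -
  let ?PI = "plucker_index n k"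
  let ?X = "subspace (proj_space ?PI) (grassmannian n k)"
  let ?C = "{psl_act n k b (psl_act n k c (base_point k)) | b c. b \<in> borel n \<and> c \<in> weyl_rep n (minimal_w q k)}"
  have pts: "points ?X = proj_points ?PI \<inter> grassmannian n k"
    by (simp add: points_subspace space_with_functions_proj points_proj_space)
  have x': "x \<in> ztop ?X closure_of ?C" using x unfolding schubert_def .
  have xp: "x \<in> proj_points ?PI" "x \<in> grassmannian n k"
    using subsetD[OF closure_of_subset_topspace x'] pts by auto
  have van: "v S = 0" if "v \<in> x" "\<not> index_le q k S" for v S
  proof (cases "S \<in> ?PI")
    case False then show ?thesis using proj_points_vector(1)[OF xp(1) that(1)] by (simp add: vectors_def)
  next
    case True
    let ?Z = "{x \<in> proj_points ?PI. \<forall>v\<in>x. v S = 0} \<inter> grassmannian n k"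
    have "closedin (ztop ?X) ?Z"
      by (rule closedin_subspace[OF space_with_functions_proj closedin_proj_zero[OF homfun.coord[OF True]]])
    moreover have "points ?X \<inter> ?C \<subseteq> ?Z" using that(2) pts cell_point_vanish by blast
    ultimately have "ztop ?X closure_of (points ?X \<inter> ?C) \<subseteq> ?Z" by (rule closure_of_minimal[rotated])
    then have "x \<in> ?Z" using x' closure_of_restrict[of "ztop ?X" ?C] by blast
    then show ?thesis using that(1) by blast
  qed
  obtain A where A: "x = line (plu n k A)" by (rule grassmannian_form[OF xp(2) n_pos k_le_n])
  then have pA: "plu n k A \<in> x" using line_self by blast
  then obtain S where "plu n k A S \<noteq> 0" using proj_points_vector(2)[OF xp(1) pA] by auto
  then show ?thesis using that[OF A] van[OF pA] by blast
qed

text \<open>The point is a limit of points of the cell: adding \<open>t\<close> to all pivot entries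
  of an echelon form makes them nonzero, and letting \<open>t\<close> tend to 0 recovers the
  point.\<close>

lemma schubert_supset:
  assumes nz: "plu n k A S0 \<noteq> 0" and le: "\<And>S. plu n k A S \<noteq> 0 \<Longrightarrow> index_le q k S"
  shows "line (plu n k A) \<in> schubert n k (minimal_w q k)"
proof -
  let ?PI = "plucker_index n k"
  let ?X = "subspace (proj_space ?PI) (grassmannian n k)"
  let ?C = "{psl_act n k b (psl_act n k c (base_point k)) | b c. b \<in> borel n \<and> c \<in> weyl_rep n (minimal_w q k)}"
  \<comment> \<open>For the weight \<open>int\<close> the extremal set has the largest sum of
    indices, so every entry of column \<open>l\<close> below the row \<open>pick S l\<close> is
    zero.\<close>
  obtain S B where S: "S \<in> ?PI" "plu n k A S \<noteq> 0" "unit_rows k B (pick S)"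
    "line (plu n k B) = line (plu n k A)"
    and ech: "\<And>l i. l < k \<Longrightarrow> i < n \<Longrightarrow> int i > int (pick S l) \<Longrightarrow> B i l = 0"
    using extremal_normal_form[OF nz, of int] by metis
  have Sle: "pick S l \<le> Suc l * q" if "l < k" for l
    using le[OF S(2)] that unfolding index_le_def by blast
  \<comment> \<open>The pivot entry of \<open>B\<close> is 1 if \<open>pick S l\<close> is the pivot
    row and 0 if it lies above it, so only the values 0 and -1 of \<open>t\<close> have to be
    avoided.\<close>
  define Bt where "Bt t = (\<lambda>i l. B i l + (if i = Suc l * q then t else 0))" for t
  have cell: "line (plu n k (Bt t)) \<in> ?C" if t: "t \<noteq> 0" "t \<noteq> -1" for t
  proof -
    have "echelon q k n (Bt t)"
      unfolding echelon_def
    proof (intro allI impI)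
      fix j i assume "j < k" "i < n" "Suc j * q < i"
      then show "Bt t i j = 0" using ech[of j i] Sle[of j] by (simp add: Bt_def del: mult_Suc)
    qed
    moreover have "Bt t (Suc j * q) j \<noteq> 0" if j: "j < k" for j
    proof (cases "pick S j = Suc j * q")
      case True
      then have "B (Suc j * q) j = 1" using S(3) j unfolding unit_rows_def by metis
      then show ?thesis using t(2) by (simp add: Bt_def add_eq_0_iff)
    next
      case False
      then have "int (pick S j) < int (Suc j * q)" using Sle[OF j] by linarith
      then have "B (Suc j * q) j = 0" by (rule ech[OF j pivot_less[OF j]])
      then show ?thesis using t(1) by (simp add: Bt_def)
    qed
    ultimately obtain b c where "b \<in> borel n" "c \<in> weyl_rep n (minimal_w q k)"
      "psl_act n k b (psl_act n k c (base_point k)) = line (plu n k (Bt t))" by (rule echelon_in_cell)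
    then show ?thesis by (metis (mono_tags, lifting) mem_Collect_eq)
  qed
  have lim: "((\<lambda>t. plu n k (Bt t) T) \<longlongrightarrow> plu n k B T) (at 0)" for T
  proof -
    have "((\<lambda>t. minor k (Bt t) (pick T)) \<longlongrightarrow> minor k B (pick T)) (at 0)"
    proof (rule minor_tendsto)
      fix a b
      have "((\<lambda>t. if pick T a = Suc b * q then t else 0) \<longlongrightarrow> 0) (at (0::complex))"
        by (cases "pick T a = Suc b * q") (simp_all add: tendsto_ident_at del: mult_Suc)
      from tendsto_add[OF tendsto_const this, of "B (pick T a) b"]
      show "((\<lambda>t. Bt t (pick T a) b) \<longlongrightarrow> B (pick T a) b) (at 0)" by (simp add: Bt_def)
    qed
    then show ?thesis by (simp add: plu_def)
  qed
  have tz: "\<forall>\<^sub>F t in at (0::complex). t \<noteq> 0 \<and> t \<noteq> -1"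
  proof (rule eventually_conj)
    show "\<forall>\<^sub>F t in at (0::complex). t \<noteq> 0" by (simp add: eventually_at_filter)
    show "\<forall>\<^sub>F t in at (0::complex). t \<noteq> -1" by (rule tendsto_imp_eventually_ne[OF tendsto_ident_at]) simp
  qed
  have pts: "points ?X = proj_points ?PI \<inter> grassmannian n k"
    by (simp add: points_subspace space_with_functions_proj points_proj_space)
  have xX: "line (plu n k A) \<in> points ?X" using plu_nonzero_proj[OF nz] pts by blast
  show ?thesis
    unfolding schubert_def in_closure_of
  proof (intro conjI xX allI impI)
    fix T assume T: "line (plu n k A) \<in> T \<and> openin (ztop ?X) T"
    from conjunct2[OF this] obtain U where U: "openin (ztop (proj_space ?PI)) U" "T = U \<inter> grassmannian n k"
      unfolding openin_subspace[OF space_with_functions_proj] by (elim exE conjE)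
    have "line (plu n k B) \<in> U" using T unfolding U(2) S(4) by simp
    then have ev: "\<forall>\<^sub>F t in at 0. line (plu n k (Bt t)) \<in> U"
      using eventually_line_in_open[of ?PI U "plu n k B" "\<lambda>t. plu n k (Bt t)" "at 0"] U(1) plu_vectors lim
      by simp
    have "\<exists>t. line (plu n k (Bt t)) \<in> U \<and> t \<noteq> 0 \<and> t \<noteq> -1"
      by (rule eventually_happens'[OF trivial_limit_at eventually_conj[OF ev tz]])
    then obtain t where t: "line (plu n k (Bt t)) \<in> U" "t \<noteq> 0" "t \<noteq> -1" by blast
    have "line (plu n k (Bt t)) \<in> proj_points ?PI"
      using subsetD[OF openin_subset[OF U(1)] t(1)] points_proj_space by blast
    then have "plu n k (Bt t) \<noteq> (\<lambda>_. 0)" using proj_points_vector(2) line_self by blast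
    then obtain S' where "plu n k (Bt t) S' \<noteq> 0" by auto
    then have "line (plu n k (Bt t)) \<in> T" using plu_nonzero_proj(2) t(1) U(2) by blast
    then show "\<exists>y. y \<in> ?C \<and> y \<in> T" using cell[OF t(2,3)] by blast
  qed
qed

end

section \<open>Semistable points\<close>

text \<open>The rows in which column \<open>j\<close> of a reduced echelon matrix may be nonzero
  besides the pivot: those above the pivot row that are not pivot rows themselves. Row 0 is a
  multiple of \<open>q\<close> but not a pivot row, hence the exception.\<close>

definition row_supp :: "nat \<Rightarrow> nat \<Rightarrow> nat set" where
  "row_supp q j = {i. i < Suc j * q \<and> (i = 0 \<or> \<not> q dvd i)}"

text \<open>The first index of \<open>x\<close> is the column and the second the row, transposed
  against \<open>mat_of\<close>.\<close>

definition params :: "nat \<Rightarrow> nat \<Rightarrow> (nat \<Rightarrow> nat \<Rightarrow> complex) set" where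
  "params q k = {x. (\<forall>j i. \<not> (j < k \<and> i \<in> row_supp q j) \<longrightarrow> x j i = 0) \<and> (\<forall>j<k. \<exists>i. x j i \<noteq> 0)}"

definition mat_of :: "nat \<Rightarrow> (nat \<Rightarrow> nat \<Rightarrow> complex) \<Rightarrow> nat \<Rightarrow> nat \<Rightarrow> complex" where
  "mat_of q x = (\<lambda>i j. if i = Suc j * q then 1 else x j i)"

definition pt :: "nat \<Rightarrow> nat \<Rightarrow> (nat \<Rightarrow> nat \<Rightarrow> complex) \<Rightarrow> (nat set \<Rightarrow> complex) set" where
  "pt q k x = line (plu (k * q + 1) k (mat_of q x))"

text \<open>Near the limit point the section is a quotient of forms whose degrees differ by
  \<open>D\<close>. Along \<open>g t\<close> this quotient stays bounded, while the factor t ^ N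
  contributes t ^ (N * D).\<close>

lemma section_of_tendsto_zero:
  assumes s: "section_of I X D s" and x0: "line g0 \<in> X" and D: "D \<ge> 1" and N: "N \<ge> 1"
    and g: "\<And>t. g t \<in> vectors I" and lim: "\<And>i. i \<in> I \<Longrightarrow> ((\<lambda>t. g t i) \<longlongrightarrow> g0 i) (at 0)"
    and gX: "\<And>t. t \<noteq> 0 \<Longrightarrow> line (g t) \<in> X"
  shows "((\<lambda>t. s (\<lambda>i. t ^ N * g t i)) \<longlongrightarrow> 0) (at (0::complex))"
proof -
  obtain U e F G where U: "openin (ztop (proj_space I)) U" "line g0 \<in> U"
    "homfun I (D + e) F" "homfun I e G" "\<And>v. v \<in> \<Union>(U \<inter> X) \<Longrightarrow> G v \<noteq> 0 \<and> s v = F v / G v"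
    using s x0 unfolding section_of_def by metis
  have G0: "G g0 \<noteq> 0" using U(2,5) x0 line_self by blast
  have ev: "\<forall>\<^sub>F t in at 0. line (g t) \<in> U"
    using eventually_line_in_open[of I U g0 g "at 0"] U(1,2) g lim by simp
  have "((\<lambda>t. t ^ (N * D) * (F (g t) / G (g t))) \<longlongrightarrow> 0 ^ (N * D) * (F g0 / G g0)) (at 0)"
    using homfun_tendsto[OF U(3) lim] homfun_tendsto[OF U(4) lim] G0 by (intro tendsto_intros)
  then have "((\<lambda>t. t ^ (N * D) * (F (g t) / G (g t))) \<longlongrightarrow> 0) (at 0)"
    using D N by (simp add: power_0_left)
  moreover have "\<forall>\<^sub>F t in at 0. t ^ (N * D) * (F (g t) / G (g t)) = s (\<lambda>i. t ^ N * g t i)"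
    using ev eventually_neq_at_within[of 0 0 UNIV]
  proof eventually_elim
    case (elim t)
    let ?w = "\<lambda>i. t ^ N * g t i"
    have tN: "t ^ N \<noteq> 0" using elim by simp
    have "?w \<in> line (g t)" by (rule lineI[OF tN])
    then have "?w \<in> \<Union>(U \<inter> X)" using elim gX by blast
    then have "s ?w = F ?w / G ?w" using U(5) by blast
    also have "\<dots> = (t ^ N) ^ (D + e) * F (g t) / ((t ^ N) ^ e * G (g t))"
      by (simp only: homfun_scale[OF U(3)] homfun_scale[OF U(4)])
    also have "\<dots> = t ^ (N * D) * (F (g t) / G (g t))"
      using elim(2) by (simp add: power_add power_mult)
    finally show ?case by simp
  qed
  ultimately show ?thesis by (rule Lim_transform_eventually)
qed

context
  fixes q k n :: nat
  assumes q: "q \<ge> 1" and k: "k \<ge> 1" and n: "n = k * q + 1"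
begin

lemmas np = n_pos[OF q k n]

lemma X_ss_eq: "X_ss q k = semistable (plucker_index n k) (schubert n k (minimal_w q k)) n
    (ext_pow n k ` \<Union>(T_J q k))"
  unfolding X_ss_def n Let_def ..

text \<open>The Hilbert--Mumford inequality for the one-parameter subgroup scaling the coordinates in a
  union of blocks: if it failed, the subgroup would contract an invariant section to \<open>0\<close>.\<close>

lemma semistable_inequality:
  assumes x: "x \<in> X_ss q k" and xA: "x = line (plu n k A)" and I: "I = {i. i < n \<and> i div q \<in> J}"
  shows "\<exists>T. plu n k A T \<noteq> 0 \<and> n * card (T \<inter> I) \<le> k * card I"
proof (rule ccontr)
  let ?PI = "plucker_index n k"
  let ?X = "schubert n k (minimal_w q k)"
  assume "\<not> ?thesis"
  then have neg: "k * card I < n * card (T \<inter> I)" if "plu n k A T \<noteq> 0" for T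
    using that by (meson not_le)
  from x obtain m s where xX: "x \<in> ?X" and m: "m \<ge> 1" and s: "section_of ?PI ?X (n * m) s"
    and inv: "\<And>a v. a \<in> ext_pow n k ` \<Union>(T_J q k) \<Longrightarrow> v \<in> \<Union>?X \<Longrightarrow> s (a v) = s v"
    and sx: "\<And>v. v \<in> x \<Longrightarrow> s v \<noteq> 0"
    unfolding X_ss_eq semistable_def by blast
  obtain A' S' where A': "x = line (plu n k A')" "plu n k A' S' \<noteq> 0"
    "\<And>S. plu n k A' S \<noteq> 0 \<Longrightarrow> index_le q k S" by (rule schubert_subset[OF q k n xX]) blast
  have "plu n k A' \<in> line (plu n k A)" using A'(1) xA line_self by metis
  then obtain c where c: "c \<noteq> 0" "plu n k A' = (\<lambda>S. c * plu n k A S)" by (rule lineE)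
  have A0: "plu n k A S' \<noteq> 0" using A'(2) c by simp
  have Ale: "index_le q k S" if "plu n k A S \<noteq> 0" for S using A'(3)[of S] that c by simp
  \<comment> \<open>The weight -1 on \<open>I\<close> selects a nonvanishing coordinate that meets
    \<open>I\<close> in as few rows as possible.\<close>
  obtain S B where S: "S \<in> ?PI" "plu n k A S \<noteq> 0" "unit_rows k B (pick S)"
    "line (plu n k B) = line (plu n k A)" "\<And>T. plu n k B T = 0 \<longleftrightarrow> plu n k A T = 0"
    and zero: "\<And>l i. l < k \<Longrightarrow> i < n \<Longrightarrow> (if i \<in> I then -1 else 0::int) > (if pick S l \<in> I then -1 else 0) \<Longrightarrow> B i l = 0"
    using extremal_normal_form[OF A0, of "\<lambda>i. if i \<in> I then -1 else 0"] by metis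
  \<comment> \<open>The one-parameter subgroup scales the rows in \<open>I\<close> by
    \<open>t\<close>, and the columns are rescaled to keep the unit rows. The entries which this
    would multiply by 1 / t lie in rows outside \<open>I\<close> and columns with pivot in
    \<open>I\<close>; they vanish by the choice of \<open>S\<close>, so the path extends to t =
    0.\<close>
  define Bt where "Bt t = (\<lambda>i l. B i l * (if i \<in> I \<and> pick S l \<notin> I then t else 1))" for t :: complex
  have scale: "plu n k (Bt t) T * t ^ card (S \<inter> I) = t ^ card (T \<inter> I) * plu n k B T" if t: "t \<noteq> 0" for t T
  proof (cases "T \<in> ?PI")
    case False then show ?thesis by (simp add: plu_def)
  next
    case T: True
    let ?r = "\<lambda>i. if i \<in> I then t else 1" and ?c = "\<lambda>l. if pick S l \<in> I then 1 / t else 1"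
    have "minor k (Bt t) (pick T) = minor k (\<lambda>i l. ?r i * B i l * ?c l) (pick T)"
    proof (rule minor_cong)
      fix a b assume ab: "a < k" "b < k"
      show "Bt t (pick T a) b = ?r (pick T a) * B (pick T a) b * ?c b"
        using zero[OF ab(2) pick_plucker(4)[OF T ab(1)]] t by (simp add: Bt_def)
    qed
    also have "\<dots> = (\<Prod>a<k. ?r (pick T a)) * (\<Prod>b<k. ?c b) * minor k B (pick T)" by (rule minor_scale)
    also have "(\<Prod>a<k. ?r (pick T a)) = (\<Prod>i\<in>T. ?r i)"
      using prod.reindex[OF pick_plucker(3)[OF T], of ?r] pick_plucker(1)[OF T] by simp
    also have "(\<Prod>i\<in>T. ?r i) = t ^ card (T \<inter> I)"
      using plucker_indexD[OF T] by (simp add: prod.If_cases)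
    also have "(\<Prod>b<k. ?c b) = (\<Prod>i\<in>S. if i \<in> I then 1 / t else 1)"
      using prod.reindex[OF pick_plucker(3)[OF S(1)], of "\<lambda>i. if i \<in> I then 1 / t else 1"]
        pick_plucker(1)[OF S(1)] by simp
    also have "\<dots> = (1 / t) ^ card (S \<inter> I)"
      using plucker_indexD[OF S(1)] by (simp add: prod.If_cases)
    finally show ?thesis using t T by (simp add: plu_def power_divide)
  qed
  have BtS: "plu n k (Bt t) S = 1" for t
  proof -
    have "unit_rows k (Bt t) (pick S)" using S(3) by (auto simp: unit_rows_def Bt_def)
    then show ?thesis using S(1) by (simp add: plu_def minor_unit_rows)
  qed
  have nzt: "index_le q k T" if "plu n k (Bt t) T \<noteq> 0" "t \<noteq> 0" for t T
    using scale[OF that(2), of T] that Ale[of T] S(5)[of T] by auto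
  have BtX: "line (plu n k (Bt t)) \<in> ?X" if "t \<noteq> 0" for t
    by (rule schubert_supset[OF q k n, of _ S]) (use BtS nzt that in auto)
  \<comment> \<open>The parameter is an \<open>n\<close>-th power so that the scalar which
    normalises the determinant is itself a power of \<open>\<tau>\<close>.\<close>
  have lim: "((\<lambda>\<tau>. plu n k (Bt (\<tau> ^ n)) T) \<longlongrightarrow> plu n k (Bt 0) T) (at 0)" for T
  proof -
    have "((\<lambda>\<tau>. minor k (Bt (\<tau> ^ n)) (pick T)) \<longlongrightarrow> minor k (Bt 0) (pick T)) (at 0)"
    proof (rule minor_tendsto)
      fix a b
      have "((\<lambda>\<tau>::complex. \<tau> ^ n) \<longlongrightarrow> 0 ^ n) (at 0)" by (intro tendsto_intros)
      then have "((\<lambda>\<tau>. if pick T a \<in> I \<and> pick S b \<notin> I then \<tau> ^ n else 1) \<longlongrightarrow>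
          (if pick T a \<in> I \<and> pick S b \<notin> I then 0 else 1)) (at (0::complex))"
        using np by (auto simp: power_0_left)
      then show "((\<lambda>\<tau>. Bt (\<tau> ^ n) (pick T a) b) \<longlongrightarrow> Bt 0 (pick T a) b) (at 0)"
        unfolding Bt_def by (intro tendsto_mult tendsto_const)
    qed
    then show ?thesis by (simp add: plu_def)
  qed
  \<comment> \<open>A coordinate that is nonzero at t = 0 is nonzero for small nonzero parameters,
    where the Bruhat condition is already known.\<close>
  have nz0: "index_le q k T" if T: "plu n k (Bt 0) T \<noteq> 0" for T
  proof -
    have "\<forall>\<^sub>F \<tau> in at (0::complex). plu n k (Bt (\<tau> ^ n)) T \<noteq> 0 \<and> \<tau> \<noteq> 0"
      by (intro eventually_conj tendsto_imp_eventually_ne[OF lim T] eventually_neq_at_within)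
    then obtain \<tau> :: complex where "plu n k (Bt (\<tau> ^ n)) T \<noteq> 0" "\<tau> \<noteq> 0"
      using eventually_happens'[OF trivial_limit_at] by blast
    then show ?thesis using nzt[of "\<tau> ^ n" T] by simp
  qed
  have B0X: "line (plu n k (Bt 0)) \<in> ?X"
    by (rule schubert_supset[OF q k n, of _ S]) (use BtS nz0 in auto)
  \<comment> \<open>The exponent with which the normalised subgroup scales the coordinate of
    \<open>S\<close>; it is positive because the inequality is assumed to fail.\<close>
  define N where "N = n * card (S \<inter> I) - k * card I"
  have N: "N \<ge> 1" "n * card (S \<inter> I) = N + k * card I" using neg[OF S(2)] by (auto simp: N_def)
  have const: "s (\<lambda>T. \<tau> ^ N * plu n k (Bt (\<tau> ^ n)) T) = s (plu n k B)" if \<tau>: "\<tau> \<noteq> 0" for \<tau>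
  proof -
    \<comment> \<open>Dividing by \<open>\<tau> ^ card I\<close> makes the product of the
      \<open>n\<close> diagonal entries equal to 1.\<close>
    define u where "u b = (if b \<in> J then \<tau> ^ n / \<tau> ^ card I else 1 / \<tau> ^ card I)" for b
    have II: "{..<n} \<inter> {a. a div q \<in> J} = I" "I \<subseteq> {..<n}" "finite I" unfolding I by auto
    have u0: "u b \<noteq> 0" for b using \<tau> by (simp add: u_def)
    have ua: "u (a div q) = (if a div q \<in> J then \<tau> ^ n else 1) * (1 / \<tau> ^ card I)" for a
      by (simp add: u_def)
    have "(\<Prod>a<n. u (a div q)) = (\<tau> ^ n) ^ card I * (1 / \<tau> ^ card I) ^ n"
    proof -
      have "(\<Prod>a<n. if a div q \<in> J then \<tau> ^ n else 1) = (\<tau> ^ n) ^ card I"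
        by (simp add: prod.If_cases II(1))
      then show ?thesis unfolding ua prod.distrib by simp
    qed
    also have "\<dots> = 1" using \<tau> by (simp add: power_divide power_mult[symmetric] mult.commute)
    finally have "\<exists>C\<in>T_J q k. diagm n (\<lambda>a. u (a div q)) \<in> C"
      using T_J_contains_diagm[of q n k u] q n u0 by simp
    then have g: "ext_pow n k (diagm n (\<lambda>a. u (a div q))) \<in> ext_pow n k ` \<Union>(T_J q k)" by blast
    have "plu n k B \<in> x" unfolding xA S(4)[symmetric] by (rule line_self)
    then have vX: "plu n k B \<in> \<Union>?X" using xX by (rule UnionI[rotated])
    have "ext_pow n k (diagm n (\<lambda>a. u (a div q))) (plu n k B) = (\<lambda>T. \<tau> ^ N * plu n k (Bt (\<tau> ^ n)) T)"
    proof
      fix T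
      show "ext_pow n k (diagm n (\<lambda>a. u (a div q))) (plu n k B) T = \<tau> ^ N * plu n k (Bt (\<tau> ^ n)) T"
      proof (cases "T \<in> ?PI")
        case False then show ?thesis by (simp add: plu_def ext_pow_def)
      next
        case T: True
        have TI: "T \<inter> {a. a div q \<in> J} = T \<inter> I" using plucker_indexD[OF T] unfolding I by auto
        have "(\<Prod>i\<in>T. u (i div q)) = (\<tau> ^ n) ^ card (T \<inter> I) * (1 / \<tau> ^ card I) ^ k"
        proof -
          have "(\<Prod>i\<in>T. if i div q \<in> J then \<tau> ^ n else 1) = (\<tau> ^ n) ^ card (T \<inter> I)"
            using plucker_indexD[OF T] by (simp add: prod.If_cases TI)
          then show ?thesis unfolding ua prod.distrib using plucker_indexD[OF T] by simp
        qed
        then have "ext_pow n k (diagm n (\<lambda>a. u (a div q))) (plu n k B) T =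
            (\<tau> ^ n) ^ card (T \<inter> I) * plu n k B T / \<tau> ^ (k * card I)"
          by (simp add: ext_pow_diagm[OF plu_vectors] power_divide power_mult[symmetric] mult.commute)
        also have "(\<tau> ^ n) ^ card (T \<inter> I) * plu n k B T = plu n k (Bt (\<tau> ^ n)) T * (\<tau> ^ n) ^ card (S \<inter> I)"
          using scale[of "\<tau> ^ n" T] \<tau> by simp
        also have "(\<tau> ^ n) ^ card (S \<inter> I) = \<tau> ^ N * \<tau> ^ (k * card I)"
          by (simp add: power_mult[symmetric] N(2) power_add)
        finally show ?thesis using \<tau> by simp
      qed
    qed
    then show ?thesis using inv[OF g vX] by simp
  qed
  have "((\<lambda>\<tau>. s (\<lambda>T. \<tau> ^ N * plu n k (Bt (\<tau> ^ n)) T)) \<longlongrightarrow> 0) (at 0)"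
    by (rule section_of_tendsto_zero[OF s B0X _ N(1) plu_vectors lim])
       (use m np BtX in auto)
  moreover have "\<forall>\<^sub>F \<tau> in at (0::complex). s (\<lambda>T. \<tau> ^ N * plu n k (Bt (\<tau> ^ n)) T) = s (plu n k B)"
    using eventually_neq_at_within[of 0 0 UNIV] by eventually_elim (rule const)
  ultimately have "((\<lambda>\<tau>::complex. s (plu n k B)) \<longlongrightarrow> 0) (at 0)" by (rule Lim_transform_eventually)
  then have "s (plu n k B) = 0" by (simp add: tendsto_const_iff)
  moreover have "plu n k B \<in> x" unfolding xA S(4)[symmetric] by (rule line_self)
  ultimately show False using sx[of "plu n k B"] by simp
qed

end

lemma homfun_power: "homfun I d F \<Longrightarrow> homfun I (d * e) (\<lambda>v. F v ^ e)"
proof (induction e)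
  case 0 show ?case using homfun.const[of I 1] by simp
next
  case (Suc e) then show ?case using homfun.mult[of I d F "d * e"] by (simp add: add.commute)
qed

lemma homfun_prod:
  "finite J \<Longrightarrow> (\<And>j. j \<in> J \<Longrightarrow> homfun I (d j) (F j)) \<Longrightarrow> homfun I (\<Sum>j\<in>J. d j) (\<lambda>v. \<Prod>j\<in>J. F j v)"
proof (induction J rule: finite_induct)
  case empty show ?case using homfun.const[of I 1] by simp
next
  case (insert j J) then show ?case using homfun.mult[of I "d j" "F j"] by simp
qed

section \<open>Reduced echelon matrices and semistability\<close>

lemma row_supp_pivot: "q \<ge> 1 \<Longrightarrow> Suc a * q \<notin> row_supp q j"
  by (auto simp: row_supp_def)

lemma row_supp_block: "q \<ge> 1 \<Longrightarrow> i \<in> row_supp q j \<Longrightarrow> i div q \<le> j"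
  using div_less_iff_less_mult[of q i "Suc j"] by (simp add: row_supp_def less_Suc_eq_le)

context
  fixes q k n :: nat
  assumes q: "q \<ge> 1" and k: "k \<ge> 1" and n: "n = k * q + 1"
begin

lemma params_supp: "y \<in> params q k \<Longrightarrow> y j i \<noteq> 0 \<Longrightarrow> j < k \<and> i \<in> row_supp q j"
  unfolding params_def by blast

lemma mat_of_unit_rows:
  assumes y: "y \<in> params q k"
  shows "unit_rows k (mat_of q y) (\<lambda>a. Suc a * q)"
  unfolding unit_rows_def
proof (intro allI impI)
  fix a b assume "a < k" "b < k"
  have "y b (Suc a * q) = 0" using params_supp[OF y] row_supp_pivot[OF q, of a b] by blast
  then show "mat_of q y (Suc a * q) b = (if a = b then 1 else 0)"
    using q by (auto simp: mat_of_def simp del: mult_Suc)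
qed

lemma mat_of_echelon:
  assumes y: "y \<in> params q k"
  shows "echelon q k n (mat_of q y)"
  unfolding echelon_def
proof (intro allI impI)
  fix j i assume i: "Suc j * q < i"
  then have "y j i = 0" using params_supp[OF y, of j i] by (auto simp: row_supp_def)
  then show "mat_of q y i j = 0" using i by (simp add: mat_of_def)
qed

lemma plu_mat_of_pivot_set:
  assumes y: "y \<in> params q k"
  shows "plu n k (mat_of q y) (pivot_set q k) = 1"
proof -
  have "minor k (mat_of q y) (pick (pivot_set q k)) = minor k (mat_of q y) (\<lambda>a. Suc a * q)"
    using pick_pivot_set[OF q k n] by (intro minor_cong) (simp del: mult_Suc)
  then show ?thesis
    using pivot_set_plucker[OF q k n] minor_unit_rows[OF mat_of_unit_rows[OF y]] by (simp add: plu_def)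
qed

text \<open>The inequality for the blocks 0 to \<open>j\<close> yields a nonvanishing coordinate
  with at most \<open>j\<close> rows above (j + 1) * q, because n * (j + 1) exceeds k * (j + 1) * q;
  this pushes the pivot of column \<open>j\<close> down to its largest admissible position. The
  inequality for the single block j + 1 excludes that the rest of column \<open>j\<close>
  vanishes.\<close>

lemma semistable_form:
  assumes x: "x \<in> X_ss q k"
  obtains y where "y \<in> params q k" "x = pt q k y"
proof -
  let ?PI = "plucker_index n k"
  from x have "x \<in> schubert n k (minimal_w q k)"
    unfolding X_ss_eq[OF q k n] semistable_def by blast
  then obtain A S' where A: "x = line (plu n k A)" "plu n k A S' \<noteq> 0"
    "\<And>S. plu n k A S \<noteq> 0 \<Longrightarrow> index_le q k S" by (rule schubert_subset[OF q k n]) blast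
  obtain S B where S: "S \<in> ?PI" "plu n k A S \<noteq> 0" "unit_rows k B (pick S)"
    "line (plu n k B) = line (plu n k A)" "\<And>T. plu n k B T = 0 \<longleftrightarrow> plu n k A T = 0"
    and ech: "\<And>l i. l < k \<Longrightarrow> i < n \<Longrightarrow> int i > int (pick S l) \<Longrightarrow> B i l = 0"
    using extremal_normal_form[OF A(2), of int] by metis
  have match: "\<exists>p. p permutes {0..<k} \<and> (\<forall>a<k. B (pick T a) (p a) \<noteq> 0)" "T \<in> ?PI"
    if "plu n k A T \<noteq> 0" for T
  proof -
    from that S(5)[of T] have "plu n k B T \<noteq> 0" by simp
    then have "minor k B (pick T) \<noteq> 0" and TP: "T \<in> ?PI" by (auto simp: plu_def split: if_splits)
    then show "\<exists>p. p permutes {0..<k} \<and> (\<forall>a<k. B (pick T a) (p a) \<noteq> 0)" "T \<in> ?PI"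
      using minor_nonzero_matching[of k B "pick T"] by metis+
  qed
  have pS: "pick S j = Suc j * q" if j: "j < k" for j
  proof (rule antisym)
    show "pick S j \<le> Suc j * q" using A(3)[OF S(2)] j unfolding index_le_def by (elim allE impE)
    \<comment> \<open>The blocks 0 to \<open>j\<close> are exactly the rows above the pivot row of
      column \<open>j\<close>.\<close>
    define I where "I = {i. i < n \<and> i div q \<in> {..j}}"
    have dl: "i div q \<in> {..j} \<longleftrightarrow> i < Suc j * q" for i
      using q div_less_iff_less_mult[of q i "Suc j"] by (simp only: atMost_iff less_Suc_eq_le[symmetric])
    have I: "I = {..<Suc j * q}"
      unfolding I_def dl using less_trans[OF _ pivot_less[OF q k n j]] by blast
    obtain T where T: "plu n k A T \<noteq> 0" "n * card (T \<inter> I) \<le> k * card I"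
      using semistable_inequality[OF q k n x A(1) I_def] by blast
    obtain p where p: "p permutes {0..<k}" "\<And>a. a < k \<Longrightarrow> B (pick T a) (p a) \<noteq> 0"
      using match(1)[OF T(1)] by blast
    note TP = match(2)[OF T(1)]
    have "card (T \<inter> I) < Suc j"
    proof (rule ccontr)
      assume "\<not> card (T \<inter> I) < Suc j"
      then have "n * Suc j \<le> n * card (T \<inter> I)" by (intro mult_le_mono2) simp
      also have "\<dots> \<le> k * (Suc j * q)" using T(2) by (simp add: I)
      finally have "n * Suc j \<le> k * (Suc j * q)" .
      moreover have "n * Suc j = k * (Suc j * q) + Suc j" unfolding n by (simp add: algebra_simps)
      ultimately show False by linarith
    qed
    have "Suc j * q \<le> pick T j"
    proof (rule ccontr)
      assume lt: "\<not> Suc j * q \<le> pick T j"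
      have "pick T ` {..j} \<subseteq> T \<inter> I"
      proof
        fix i assume "i \<in> pick T ` {..j}"
        then obtain a where a: "a \<le> j" "i = pick T a" by auto
        then have "pick T a \<le> pick T j" using j strict_mono_on_leD[OF pick_plucker(2)[OF TP], of a j] by simp
        then show "i \<in> T \<inter> I" using a j lt pick_plucker(5)[OF TP, of a] unfolding I by auto
      qed
      then have "card (pick T ` {..j}) \<le> card (T \<inter> I)" using I by (intro card_mono) auto
      moreover have "{..j} \<subseteq> {..<k}" using j by auto
      from card_image[OF inj_on_subset[OF pick_plucker(3)[OF TP] this]]
      have "card (pick T ` {..j}) = Suc j" by simp
      ultimately show False using \<open>card (T \<inter> I) < Suc j\<close> by simp
    qed
    \<comment> \<open>In the echelon form at \<open>S\<close> a matching pairs every row of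
      \<open>T\<close> with a pivot at or below it.\<close>
    also have "pick T j \<le> pick S j"
    proof (rule strict_mono_matching_le[OF pick_plucker(2)[OF TP] pick_plucker(2)[OF S(1)] p(1) _ j])
      fix a assume a: "a < k"
      show "pick T a \<le> pick S (p a)"
        using ech[OF permutes_lessThan[OF p(1) a] pick_plucker(4)[OF TP a]] p(2)[OF a] by (meson not_le of_nat_less_iff)
    qed
    finally show "Suc j * q \<le> pick S j" .
  qed
  have unit: "B (Suc a * q) b = (if a = b then 1 else 0)" if "a < k" "b < k" for a b
    using S(3) that unfolding unit_rows_def by (metis pS)
  define y where "y j i = (if j < k \<and> i \<in> row_supp q j then B i j else 0)" for j i
  have By: "B i j = mat_of q y i j" if i: "i < n" and j: "j < k" for i j
  proof -
    \<comment> \<open>Above the pivot, a nonzero multiple of \<open>q\<close> is the pivot row of an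
      earlier column.\<close>
    consider "i = Suc j * q" | "Suc j * q < i" | "i < Suc j * q" "i \<noteq> 0" "q dvd i" | "i \<in> row_supp q j"
      unfolding row_supp_def by force
    then show ?thesis
    proof cases
      case 1 then show ?thesis using unit j by (simp add: mat_of_def del: mult_Suc)
    next
      case 2
      then have "i \<notin> row_supp q j" by (simp add: row_supp_def)
      moreover have "int (pick S j) < int i" using 2 pS[OF j] by (simp del: mult_Suc of_nat_mult)
      then have "B i j = 0" by (rule ech[OF j i])
      ultimately show ?thesis using 2 by (simp add: mat_of_def y_def del: mult_Suc)
    next
      case 3
      then obtain c where c: "i = q * c" by (auto elim: dvdE)
      then obtain a where a: "i = Suc a * q" using 3(2) by (cases c) (auto simp: mult.commute)
      then have "a < j" using 3(1) by (simp del: mult_Suc)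
      then have "B i j = 0" using unit[of a j] j a by simp
      moreover have "i \<notin> row_supp q j" using 3 by (simp add: row_supp_def)
      ultimately show ?thesis using 3(1) by (simp add: mat_of_def y_def del: mult_Suc)
    next
      case 4
      then have "i \<noteq> Suc j * q" by (auto simp: row_supp_def)
      then show ?thesis using 4 j by (simp add: mat_of_def y_def del: mult_Suc)
    qed
  qed
  have "plu n k B = plu n k (mat_of q y)"
  proof
    fix T show "plu n k B T = plu n k (mat_of q y) T"
      using By pick_plucker(4)[of T n k] by (auto simp: plu_def intro!: minor_cong)
  qed
  then have xy: "x = pt q k y" unfolding pt_def n[symmetric] using A(1) S(4) by simp
  have "\<exists>i. y j i \<noteq> 0" if j: "j < k" for j
  proof (rule ccontr)
    assume "\<not> (\<exists>i. y j i \<noteq> 0)"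
    then have Bj: "B i j = (if i = Suc j * q then 1 else 0)" if "i < n" for i
      using By[OF that j] by (simp add: mat_of_def)
    \<comment> \<open>Block j + 1 has at most \<open>q\<close> rows, so k * card I < n and some
      nonvanishing coordinate avoids the block. A column \<open>j\<close> consisting of its pivot
      alone would force the pivot row, which lies in this block, into every nonvanishing
      coordinate.\<close>
    define I where "I = {i. i < n \<and> i div q \<in> {Suc j}}"
    obtain T where T: "plu n k A T \<noteq> 0" "n * card (T \<inter> I) \<le> k * card I"
      using semistable_inequality[OF q k n x A(1) I_def] by blast
    have "i \<in> {Suc j * q..<Suc j * q + q}" if "i \<in> I" for i
    proof -
      have "i div q = Suc j" using that by (simp add: I_def)
      then have e: "Suc j * q + i mod q = i" using div_mult_mod_eq[of i q] by simp
      have "i mod q < q" using q by (intro mod_less_divisor) simp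
      with e have "Suc j * q \<le> i" "i < Suc j * q + q" by linarith+
      then show ?thesis by simp
    qed
    then have "card I \<le> card {Suc j * q..<Suc j * q + q}" by (intro card_mono) auto
    then have "k * card I \<le> k * q" by simp
    with T(2) n have "n * card (T \<inter> I) < n * 1" by linarith
    then have "card (T \<inter> I) < 1" by (simp only: mult_less_cancel1)
    moreover have "finite (T \<inter> I)" by (simp add: I_def)
    ultimately have TI: "T \<inter> I = {}" by simp
    obtain p where p: "p permutes {0..<k}" "\<And>a. a < k \<Longrightarrow> B (pick T a) (p a) \<noteq> 0"
      using match(1)[OF T(1)] by blast
    note TP = match(2)[OF T(1)]
    obtain a where a: "p a = j" using permutes_surj[OF p(1)] by (metis surjD)
    then have ak: "a < k" using permutes_in_image[OF p(1), of a] j by simp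
    have "pick T a = Suc j * q"
      using p(2)[OF ak] Bj[OF pick_plucker(4)[OF TP ak]] a by (auto split: if_splits)
    moreover have "Suc j * q \<in> I" using pivot_less[OF q k n j] q unfolding I_def by (simp del: mult_Suc)
    ultimately show False using TI pick_plucker(5)[OF TP ak] by auto
  qed
  then have "y \<in> params q k" unfolding params_def by (auto simp: y_def)
  then show ?thesis using that xy by blast
qed

text \<open>Every row has a nonzero entry, lying in an earlier block.  Following these entries from row
  \<open>j\<close> down to the first block exchanges the pivots along the path, which moves one index from block
  \<open>j + 1\<close> to block \<open>0\<close> while keeping the Pluecker coordinate nonzero.\<close>

lemma exchange_path:
  assumes y: "y \<in> params q k" and j: "j < k"
  shows "\<exists>\<rho> E. j \<in> E \<and> E \<subseteq> {..j} \<and> (\<forall>l. l \<notin> E \<longrightarrow> \<rho> l = Suc l * q) \<and>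
      (\<forall>l\<in>E. y l (\<rho> l) \<noteq> 0) \<and> (\<forall>l\<in>E. \<forall>l'\<in>E. l' < l \<longrightarrow> l' < \<rho> l div q) \<and>
      (\<forall>u :: nat \<Rightarrow> complex. (\<Prod>l<k. u (\<rho> l div q)) * u (Suc j) = (\<Prod>b<Suc k. u b))"
  using j
proof (induction j rule: less_induct)
  case (less j)
  obtain c where c: "y j c \<noteq> 0" using y less.prems unfolding params_def by blast
  then have cs: "c \<in> row_supp q j" using params_supp[OF y] by blast
  have split_j: "(\<Prod>l<k. f l) = f j * (\<Prod>l\<in>{..<k} - {j}. f l)" for f :: "nat \<Rightarrow> complex"
    using less.prems by (intro prod.remove) auto
  \<comment> \<open>Replacing the pivot of column \<open>j\<close> by row \<open>c\<close> trades a
    factor of block j + 1 for one of the block of \<open>c\<close>. An identity for all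
    \<open>u\<close> thus records how many rows lie in each block.\<close>
  have upd: "(\<Prod>l<k. u ((\<sigma>(j := c)) l div q)) * u (Suc j) = (\<Prod>l<k. u (\<sigma> l div q)) * u (c div q)"
    if "\<sigma> j = Suc j * q" for \<sigma> and u :: "nat \<Rightarrow> complex"
    unfolding split_j[of "\<lambda>l. u ((\<sigma>(j := c)) l div q)"] split_j[of "\<lambda>l. u (\<sigma> l div q)"]
    using that q by (simp add: mult_ac del: mult_Suc)
  show ?case
  proof (cases "c div q")
    case 0
    have "(\<Prod>l<k. u (((\<lambda>l. Suc l * q)(j := c)) l div q)) * u (Suc j) = (\<Prod>b<Suc k. u b)" for u :: "nat \<Rightarrow> complex"
      unfolding upd[of "\<lambda>l. Suc l * q", OF refl] 0 prod.lessThan_Suc_shift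
      using q by (simp add: mult.commute del: mult_Suc)
    then show ?thesis using c
      by (intro exI[of _ "(\<lambda>l. Suc l * q)(j := c)"] exI[of _ "{j}"]) (auto simp del: mult_Suc)
  next
    \<comment> \<open>The entry lies in block i + 1, which contains the pivot of column
      \<open>i\<close>; the path continues in that column.\<close>
    case (Suc i)
    have ij: "i < j" using row_supp_block[OF q cs] Suc by simp
    from less.IH[OF ij less_trans[OF ij less.prems]]
    obtain \<sigma> E where IH0: "i \<in> E" "E \<subseteq> {..i}" "\<forall>l. l \<notin> E \<longrightarrow> \<sigma> l = Suc l * q" "\<forall>l\<in>E. y l (\<sigma> l) \<noteq> 0"
      "\<forall>l\<in>E. \<forall>l'\<in>E. l' < l \<longrightarrow> l' < \<sigma> l div q"
      "\<forall>u :: nat \<Rightarrow> complex. (\<Prod>l<k. u (\<sigma> l div q)) * u (Suc i) = (\<Prod>b<Suc k. u b)"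
      by (elim exE conjE)
    note IH = IH0(1,2) IH0(3-6)[rule_format]
    have jE: "j \<notin> E" using IH(2) ij by auto
    have "(\<Prod>l<k. u ((\<sigma>(j := c)) l div q)) * u (Suc j) = (\<Prod>b<Suc k. u b)" for u :: "nat \<Rightarrow> complex"
      unfolding upd[of \<sigma>, OF IH(3)[OF jE]] Suc by (rule IH(6))
    moreover have "l' < (\<sigma>(j := c)) l div q" if "l \<in> insert j E" "l' \<in> insert j E" "l' < l" for l l'
    proof (cases "l = j")
      case True
      then have "l' \<in> E" using that by auto
      then show ?thesis using IH(2) True Suc by auto
    next
      case False
      then have "l \<in> E" "l \<le> i" using that IH(2) by auto
      moreover from this have "l' \<in> E" using that ij by auto
      ultimately show ?thesis using IH(5)[of l l'] that False by simp
    qed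
    moreover have "insert j E \<subseteq> {..j}" using IH(2) ij by auto
    ultimately show ?thesis using c IH(3,4) jE
      by (intro exI[of _ "\<sigma>(j := c)"] exI[of _ "insert j E"]) (auto simp del: mult_Suc)
  qed
qed

text \<open>On the rows of the path the matrix is triangular: a matching that assigns a row to a
  smaller column of the path would need a nonzero entry in a block beyond the support of that
  column. So the minor is the product of nonzero diagonal entries. The identity for all
  \<open>u\<close> says that the index set has one row in each block except block j + 1.\<close>

lemma exchange_index:
  assumes y: "y \<in> params q k" and j: "j < k"
  obtains S where "S \<in> plucker_index n k" "plu n k (mat_of q y) S \<noteq> 0"
    "\<And>u :: nat \<Rightarrow> complex. (\<Prod>i\<in>S. u (i div q)) * u (Suc j) = (\<Prod>b<Suc k. u b)"
proof -
  let ?A = "mat_of q y"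
  from exchange_path[OF y j]
  obtain \<rho> E where E0: "E \<subseteq> {..j}" "\<forall>l. l \<notin> E \<longrightarrow> \<rho> l = Suc l * q" "\<forall>l\<in>E. y l (\<rho> l) \<noteq> 0"
    "\<forall>l\<in>E. \<forall>l'\<in>E. l' < l \<longrightarrow> l' < \<rho> l div q"
    and P: "\<forall>u :: nat \<Rightarrow> complex. (\<Prod>l<k. u (\<rho> l div q)) * u (Suc j) = (\<Prod>b<Suc k. u b)"
    by (elim exE conjE)
  note E = E0(1) E0(2-4)[rule_format]
  have supp: "\<rho> l \<in> row_supp q l" if "l \<in> E" for l using params_supp[OF y E(3)[OF that]] by blast
  have A1: "?A (\<rho> l) b = y b (\<rho> l)" if "l \<in> E" for l b
    using row_supp_pivot[OF q, of b l] supp[OF that] by (auto simp: mat_of_def simp del: mult_Suc)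
  have "minor k ?A \<rho> = (\<Prod>a<k. ?A (\<rho> a) a)"
  proof (rule minor_diagonal)
    fix p assume p: "p permutes {0..<k}" and nz: "\<And>a. a < k \<Longrightarrow> ?A (\<rho> a) (p a) \<noteq> 0"
    have out: "p a = a" if "a \<notin> E" "a < k" for a
      using nz[OF that(2)] mat_of_unit_rows[OF y] E(2)[OF that(1)] permutes_lessThan[OF p that(2)] that(2)
      unfolding unit_rows_def by metis
    have "p a \<ge> a" if a: "a < k" for a
    proof (rule ccontr)
      assume lt: "\<not> a \<le> p a"
      then have aE: "a \<in> E" using out[OF _ a] by fastforce
      have "p a \<in> E"
      proof (rule ccontr)
        assume "p a \<notin> E"
        then have "p (p a) = p a" using out permutes_lessThan[OF p a] by blast
        then have "p a = a" using permutes_inj[OF p] by (blast dest: injD)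
        then show False using lt by simp
      qed
      then have "p a < \<rho> a div q" using E(4)[OF aE] lt by simp
      moreover have "\<rho> a \<in> row_supp q (p a)"
        using nz[OF a] params_supp[OF y, of "p a" "\<rho> a"] unfolding A1[OF aE] by blast
      ultimately show False using row_supp_block[OF q] by fastforce
    qed
    then show "p = id" using permutes_natset_ge[OF p] by simp
  qed
  moreover have "?A (\<rho> a) a \<noteq> 0" if "a < k" for a
  proof (cases "a \<in> E")
    case True then show ?thesis using A1 E(3) by simp
  next
    case False then show ?thesis using E(2) by (simp add: mat_of_def)
  qed
  ultimately have m: "minor k ?A \<rho> \<noteq> 0" by simp
  have "\<rho> l < n" if "l < k" for l
  proof (cases "l \<in> E")
    case True
    then have "\<rho> l < Suc l * q" using supp unfolding row_supp_def by blast
    then show ?thesis using pivot_less[OF q k n that] by (rule less_trans)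
  next
    case False then show ?thesis using E(2) pivot_less[OF q k n that] by simp
  qed
  then have sub: "\<rho> ` {..<k} \<subseteq> {..<n}" by auto
  show ?thesis
  proof (rule that[OF plu_nonzero_image[OF m sub]])
    fix u :: "nat \<Rightarrow> complex"
    show "(\<Prod>i\<in>\<rho> ` {..<k}. u (i div q)) * u (Suc j) = (\<Prod>b<Suc k. u b)"
      using P[rule_format, of u] by (simp add: prod.reindex[OF minor_nonzero_inj[OF m]])
  qed
qed

lemma pt_in_schubert:
  assumes y: "y \<in> params q k"
  shows "pt q k y \<in> schubert n k (minimal_w q k)"
  unfolding pt_def n[symmetric]
  by (rule schubert_supset[OF q k n, of _ "pivot_set q k"])
     (use plu_mat_of_pivot_set[OF y] echelon_plu[OF q k n mat_of_echelon[OF y]] in auto)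

text \<open>Blocks 0 to k - 1 have \<open>q\<close> rows each, block \<open>k\<close> has the single
  row k * q.\<close>

lemma prod_blocks: "(\<Prod>a<n. u (a div q)) = (\<Prod>b<k. u b) ^ q * (u k :: complex)"
proof -
  have "(\<Prod>a<k * q. u (a div q)) = (\<Prod>b<k. \<Prod>a\<in>{b * q..<b * q + q}. u (a div q))"
    by (rule prod.nat_group[symmetric])
  also have "\<dots> = (\<Prod>b<k. u b ^ q)"
  proof (rule prod.cong)
    fix b
    have "a div q = b" if "a \<in> {b * q..<b * q + q}" for a
      using that q by (intro div_nat_eqI) (auto simp: mult.commute)
    then have "(\<Prod>a\<in>{b * q..<b * q + q}. u (a div q)) = (\<Prod>a\<in>{b * q..<b * q + q}. u b)"
      by (intro prod.cong) auto
    then show "(\<Prod>a\<in>{b * q..<b * q + q}. u (a div q)) = u b ^ q" by simp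
  qed simp
  finally show ?thesis using q by (simp add: n prod_power_distrib)
qed

text \<open>The pivot set misses block 0 and \<open>S j\<close> misses block j + 1, so with
  \<open>P\<close> the product of all \<open>u b\<close> their coordinates have the weights
  \<open>P / u 0\<close> and \<open>P / u (Suc j)\<close>. Their product, with a suitable exponent
  on the last one, is a form of degree \<open>n\<close> whose weight is the \<open>k\<close>-th
  power of the determinant of the torus element.\<close>

lemma pt_semistable:
  assumes y: "y \<in> params q k"
  shows "pt q k y \<in> X_ss q k"
proof -
  let ?PI = "plucker_index n k" and ?X = "schubert n k (minimal_w q k)" and ?A = "mat_of q y"
  have "\<forall>j. \<exists>S. j < k \<longrightarrow> S \<in> ?PI \<and> plu n k ?A S \<noteq> 0 \<and>
      (\<forall>u :: nat \<Rightarrow> complex. (\<Prod>i\<in>S. u (i div q)) * u (Suc j) = (\<Prod>b<Suc k. u b))"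
    using exchange_index[OF y] by metis
  from choice[OF this] obtain S where "\<forall>j. j < k \<longrightarrow> S j \<in> ?PI \<and> plu n k ?A (S j) \<noteq> 0 \<and>
      (\<forall>u :: nat \<Rightarrow> complex. (\<Prod>i\<in>S j. u (i div q)) * u (Suc j) = (\<Prod>b<Suc k. u b))" by (elim exE)
  then have S: "\<And>j. j < k \<Longrightarrow> S j \<in> ?PI" "\<And>j. j < k \<Longrightarrow> plu n k ?A (S j) \<noteq> 0"
    "\<And>j (u :: nat \<Rightarrow> complex). j < k \<Longrightarrow> (\<Prod>i\<in>S j. u (i div q)) * u (Suc j) = (\<Prod>b<Suc k. u b)"
    by (simp_all del: prod.lessThan_Suc)
  \<comment> \<open>The exponents 1, ..., 1, n - k and the pivot coordinate add up to degree
    \<open>n\<close>. With Q = u 0 * ... * u (k - 1) the total weight becomes Q ^ (n - 1) * u k ^ k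
    = (Q ^ q * u k) ^ k, as n - 1 = k * q.\<close>
  define e where "e j = (if Suc j = k then n - k else 1)" for j
  define s where "s v = v (pivot_set q k) * (\<Prod>j<k. v (S j) ^ e j)" for v :: "nat set \<Rightarrow> complex"
  obtain k' where k': "k = Suc k'" using k by (cases k) auto
  have kn: "k \<le> n" by (rule k_le_n[OF q k n])
  have "homfun ?PI (1 + (\<Sum>j<k. 1 * e j)) s"
    unfolding s_def
    by (intro homfun.mult homfun_prod homfun_power homfun.coord pivot_set_plucker[OF q k n]) (use S(1) in auto)
  moreover have "1 + (\<Sum>j<k. 1 * e j) = n"
  proof -
    have "(\<Sum>j<k'. e j) = (\<Sum>j<k'. 1)" by (rule sum.cong) (auto simp: e_def k')
    then show ?thesis using kn by (simp add: k' e_def)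
  qed
  ultimately have hs: "homfun ?PI n s" by simp
  have sec: "section_of ?PI ?X (n * 1) s"
    unfolding section_of_def
  proof
    fix x assume x: "x \<in> ?X"
    obtain A S where "x = line (plu n k A)" "plu n k A S \<noteq> 0" using schubert_subset[OF q k n x] by metis
    then have "x \<in> proj_points ?PI" using plu_nonzero_proj[OF q k n] by blast
    then show "\<exists>U e F G. openin (ztop (proj_space ?PI)) U \<and> x \<in> U \<and> homfun ?PI (n * 1 + e) F \<and>
        homfun ?PI e G \<and> (\<forall>v\<in>\<Union>(U \<inter> ?X). G v \<noteq> 0 \<and> s v = F v / G v)"
      using hs homfun.const[of ?PI 1]
      by (intro exI[of _ "proj_points ?PI"] exI[of _ 0] exI[of _ s] exI[of _ "\<lambda>_. 1"])
         (auto simp: points_proj_space[symmetric])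
  qed
  have inv: "s (a v) = s v" if a: "a \<in> ext_pow n k ` \<Union>(T_J q k)" and v: "v \<in> \<Union>?X" for a v
  proof -
    from a obtain C g where g: "a = ext_pow n k g" "g \<in> C" "C \<in> T_J q k" by blast
    have q0: "q > 0" using q by simp
    obtain u where u: "\<And>b. u b \<noteq> 0" "g = diagm n (\<lambda>a. u (a div q))"
      using T_J_class(2)[OF q0 n g(3) g(2)] by blast
    have "det g = 1" using PSL_coset(1)[OF T_J_class(1)[OF q0 n g(3)] g(2) n_pos[OF q k n]] by simp
    then have d: "(\<Prod>b<k. u b) ^ q * u k = 1" unfolding u(2) det_diagm prod_blocks .
    from v obtain x where x: "x \<in> ?X" "v \<in> x" by blast
    obtain A S' where "x = line (plu n k A)" "plu n k A S' \<noteq> 0" using schubert_subset[OF q k n x(1)] by metis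
    then have "x \<in> proj_points ?PI" using plu_nonzero_proj[OF q k n] by blast
    then have "v \<in> vectors ?PI" using x(2) by (rule proj_points_vector)
    then have av: "a v = (\<lambda>S. (\<Prod>i\<in>S. u (i div q)) * v S)" unfolding g(1) u(2) by (rule ext_pow_diagm)
    define Q where "Q = (\<Prod>b<k. u b)"
    define P where "P = (\<Prod>b<Suc k. u b)"
    have PQ: "P = Q * u k" "P \<noteq> 0" "Q \<noteq> 0" using u(1) by (auto simp: P_def Q_def)
    have Q': "Q = u 0 * (\<Prod>j<k'. u (Suc j))" unfolding Q_def k' prod.lessThan_Suc_shift by simp
    have "(\<Prod>i\<in>pivot_set q k. u (i div q)) = (\<Prod>l<k. u (Suc l))"
      unfolding pivot_set_def[OF q k n] using strict_mono_on_imp_inj_on[OF pivot_mono[OF q k n]] q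
      by (subst prod.reindex) (auto simp del: mult_Suc)
    also have "\<dots> = P / u 0" using u(1)[of 0] unfolding P_def prod.lessThan_Suc_shift by simp
    finally have w: "(\<Prod>i\<in>pivot_set q k. u (i div q)) = P / u 0" .
    have wj: "(\<Prod>i\<in>S j. u (i div q)) = P / u (Suc j)" if "j < k" for j
      using S(3)[OF that, of u] u(1)[of "Suc j"] by (simp add: P_def field_simps)
    have "s (a v) = (P / u 0) * (\<Prod>j<k. (P / u (Suc j)) ^ e j) * s v"
    proof -
      have "(\<Prod>j<k. ((\<Prod>i\<in>S j. u (i div q)) * v (S j)) ^ e j) =
          (\<Prod>j<k. (P / u (Suc j)) ^ e j * v (S j) ^ e j)"
        by (rule prod.cong) (simp_all only: lessThan_iff wj power_mult_distrib)
      then show ?thesis unfolding s_def av w by (simp only: prod.distrib mult_ac)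
    qed
    also have "(P / u 0) * (\<Prod>j<k. (P / u (Suc j)) ^ e j) = 1"
    proof -
      have "(\<Prod>j<k'. (P / u (Suc j)) ^ e j) = (\<Prod>j<k'. P / u (Suc j))"
        by (rule prod.cong) (auto simp: e_def k')
      then have "(\<Prod>j<k. (P / u (Suc j)) ^ e j) = P ^ k' / (\<Prod>j<k'. u (Suc j)) * (P / u k) ^ (n - k)"
        by (simp add: k' e_def prod_dividef)
      then have "(P / u 0) * (\<Prod>j<k. (P / u (Suc j)) ^ e j) = P ^ (Suc k') / Q * Q ^ (n - k)"
        using u(1) PQ by (simp add: Q')
      also have "\<dots> = Q ^ (n - 1) * u k ^ k"
      proof -
        have "Suc k' + (n - k) = Suc (n - 1)" using kn k' by simp
        then have "Q ^ Suc k' * Q ^ (n - k) = Q * Q ^ (n - 1)" by (metis power_add power_Suc)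
        then show ?thesis using PQ unfolding PQ(1) power_mult_distrib k'[symmetric]
          by (simp add: field_simps)
      qed
      also have "\<dots> = (Q ^ q * u k) ^ k" by (simp add: n power_mult_distrib power_mult[symmetric] mult.commute)
      also have "\<dots> = 1" using d unfolding Q_def by simp
      finally show ?thesis .
    qed
    finally show ?thesis by simp
  qed
  have nz: "s v \<noteq> 0" if v: "v \<in> pt q k y" for v
  proof -
    from v obtain c where c: "c \<noteq> 0" "v = (\<lambda>i. c * plu n k ?A i)" unfolding pt_def n[symmetric] by (rule lineE)
    have "s (plu n k ?A) \<noteq> 0" using S(2) plu_mat_of_pivot_set[OF y] by (simp add: s_def)
    then show ?thesis using c homfun_scale[OF hs, of c "plu n k ?A"] by simp
  qed
  show ?thesis
    unfolding X_ss_eq[OF q k n] semistable_def using pt_in_schubert[OF y] sec inv nz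
    by (intro CollectI conjI exI[of _ 1] exI[of _ s]) auto
qed

end

section \<open>The torus action on the semistable locus\<close>

definition ss_space :: "nat \<Rightarrow> nat \<Rightarrow> (nat set \<Rightarrow> complex) set fspace" where
  "ss_space q k = subspace (proj_space (plucker_index (k * q + 1) k)) (X_ss q k)"

text \<open>A diagonal matrix scales row \<open>i\<close> by \<open>u (i div q)\<close>; dividing
  column \<open>j\<close> by \<open>u (Suc j)\<close> restores the pivot entry 1, since the pivot
  row (j + 1) * q lies in block j + 1.\<close>

definition torus_act :: "nat \<Rightarrow> (nat \<Rightarrow> complex) \<Rightarrow> (nat \<Rightarrow> nat \<Rightarrow> complex) \<Rightarrow> nat \<Rightarrow> nat \<Rightarrow> complex" where
  "torus_act q u x = (\<lambda>j i. u (i div q) / u (Suc j) * x j i)"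

lemma torus_act_params: "x \<in> params q k \<Longrightarrow> (\<And>b. u b \<noteq> 0) \<Longrightarrow> torus_act q u x \<in> params q k"
  unfolding params_def torus_act_def by auto

lemma torus_act_compose: "(\<And>b. v b \<noteq> 0) \<Longrightarrow> torus_act q u (torus_act q v x) = torus_act q (\<lambda>b. u b * v b) x"
  unfolding torus_act_def by (auto simp: fun_eq_iff field_simps)

lemma space_with_functions_ss: "space_with_functions (ss_space q k)"
  unfolding ss_space_def by (rule space_with_functions_subspace[OF space_with_functions_proj])

section \<open>Coordinates on the semistable locus\<close>

context
  fixes q k n :: nat
  assumes q: "q \<ge> 1" and k: "k \<ge> 1" and n: "n = k * q + 1"
begin

lemmas pt_eq = pt_def[of q k, folded n]
lemmas ss_space_eq = ss_space_def[of q k, folded n]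

lemma X_ss_params: "X_ss q k = pt q k ` params q k"
proof (intro equalityI subsetI)
  fix x assume "x \<in> X_ss q k"
  then obtain y where "y \<in> params q k" "x = pt q k y" by (rule semistable_form[OF q k n])
  then show "x \<in> pt q k ` params q k" by blast
next
  fix x assume "x \<in> pt q k ` params q k"
  then show "x \<in> X_ss q k" using pt_semistable[OF q k n] by blast
qed

lemma pt_proj: "x \<in> params q k \<Longrightarrow> pt q k x \<in> proj_points (plucker_index n k)"
  unfolding pt_eq
  by (rule plu_nonzero_proj(1)[OF q k n, of _ "pivot_set q k"]) (simp add: plu_mat_of_pivot_set[OF q k n])

lemma points_ss: "points (ss_space q k) = pt q k ` params q k"
  unfolding ss_space_eq points_subspace[OF space_with_functions_proj] points_proj_space X_ss_params
  using pt_proj by blast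

text \<open>Up to the sign \<open>e\<close>, the entry is the Pluecker coordinate with one pivot row
  exchanged, divided by the coordinate of the pivot set. The latter vanishes nowhere on the
  semistable locus, so the function is regular everywhere.\<close>

lemma coordinate_exists:
  "\<exists>f. (\<forall>x\<in>params q k. f (pt q k x) = x j i) \<and> reg (ss_space q k) (points (ss_space q k)) f"
proof (cases "j < k \<and> i \<in> row_supp q j")
  case False
  then have "\<forall>x\<in>params q k. 0 = x j i" unfolding params_def by auto
  then show ?thesis
    by (intro exI[of _ "\<lambda>_. 0"]) (auto intro: reg_const[OF space_with_functions_ss])
next
  case True
  then have j: "j < k" and i: "i \<in> row_supp q j" by auto
  let ?pivots = "pivot_set q k" and ?\<rho> = "(pick (pivot_set q k))(j := i)"
  note WP = pivot_set_plucker[OF q k n]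
  have "i < n" using i pivot_less[OF q k n j] unfolding row_supp_def by (auto intro: less_trans)
  moreover have "pick ?pivots a < n" if "a < k" for a using pick_plucker(4)[OF WP that] .
  ultimately have sub: "?\<rho> ` {..<k} \<subseteq> {..<n}" by auto
  have inj: "inj_on ?\<rho> {..<k}"
  proof (rule inj_onI)
    fix a b assume ab: "a \<in> {..<k}" "b \<in> {..<k}" "?\<rho> a = ?\<rho> b"
    have "pick ?pivots a \<noteq> i" if "a < k" for a
      using that row_supp_pivot[OF q, of a j] i by (auto simp: pick_pivot_set[OF q k n] simp del: mult_Suc)
    then show "a = b" using ab inj_onD[OF pick_plucker(3)[OF WP], of a b]
      by (auto split: if_splits)
  qed
  let ?S = "?\<rho> ` {..<k}"
  have SP: "?S \<in> plucker_index n k" using sub card_image[OF inj] by (simp add: plucker_index_def)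
  obtain e where e: "\<And>A. minor k A ?\<rho> = e * minor k A (pick ?S)" using minor_image[OF inj] by metis
  have h: "homfun (plucker_index n k) 1 (\<lambda>v. e * v ?S)"
    using homfun.mult[OF homfun.const homfun.coord[OF SP]] by simp
  have hW: "homfun (plucker_index n k) 1 (\<lambda>v. v ?pivots)" by (rule homfun.coord[OF WP])
  let ?f = "\<lambda>p. e * (SOME v. v \<in> p) ?S / (SOME v. v \<in> p) ?pivots"
  have r: "reg (proj_space (plucker_index n k)) {p \<in> proj_points (plucker_index n k). \<forall>v\<in>p. v ?pivots \<noteq> 0} ?f"
    by (rule reg_proj_quotient[OF h hW proj_quotient[OF h hW]])
  have val: "?f (pt q k x) = x j i" and nz: "\<And>v. v \<in> pt q k x \<Longrightarrow> v ?pivots \<noteq> 0" if x: "x \<in> params q k" for x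
  proof -
    let ?A = "mat_of q x"
    have W1: "plu n k ?A ?pivots = 1" by (rule plu_mat_of_pivot_set[OF q k n x])
    have "unit_rows k ?A (pick ?pivots)"
      using mat_of_unit_rows[OF q k n x] by (simp add: unit_rows_def pick_pivot_set[OF q k n])
    then have "minor k ?A ?\<rho> = ?A i j" using j by (rule minor_replace_row)
    also have "?A i j = x j i"
      using i by (auto simp: mat_of_def row_supp_def)
    finally have "e * plu n k ?A ?S = x j i" using e[of ?A] SP by (simp add: plu_def)
    moreover have "plu n k ?A \<in> pt q k x" unfolding pt_eq by (rule line_self)
    ultimately show "?f (pt q k x) = x j i"
      using proj_quotient[OF h hW pt_proj[OF x], of "plu n k ?A"] W1 by simp
    show "v ?pivots \<noteq> 0" if "v \<in> pt q k x" for v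
      using that W1 unfolding pt_eq by (auto elim!: lineE)
  qed
  have "{p \<in> proj_points (plucker_index n k). \<forall>v\<in>p. v ?pivots \<noteq> 0} \<inter> X_ss q k = points (ss_space q k)"
    unfolding points_ss X_ss_params using nz pt_proj by blast
  then have "reg (ss_space q k) (points (ss_space q k)) ?f"
    using reg_subspaceI[OF r, of "X_ss q k"] by (simp only: ss_space_eq[symmetric])
  then show ?thesis using val by (intro exI[of _ ?f]) simp
qed

text \<open>Pluecker coordinates are polynomials in the echelon parameters. Together with
  \<open>reg_coord\<close> this identifies the semistable locus with a product of punctured affine
  spaces.\<close>

lemma morphism_pt:
  assumes Z: "space_with_functions Z"
    and par: "\<And>z. z \<in> points Z \<Longrightarrow> (\<lambda>j i. \<xi> j i z) \<in> params q k"
    and r: "\<And>j i. reg Z (points Z) (\<xi> j i)"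
  shows "morphism Z (ss_space q k) (\<lambda>z. pt q k (\<lambda>j i. \<xi> j i z))"
  unfolding ss_space_eq
proof (rule morphism_into_subspace[OF Z _ _ space_with_functions_proj])
  show "pt q k (\<lambda>j i. \<xi> j i z) \<in> X_ss q k" if "z \<in> points Z" for z
    unfolding X_ss_params using par[OF that] by blast
  have o: "openin (ztop Z) (points Z)" by simp
  define m where "m S z = plu n k (mat_of q (\<lambda>j i. \<xi> j i z)) S" for S z
  have rm: "reg Z (points Z) (m S)" if "S \<in> plucker_index n k" for S
  proof -
    have "reg Z (points Z) (\<lambda>z. minor k (mat_of q (\<lambda>j i. \<xi> j i z)) (pick S))"
    proof (rule reg_minor[OF Z o])
      fix a b
      show "reg Z (points Z) (\<lambda>z. mat_of q (\<lambda>j i. \<xi> j i z) (pick S a) b)"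
        using r reg_const[OF Z o] by (cases "pick S a = Suc b * q") (simp_all add: mat_of_def del: mult_Suc)
    qed
    moreover have "m S = (\<lambda>z. minor k (mat_of q (\<lambda>j i. \<xi> j i z)) (pick S))"
      using that by (simp add: fun_eq_iff m_def plu_def)
    ultimately show ?thesis by simp
  qed
  have mm: "(\<lambda>S. if S \<in> plucker_index n k then m S z else 0) \<in> pt q k (\<lambda>j i. \<xi> j i z)" for z
  proof -
    have "(\<lambda>S. if S \<in> plucker_index n k then m S z else 0) = plu n k (mat_of q (\<lambda>j i. \<xi> j i z))"
      by (auto simp: m_def plu_def fun_eq_iff)
    then show ?thesis unfolding pt_eq by (simp only: line_self)
  qed
  show "morphism Z (proj_space (plucker_index n k)) (\<lambda>z. pt q k (\<lambda>j i. \<xi> j i z))"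
  proof (rule morphism_projI[OF Z])
    show "pt q k (\<lambda>j i. \<xi> j i z) \<in> proj_points (plucker_index n k)" if "z \<in> points Z" for z
      by (rule pt_proj[OF par[OF that]])
    show "\<exists>V m. openin (ztop Z) V \<and> z \<in> V \<and> (\<forall>S\<in>plucker_index n k. reg Z V (m S)) \<and>
      (\<forall>y\<in>V. (\<lambda>S. if S \<in> plucker_index n k then m S y else 0) \<in> pt q k (\<lambda>j i. \<xi> j i y))" if "z \<in> points Z" for z
      using o that rm mm by (intro exI[of _ "points Z"] exI[of _ m]) blast
  qed
qed

text \<open>The scalar \<open>c\<close> and the rescaling of the columns multiply the Pluecker
  vector by a nonzero constant.\<close>

lemma psl_act_pt:
  assumes x: "x \<in> params q k" and C: "C \<in> T_J q k" and g: "diagm n (\<lambda>a. c * u (a div q)) \<in> C"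
    and c: "c \<noteq> 0" and u: "\<And>b. u b \<noteq> 0"
  shows "psl_act n k C (pt q k x) = pt q k (torus_act q u x)"
proof -
  have q0: "q > 0" using q by simp
  let ?A = "mat_of q x"
  have A: "mat_of q (torus_act q u x) = (\<lambda>i j. u (i div q) * ?A i j * (1 / u (Suc j)))"
  proof (intro ext)
    fix i j show "mat_of q (torus_act q u x) i j = u (i div q) * ?A i j * (1 / u (Suc j))"
      using q0 u[of "Suc j"] by (cases "i = Suc j * q") (simp_all add: mat_of_def torus_act_def del: mult_Suc)
  qed
  define d where "d = (\<Prod>b<k. 1 / u (Suc b))"
  have d0: "d \<noteq> 0" using u by (simp add: d_def)
  have "ext_pow n k (diagm n (\<lambda>a. c * u (a div q))) (plu n k ?A) S =
      c ^ k / d * plu n k (mat_of q (torus_act q u x)) S" for S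
  proof (cases "S \<in> plucker_index n k")
    case False then show ?thesis by (simp add: ext_pow_def plu_def)
  next
    case S: True
    have "(\<Prod>a<k. u (pick S a div q)) = (\<Prod>i\<in>S. u (i div q))"
      using prod.reindex[OF pick_plucker(3)[OF S], of "\<lambda>i. u (i div q)"] pick_plucker(1)[OF S] by simp
    moreover have "(\<Prod>i\<in>S. c * u (i div q)) = c ^ k * (\<Prod>i\<in>S. u (i div q))"
      using plucker_indexD[OF S] by (simp add: prod.distrib)
    moreover have "ext_pow n k (diagm n (\<lambda>a. c * u (a div q))) (plu n k ?A) S =
        (\<Prod>i\<in>S. c * u (i div q)) * plu n k ?A S" by (simp only: ext_pow_diagm[OF plu_vectors])
    moreover have "plu n k (mat_of q (torus_act q u x)) S = (\<Prod>a<k. u (pick S a div q)) * d * plu n k ?A S"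
      using S unfolding A plu_def minor_scale d_def[symmetric] by simp
    ultimately show ?thesis using d0 by simp
  qed
  then have "ext_pow n k (diagm n (\<lambda>a. c * u (a div q))) (plu n k ?A) =
      (\<lambda>S. c ^ k / d * plu n k (mat_of q (torus_act q u x)) S)" by (rule ext)
  moreover have "c ^ k / d \<noteq> 0" using c d0 by simp
  ultimately show ?thesis
    unfolding pt_eq psl_act_line[OF T_J_class(1)[OF q0 n C] g n_pos[OF q k n]]
    using line_scale[of "c ^ k / d"] by simp
qed

lemma T_J_acts:
  assumes C: "C \<in> T_J q k" and x: "x \<in> params q k"
  shows "\<exists>u. (\<forall>b. u b \<noteq> 0) \<and> psl_act n k C (pt q k x) = pt q k (torus_act q u x)"
proof -
  have q0: "q > 0" using q by simp
  obtain h where "C = {c \<cdot>\<^sub>m h | c. c ^ n = 1}"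
    using T_J_class(1)[OF q0 n C] unfolding PSL_carrier by blast
  then have "1 \<cdot>\<^sub>m h \<in> C" by (metis (mono_tags, lifting) mem_Collect_eq power_one)
  moreover from T_J_class(2)[OF q0 n C this] obtain u where u: "\<forall>b. u b \<noteq> 0"
    "1 \<cdot>\<^sub>m h = diagm n (\<lambda>a. 1 * u (a div q))"
    by auto
  ultimately have "diagm n (\<lambda>a. 1 * u (a div q)) \<in> C" by simp
  then show ?thesis using psl_act_pt[OF x C, of 1 u] u(1) by (intro exI[of _ u]) simp
qed

text \<open>A scalar brings the determinant to 1 without changing the action on lines. With
  \<open>T_J_acts\<close> this shows that the orbits of \<open>T_J\<close> are the orbits of all
  block scalings.\<close>

lemma torus_act_attained:
  assumes u: "\<And>b. u b \<noteq> 0" and x: "x \<in> params q k"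
  shows "\<exists>C\<in>T_J q k. psl_act n k C (pt q k x) = pt q k (torus_act q u x)"
proof -
  have q0: "q > 0" using q by simp
  obtain C c where "C \<in> T_J q k" "c \<noteq> 0" "diagm n (\<lambda>a. c * u (a div q)) \<in> C"
    by (rule T_J_contains_scaled[of q n k u]) (use q0 u n in auto)
  then show ?thesis using psl_act_pt[OF x, of C c u] u by (intro bexI[of _ C]) auto
qed

end

text \<open>The echelon parameters of a point, pieced together from regular functions that are known
  only to exist.\<close>

definition coord :: "nat \<Rightarrow> nat \<Rightarrow> (nat set \<Rightarrow> complex) set \<Rightarrow> nat \<Rightarrow> nat \<Rightarrow> complex" where
  "coord q k p j i = (SOME f. (\<forall>x\<in>params q k. f (pt q k x) = x j i) \<and>
     reg (ss_space q k) (points (ss_space q k)) f) p"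

lemma coord_pt:
  assumes "q \<ge> 1" "k \<ge> 1" "x \<in> params q k"
  shows "coord q k (pt q k x) = x"
  using someI_ex[OF coordinate_exists[OF assms(1,2) refl]] assms(3) by (auto simp: coord_def fun_eq_iff)

lemma reg_coord:
  assumes "q \<ge> 1" "k \<ge> 1"
  shows "reg (ss_space q k) (points (ss_space q k)) (\<lambda>p. coord q k p j i)"
  using someI_ex[OF coordinate_exists[OF assms refl]] by (simp add: coord_def)

section \<open>Good quotients by the torus\<close>

text \<open>For a choice of a coordinate \<open>c j\<close> in each row, \<open>weight_fun q c x b\<close> is a monomial in the chosen
  entries on which the torus acts with the weight of block \<open>0\<close> divided by that of block \<open>b\<close>.\<close>

fun weight_fun :: "nat \<Rightarrow> (nat \<Rightarrow> nat) \<Rightarrow> (nat \<Rightarrow> nat \<Rightarrow> complex) \<Rightarrow> nat \<Rightarrow> complex" where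
  "weight_fun q c x 0 = 1"
| "weight_fun q c x (Suc j) =
    (if c j div q \<le> j then x j (c j) * weight_fun q c x (c j div q) else 0)"

definition row_choice :: "nat \<Rightarrow> nat \<Rightarrow> (nat \<Rightarrow> nat) \<Rightarrow> bool" where
  "row_choice q k c \<longleftrightarrow> (\<forall>j<k. c j \<in> row_supp q j)"

definition chart :: "nat \<Rightarrow> nat \<Rightarrow> (nat \<Rightarrow> nat) \<Rightarrow> (nat \<Rightarrow> nat \<Rightarrow> complex) set" where
  "chart q k c = {x \<in> params q k. \<forall>j<k. x j (c j) \<noteq> 0}"

lemma row_choice_block: "q \<ge> 1 \<Longrightarrow> row_choice q k c \<Longrightarrow> j < k \<Longrightarrow> c j div q \<le> j"
  unfolding row_choice_def using row_supp_block by blast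

lemma weight_fun_cong: "(\<And>j i. j < b \<Longrightarrow> x j i = y j i) \<Longrightarrow> weight_fun q c x b = weight_fun q c y b"
proof (induction b rule: less_induct)
  case (less b)
  show ?case
  proof (cases b)
    case (Suc j)
    then have "weight_fun q c x (c j div q) = weight_fun q c y (c j div q)" if "c j div q \<le> j"
      using that less by auto
    then show ?thesis using Suc less.prems by simp
  qed simp
qed

lemma weight_fun_nonzero:
  "(\<And>j. j < b \<Longrightarrow> c j div q \<le> j \<and> x j (c j) \<noteq> 0) \<Longrightarrow> weight_fun q c x b \<noteq> 0"
proof (induction b rule: less_induct)
  case (less b)
  show ?case
  proof (cases b)
    case (Suc j)
    then have cj: "c j div q \<le> j" "x j (c j) \<noteq> 0" using less.prems[of j] by auto
    have "weight_fun q c x (c j div q) \<noteq> 0"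
    proof (rule less.IH)
      show "c j div q < b" using cj(1) Suc by simp
      fix j' assume "j' < c j div q"
      then have "j' < b" using cj(1) Suc by simp
      then show "c j' div q \<le> j' \<and> x j' (c j') \<noteq> 0" by (rule less.prems)
    qed
    with cj show ?thesis using Suc by simp
  qed simp
qed

lemma chart_weight_nonzero:
  assumes "q \<ge> 1" "row_choice q k c" "x \<in> chart q k c" "b \<le> k"
  shows "weight_fun q c x b \<noteq> 0"
  using assms row_choice_block[OF assms(1,2)] by (intro weight_fun_nonzero) (auto simp: chart_def)

text \<open>The weights telescope: the entry in row \<open>c j\<close> of column \<open>j\<close>
  contributes the weight of its block over that of block j + 1, and the recursive factor that of
  block 0 over that of the block of \<open>c j\<close>.\<close>

lemma weight_fun_torus_act:
  assumes "\<And>b. u b \<noteq> 0"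
  shows "weight_fun q c (torus_act q u x) b = u 0 / u b * weight_fun q c x b"
proof (induction b rule: less_induct)
  case (less b)
  show ?case
  proof (cases b)
    case 0 then show ?thesis using assms by simp
  next
    case (Suc j)
    then have "weight_fun q c (torus_act q u x) (c j div q) = u 0 / u (c j div q) * weight_fun q c x (c j div q)"
      if "c j div q \<le> j" using that less by auto
    then show ?thesis using Suc assms by (simp add: torus_act_def)
  qed
qed

lemma reg_weight_fun:
  assumes X: "space_with_functions X" "openin (ztop X) U" and r: "\<And>j i. reg X U (\<lambda>z. \<xi> z j i)"
  shows "reg X U (\<lambda>z. weight_fun q c (\<xi> z) b)"
proof (induction b rule: less_induct)
  case (less b)
  show ?case
  proof (cases b)
    case 0 then show ?thesis using reg_const[OF X] by simp
  next
    case (Suc j)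
    show ?thesis
    proof (cases "c j div q \<le> j")
      case True
      then have "reg X U (\<lambda>z. weight_fun q c (\<xi> z) (c j div q))" using less Suc by auto
      then show ?thesis using Suc True reg_mult[OF X(1) r] by simp
    next
      case False then show ?thesis using Suc reg_const[OF X] by simp
    qed
  qed
qed

declare weight_fun.simps(2) [simp del]

lemma chart_torus_act: "x \<in> chart q k c \<Longrightarrow> (\<And>b. u b \<noteq> 0) \<Longrightarrow> torus_act q u x \<in> chart q k c"
  unfolding chart_def using torus_act_params by (auto simp: torus_act_def)

text \<open>No column of a parameter is zero, so the charts cover everything.\<close>

lemma params_in_chart:
  assumes "x \<in> params q k"
  obtains c where "row_choice q k c" "x \<in> chart q k c"
proof -
  have "\<forall>j. \<exists>i. j < k \<longrightarrow> x j i \<noteq> 0" using assms unfolding params_def by blast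
  from choice[OF this] obtain c where c: "\<forall>j. j < k \<longrightarrow> x j (c j) \<noteq> 0" by (elim exE)
  then have "row_choice q k c" using assms unfolding row_choice_def params_def by blast
  moreover have "x \<in> chart q k c" using assms c by (simp add: chart_def)
  ultimately show ?thesis by (rule that)
qed

text \<open>Normalising the chosen entries to \<open>1\<close> by the torus.\<close>

lemma normalised_is_torus_act:
  assumes "\<And>b. b \<le> k \<Longrightarrow> weight_fun q c x b \<noteq> 0" "q \<ge> 1" "x \<in> params q k" "j < k"
  shows "torus_act q (\<lambda>b. if b \<le> k then weight_fun q c x b else 1) x j i =
    weight_fun q c x (i div q) * x j i / weight_fun q c x (Suc j)"
proof (cases "x j i = 0")
  case False
  then have "i \<in> row_supp q j" using assms(3) unfolding params_def by blast
  then have "i div q \<le> k" using row_supp_block[OF assms(2)] assms(4) by fastforce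
  then show ?thesis using assms(4) by (simp add: torus_act_def)
qed (simp add: torus_act_def)

text \<open>The orbit of \<open>x\<close> is cut out by closed conditions, the proportionality of weighted rows.\<close>

definition weighted_minor :: "nat \<Rightarrow> nat \<Rightarrow> (nat \<Rightarrow> nat) \<Rightarrow> (nat \<Rightarrow> nat \<Rightarrow> complex) \<Rightarrow> nat \<times> nat \<times> nat \<Rightarrow>
    (nat \<Rightarrow> nat \<Rightarrow> complex) \<Rightarrow> complex" where
  "weighted_minor q k c x = (\<lambda>(j, i, i') y.
     weight_fun q c x (i' div q) * x j i' * (weight_fun q c y (i div q) * y j i) -
     weight_fun q c x (i div q) * x j i * (weight_fun q c y (i' div q) * y j i'))"

text \<open>On an orbit the weighted entries of column \<open>j\<close> are all multiplied by the
  same factor \<open>u 0 / u (Suc j)\<close>, which is proportionality. Conversely, the minors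
  against the chosen entry determine column \<open>j\<close> of \<open>y\<close> from that of
  \<open>x\<close> by induction on \<open>j\<close>. The same induction shows that the weights of
  \<open>y\<close> are nonzero, since otherwise a whole column of \<open>y\<close> would
  vanish.\<close>

lemma orbit_equations:
  assumes q: "q \<ge> 1" and c: "row_choice q k c" and x: "x \<in> chart q k c" and y: "y \<in> params q k"
  shows "(\<exists>u. (\<forall>b. u b \<noteq> 0) \<and> y = torus_act q u x) \<longleftrightarrow> (\<forall>t. weighted_minor q k c x t y = 0)"
proof
  assume "\<exists>u. (\<forall>b. u b \<noteq> 0) \<and> y = torus_act q u x"
  then obtain u where u: "\<And>b. u b \<noteq> 0" "y = torus_act q u x" by blast
  have "weight_fun q c y (i div q) * y j i = u 0 / u (Suc j) * (weight_fun q c x (i div q) * x j i)" for j i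
    unfolding u(2) weight_fun_torus_act[OF u(1)] using u(1) by (simp add: torus_act_def)
  then show "\<forall>t. weighted_minor q k c x t y = 0" by (auto simp: weighted_minor_def)
next
  assume eq: "\<forall>t. weighted_minor q k c x t y = 0"
  note xn = chart_weight_nonzero[OF q c x]
  have step: "y j i = weight_fun q c y (Suc j) * weight_fun q c x (i div q) * x j i /
      (weight_fun q c x (Suc j) * weight_fun q c y (i div q)) \<and> weight_fun q c y (Suc j) \<noteq> 0"
    if j: "j < k" and prev: "\<And>b. b \<le> j \<Longrightarrow> weight_fun q c y b \<noteq> 0" for j i
  proof -
    have cj: "c j div q \<le> j" using row_choice_block[OF q c j] .
    \<comment> \<open>The weighted entry at the chosen position \<open>c j\<close> is
      \<open>weight_fun\<close> at \<open>Suc j\<close>.\<close>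
    have E: "weight_fun q c x (Suc j) * (weight_fun q c y (i div q) * y j i) =
        weight_fun q c x (i div q) * x j i * weight_fun q c y (Suc j)" for i
      using eq[THEN spec, of "(j, i, c j)"] cj by (simp add: weighted_minor_def weight_fun.simps(2) mult_ac)
    have sx: "weight_fun q c x (Suc j) \<noteq> 0" using xn j by simp
    have yi: "y j i = weight_fun q c y (Suc j) * weight_fun q c x (i div q) * x j i /
      (weight_fun q c x (Suc j) * weight_fun q c y (i div q))" for i
    proof (cases "i div q \<le> j")
      case True
      then have "weight_fun q c y (i div q) \<noteq> 0" by (rule prev)
      then show ?thesis using E[of i] sx by (simp add: field_simps)
    next
      case False
      then have "i \<notin> row_supp q j" using row_supp_block[OF q] by blast
      then have "x j i = 0" "y j i = 0" using x y unfolding chart_def params_def by blast+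
      then show ?thesis by simp
    qed
    have "weight_fun q c y (Suc j) \<noteq> 0"
    proof
      assume z: "weight_fun q c y (Suc j) = 0"
      have "y j i = 0" for i using yi[of i] unfolding z by simp
      then show False using y j unfolding params_def by blast
    qed
    with yi show ?thesis by blast
  qed
  have yn: "weight_fun q c y b \<noteq> 0" if "b \<le> k" for b
    using that
  proof (induction b rule: less_induct)
    case (less b)
    show ?case
    proof (cases b)
      case (Suc j)
      then have "j < k" using less.prems by simp
      then show ?thesis using step[of j 0] less Suc by simp
    qed simp
  qed
  \<comment> \<open>This is normalised by \<open>u 0\<close> = 1, as \<open>weight_fun\<close> is 1
    at block 0; the value 1 beyond \<open>k\<close> is a nonzero default.\<close>
  define u where "u b = (if b \<le> k then weight_fun q c x b / weight_fun q c y b else 1)" for b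
  have u: "u b \<noteq> 0" for b using xn yn by (simp add: u_def)
  have "y = torus_act q u x"
  proof (intro ext)
    fix j i
    show "y j i = torus_act q u x j i"
    proof (cases "j < k \<and> i \<in> row_supp q j")
      case False
      then have "x j i = 0" "y j i = 0" using x y unfolding chart_def params_def by blast+
      then show ?thesis by (simp add: torus_act_def)
    next
      case True
      then have "i div q \<le> k" using row_supp_block[OF q, of i j] by simp
      moreover have "y j i = weight_fun q c y (Suc j) * weight_fun q c x (i div q) * x j i /
        (weight_fun q c x (Suc j) * weight_fun q c y (i div q))"
        using step[of j i] yn True by simp
      ultimately show ?thesis using True by (simp add: torus_act_def u_def mult_ac)
    qed
  qed
  then show "\<exists>u. (\<forall>b. u b \<noteq> 0) \<and> y = torus_act q u x" using u by blast
qed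

text \<open>Nothing but the axioms of a good quotient is known about \<open>Y\<close>; its points,
  open sets and functions are extracted from them.\<close>

locale torus_quotient =
  fixes q k :: nat and Y :: "'a fspace" and \<pi> :: "(nat set \<Rightarrow> complex) set \<Rightarrow> 'a"
  assumes q: "q \<ge> 1" and k: "k \<ge> 1"
    and gq: "good_quotient (T_J q k) (psl_act (k * q + 1) k) (ss_space q k) Y \<pi>"
begin

abbreviation "X \<equiv> ss_space q k"

lemmas swX = space_with_functions_ss[of q k]
lemmas pts = points_ss[OF q k refl]
lemmas cpt = coord_pt[OF q k]

lemma swY: "space_with_functions Y"
  using gq unfolding good_quotient_def variety_def by blast

lemma morphism_\<pi>: "morphism X Y \<pi>"
  using gq unfolding good_quotient_def by (elim conjE)

lemma surj_\<pi>: "\<pi> ` points X = points Y"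
  using gq unfolding good_quotient_def by (elim conjE)

lemma invariant_\<pi>: "\<forall>h\<in>T_J q k. \<forall>x\<in>points X. \<pi> (psl_act (k * q + 1) k h x) = \<pi> x"
  using gq unfolding good_quotient_def by (elim conjE)

lemma functions_\<pi>: "\<forall>V F. openin (ztop Y) V \<longrightarrow>
        (reg X {x \<in> points X. \<pi> x \<in> V} F \<and>
           (\<forall>h\<in>T_J q k. \<forall>x\<in>points X. \<pi> x \<in> V \<longrightarrow> F (psl_act (k * q + 1) k h x) = F x)) =
        (\<exists>f. reg Y V f \<and> (\<forall>x\<in>points X. \<pi> x \<in> V \<longrightarrow> F x = f (\<pi> x)))"
  using gq unfolding good_quotient_def by (elim conjE)

lemma closed_\<pi>: "\<forall>S. closedin (ztop X) S \<and> invariant_set (T_J q k) (psl_act (k * q + 1) k) S \<longrightarrow>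
    closedin (ztop Y) (\<pi> ` S)"
  using gq unfolding good_quotient_def by (elim conjE)

lemma separated_\<pi>: "\<forall>S S'. closedin (ztop X) S \<and> invariant_set (T_J q k) (psl_act (k * q + 1) k) S \<and>
        closedin (ztop X) S' \<and> invariant_set (T_J q k) (psl_act (k * q + 1) k) S' \<and> S \<inter> S' = {} \<longrightarrow>
        \<pi> ` S \<inter> \<pi> ` S' = {}"
  using gq unfolding good_quotient_def by (elim conjE)

definition saturated :: "(nat set \<Rightarrow> complex) set set \<Rightarrow> bool" where
  "saturated S \<longleftrightarrow> (\<forall>x\<in>params q k. \<forall>u. (\<forall>b. u b \<noteq> 0) \<longrightarrow> pt q k x \<in> S \<longrightarrow> pt q k (torus_act q u x) \<in> S)"

lemma saturated_invariant:
  assumes "S \<subseteq> points X" "saturated S"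
  shows "invariant_set (T_J q k) (psl_act (k * q + 1) k) S"
  unfolding invariant_set_def
proof (intro ballI)
  fix h p assume h: "h \<in> T_J q k" and p: "p \<in> S"
  then obtain x where x: "x \<in> params q k" "p = pt q k x" using assms(1) pts by blast
  from T_J_acts[OF q k refl h x(1)] obtain u where "\<forall>b. u b \<noteq> 0"
    "psl_act (k * q + 1) k h (pt q k x) = pt q k (torus_act q u x)" by blast
  then show "psl_act (k * q + 1) k h p \<in> S" using assms(2) x p unfolding saturated_def by simp
qed

lemma \<pi>_torus_act:
  assumes "x \<in> params q k" "\<And>b. u b \<noteq> 0"
  shows "\<pi> (pt q k (torus_act q u x)) = \<pi> (pt q k x)"
proof -
  obtain C where C: "C \<in> T_J q k" "psl_act (k * q + 1) k C (pt q k x) = pt q k (torus_act q u x)"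
    using torus_act_attained[OF q k refl, of u x] assms by blast
  have "pt q k x \<in> points X" using assms(1) pts by blast
  then show ?thesis using invariant_\<pi>[rule_format, OF C(1)] C(2) by metis
qed

definition orbit :: "(nat \<Rightarrow> nat \<Rightarrow> complex) \<Rightarrow> (nat set \<Rightarrow> complex) set set" where
  "orbit x = {pt q k (torus_act q u x) | u. \<forall>b. u b \<noteq> 0}"

text \<open>By \<open>orbit_equations\<close> the orbit is the common zero set of functions that are
  regular on the whole semistable locus, not just on a chart.\<close>

lemma closed_orbit:
  assumes x: "x \<in> params q k"
  shows "closedin (ztop X) (orbit x)" "orbit x \<subseteq> points X" "saturated (orbit x)"
proof -
  show sub: "orbit x \<subseteq> points X" unfolding orbit_def pts using torus_act_params[OF x] by blast
  show "saturated (orbit x)"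
    unfolding saturated_def
  proof (intro ballI allI impI)
    fix y and u :: "nat \<Rightarrow> complex" assume y: "y \<in> params q k" and u: "\<forall>b. u b \<noteq> 0" and "pt q k y \<in> orbit x"
    then obtain v where v: "\<forall>b. v b \<noteq> 0" "pt q k y = pt q k (torus_act q v x)" unfolding orbit_def by blast
    have "y = coord q k (pt q k y)" using cpt[OF y] by (rule sym)
    also have "\<dots> = torus_act q v x" unfolding v(2) using torus_act_params[OF x] v(1) by (intro cpt) blast
    finally have "torus_act q u y = torus_act q (\<lambda>b. u b * v b) x"
      using torus_act_compose[of v q u x] v(1) by (simp only:) blast
    then show "pt q k (torus_act q u y) \<in> orbit x"
      unfolding orbit_def using u v(1) by (intro CollectI exI[of _ "\<lambda>b. u b * v b"]) simp
  qed
  obtain c where c: "row_choice q k c" "x \<in> chart q k c" by (rule params_in_chart[OF x])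
  let ?f = "\<lambda>t p. weighted_minor q k c x t (coord q k p)"
  have "orbit x = (\<Inter>t. {p \<in> points X. ?f t p = 0})"
  proof (intro equalityI subsetI)
    fix p assume p: "p \<in> orbit x"
    then obtain y where y: "y \<in> params q k" "p = pt q k y" using sub pts by blast
    from p obtain u where u: "\<forall>b. u b \<noteq> 0" "p = pt q k (torus_act q u x)" unfolding orbit_def by blast
    have "y = coord q k p" unfolding y(2) using cpt[OF y(1)] by (rule sym)
    also have "\<dots> = torus_act q u x" unfolding u(2) using torus_act_params[OF x] u(1) by (intro cpt) blast
    finally have "\<forall>t. weighted_minor q k c x t y = 0" using orbit_equations[OF q c y(1)] u(1) by blast
    then have "?f t p = 0" for t unfolding y(2) cpt[OF y(1)] by blast
    then show "p \<in> (\<Inter>t. {p \<in> points X. ?f t p = 0})" using p sub by blast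
  next
    fix p assume p: "p \<in> (\<Inter>t. {p \<in> points X. ?f t p = 0})"
    then have pX: "p \<in> points X" and p0: "?f t p = 0" for t by blast+
    from pX obtain y where y: "y \<in> params q k" "p = pt q k y" unfolding pts by (elim imageE)
    have "weighted_minor q k c x t y = 0" for t using p0[of t] unfolding y(2) cpt[OF y(1)] .
    then obtain u where u: "\<forall>b. u b \<noteq> 0" "y = torus_act q u x" using orbit_equations[OF q c y(1)] by blast
    then show "p \<in> orbit x" unfolding orbit_def y(2) u(2) by blast
  qed
  moreover have "closedin (ztop X) (\<Inter>t. {p \<in> points X. ?f t p = 0})"
  proof (rule closedin_INT)
    fix t :: "nat \<times> nat \<times> nat"
    obtain j i i' where t: "t = (j, i, i')" by (cases t) auto
    have o: "openin (ztop X) (points X)" by simp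
    note r = reg_coord[OF q k]
    have "reg X (points X) (?f t)"
      unfolding t weighted_minor_def prod.case
      by (intro reg_diff[OF swX] reg_mult[OF swX] reg_const[OF swX o] reg_weight_fun[OF swX o] r)
    then show "closedin (ztop X) {p \<in> points X. ?f t p = 0}" by (rule closedin_zero[OF swX])
  qed simp
  ultimately show "closedin (ztop X) (orbit x)" by simp
qed

text \<open>Disjoint closed invariant sets have disjoint images, so orbits with a common image meet,
  and then they coincide.\<close>

lemma \<pi>_eqD:
  assumes x: "x \<in> params q k" and y: "y \<in> params q k" and eq: "\<pi> (pt q k x) = \<pi> (pt q k y)"
  obtains u where "\<forall>b. u b \<noteq> 0" "y = torus_act q u x"
proof -
  have self: "pt q k z \<in> orbit z" for z
    unfolding orbit_def by (intro CollectI exI[of _ "\<lambda>_. 1"]) (simp add: torus_act_def)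
  note cx = closed_orbit[OF x] and cy = closed_orbit[OF y]
  have i: "\<pi> (pt q k x) \<in> \<pi> ` orbit x" "\<pi> (pt q k x) \<in> \<pi> ` orbit y"
    using imageI[OF self[of x], of \<pi>] imageI[OF self[of y], of \<pi>] eq by simp_all
  have "orbit x \<inter> orbit y \<noteq> {}"
  proof
    assume "orbit x \<inter> orbit y = {}"
    then have "\<pi> ` orbit x \<inter> \<pi> ` orbit y = {}"
      using separated_\<pi>[rule_format, of "orbit x" "orbit y"] cx(1) cy(1)
        saturated_invariant[OF cx(2,3)] saturated_invariant[OF cy(2,3)] by simp
    with i show False by blast
  qed
  then obtain u v where u: "\<forall>b. u b \<noteq> 0" and v: "\<forall>b. v b \<noteq> 0"
    and eqn: "pt q k (torus_act q u x) = pt q k (torus_act q v y)" unfolding orbit_def by blast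
  have tx: "torus_act q u x \<in> params q k" and ty: "torus_act q v y \<in> params q k"
    using torus_act_params[OF x, of u] torus_act_params[OF y, of v] u v by blast+
  have e: "torus_act q u x = torus_act q v y"
    using arg_cong[OF eqn, of "coord q k"] unfolding cpt[OF tx] cpt[OF ty] .
  have "y = torus_act q (\<lambda>b. inverse (v b)) (torus_act q v y)"
  proof (intro ext)
    fix j i
    have "v (i div q) \<noteq> 0" "v (Suc j) \<noteq> 0" using v by blast+
    then show "y j i = torus_act q (\<lambda>b. inverse (v b)) (torus_act q v y) j i"
      by (simp add: torus_act_def)
  qed
  also have "\<dots> = torus_act q (\<lambda>b. inverse (v b) * u b) x"
    unfolding e[symmetric] using u by (intro torus_act_compose) simp
  finally show ?thesis using u v by (intro that) auto
qed

lemma saturated_preimage: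
  assumes "S \<subseteq> points X" "saturated S" "p \<in> points X" "\<pi> p \<in> \<pi> ` S"
  shows "p \<in> S"
proof -
  obtain p' where p': "p' \<in> S" "\<pi> p' = \<pi> p" using assms(4) by (metis imageE)
  have "p' \<in> points X" using p'(1) assms(1) by blast
  then obtain x where x: "x \<in> params q k" "p' = pt q k x" unfolding pts by blast
  obtain y where y: "y \<in> params q k" "p = pt q k y" using assms(3) unfolding pts by blast
  have "\<pi> (pt q k x) = \<pi> (pt q k y)" using p'(2) by (simp only: x(2) y(2))
  then obtain u where u: "\<forall>b. u b \<noteq> 0" "y = torus_act q u x" by (rule \<pi>_eqD[OF x(1) y(1)])
  have "pt q k x \<in> S" using p'(1) x(2) by simp
  then show ?thesis unfolding y(2) u(2)
    using assms(2)[unfolded saturated_def, THEN bspec, OF x(1), THEN spec, of u] u(1) by (elim impE)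
qed

text \<open>The complement of a saturated open set is closed and invariant, so its image is closed;
  by saturation that image is the complement of the image of \<open>S\<close>.\<close>

lemma open_image:
  assumes S: "openin (ztop X) S" and sat: "saturated S"
  shows "openin (ztop Y) (\<pi> ` S)" "{p \<in> points X. \<pi> p \<in> \<pi> ` S} = S"
proof -
  have sub: "S \<subseteq> points X" by (rule openin_subset[OF S])
  show eq: "{p \<in> points X. \<pi> p \<in> \<pi> ` S} = S"
  proof (intro equalityI subsetI)
    fix p assume "p \<in> {p \<in> points X. \<pi> p \<in> \<pi> ` S}"
    then show "p \<in> S" using saturated_preimage[OF sub sat] by simp
  qed (use sub in auto)
  have "saturated (points X - S)"
    unfolding saturated_def
  proof (intro ballI allI impI)
    fix x and u :: "nat \<Rightarrow> complex" assume x: "x \<in> params q k" and u: "\<forall>b. u b \<noteq> 0" and p: "pt q k x \<in> points X - S"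
    have t: "torus_act q u x \<in> params q k" using torus_act_params[OF x] u by blast
    have "pt q k (torus_act q u x) \<notin> S"
    proof
      assume "pt q k (torus_act q u x) \<in> S"
      then have "\<pi> (pt q k x) \<in> \<pi> ` S" using \<pi>_torus_act[OF x, of u] u by (metis imageI)
      then show False using p eq by blast
    qed
    then show "pt q k (torus_act q u x) \<in> points X - S" using t pts by blast
  qed
  then have "invariant_set (T_J q k) (psl_act (k * q + 1) k) (points X - S)"
    by (rule saturated_invariant[rotated]) blast
  then have "closedin (ztop Y) (\<pi> ` (points X - S))"
    using closed_\<pi>[rule_format, of "points X - S"] openin_closedin_eq[of "ztop X" S] S by simp
  moreover have "points Y - \<pi> ` (points X - S) = \<pi> ` S"
  proof (intro equalityI subsetI)
    fix y assume "y \<in> points Y - \<pi> ` (points X - S)"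
    then show "y \<in> \<pi> ` S" unfolding surj_\<pi>[symmetric] by blast
  next
    fix y assume "y \<in> \<pi> ` S"
    then obtain p where p: "p \<in> S" "y = \<pi> p" by (rule imageE)
    then have "y \<in> points Y" unfolding surj_\<pi>[symmetric] using sub by blast
    moreover have "y \<notin> \<pi> ` (points X - S)"
    proof
      assume "y \<in> \<pi> ` (points X - S)"
      then obtain p' where p': "p' \<in> points X - S" "y = \<pi> p'" by (rule imageE)
      have "\<pi> p' \<in> \<pi> ` S" using imageI[OF p(1), of \<pi>] by (simp only: p(2)[symmetric] p'(2)[symmetric])
      then have "p' \<in> {p \<in> points X. \<pi> p \<in> \<pi> ` S}" using p'(1) by simp
      then have "p' \<in> S" unfolding eq .
      then show False using p'(1) by simp
    qed
    ultimately show "y \<in> points Y - \<pi> ` (points X - S)" by blast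
  qed
  ultimately show "openin (ztop Y) (\<pi> ` S)"
    using openin_diff[OF openin_topspace, of "ztop Y" "\<pi> ` (points X - S)"] by (simp only:)
qed

lemma descend_function:
  assumes V: "openin (ztop Y) V" and F: "reg X {p \<in> points X. \<pi> p \<in> V} F"
    and inv: "\<And>x u. x \<in> params q k \<Longrightarrow> (\<And>b. u b \<noteq> 0) \<Longrightarrow> \<pi> (pt q k x) \<in> V \<Longrightarrow>
      F (pt q k (torus_act q u x)) = F (pt q k x)"
  shows "\<exists>f. reg Y V f \<and> (\<forall>p\<in>points X. \<pi> p \<in> V \<longrightarrow> F p = f (\<pi> p))"
proof -
  have "F (psl_act (k * q + 1) k h p) = F p" if h: "h \<in> T_J q k" and p: "p \<in> points X" "\<pi> p \<in> V" for h p
  proof -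
    obtain x where x: "x \<in> params q k" "p = pt q k x" using p pts by blast
    from T_J_acts[OF q k refl h x(1)] obtain u where "\<forall>b. u b \<noteq> 0"
      "psl_act (k * q + 1) k h (pt q k x) = pt q k (torus_act q u x)" by blast
    then show ?thesis using inv[OF x(1), of u] p(2) unfolding x(2) by simp
  qed
  then show ?thesis
    by (intro functions_\<pi>[rule_format, OF V, THEN iffD1] conjI ballI impI F)
qed

text \<open>Open sets and functions on \<open>Y\<close> are tested on the semistable locus:
  preimages under \<open>\<Phi>\<close> are saturated, hence have open images, and functions pulled
  back along \<open>\<Phi>\<close> are invariant, hence descend.\<close>

lemma descend_morphism:
  assumes V: "openin (ztop Y) V" and Z: "space_with_functions Z"
    and \<Phi>: "morphism (subspace X {p \<in> points X. \<pi> p \<in> V}) Z \<Phi>"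
    and eq: "\<And>p. p \<in> points X \<Longrightarrow> \<pi> p \<in> V \<Longrightarrow> \<phi> (\<pi> p) = \<Phi> p"
  shows "morphism (subspace Y V) Z \<phi>"
proof -
  let ?V = "{p \<in> points X. \<pi> p \<in> V}"
  have oV: "openin (ztop X) ?V" by (rule morphism_openin[OF morphism_\<pi> V])
  have pV: "points (subspace X ?V) = ?V" unfolding points_subspace[OF swX] by blast
  have pY: "points (subspace Y V) = V" unfolding points_subspace[OF swY] using openin_subset[OF V] by blast
  have lift: "\<exists>p\<in>points X. \<pi> p = y" if "y \<in> V" for y
  proof -
    have "y \<in> \<pi> ` points X" using that openin_subset[OF V] unfolding surj_\<pi> by (rule subsetD[rotated])
    then show ?thesis by blast
  qed
  have key: "openin (ztop X) {p \<in> ?V. \<Phi> p \<in> G} \<and> openin (ztop Y) {y \<in> V. \<phi> y \<in> G} \<and>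
      {p \<in> points X. \<pi> p \<in> {y \<in> V. \<phi> y \<in> G}} = {p \<in> ?V. \<Phi> p \<in> G}" if G: "openin (ztop Z) G" for G
  proof -
    let ?P = "{p \<in> ?V. \<Phi> p \<in> G}"
    have "openin (ztop (subspace X ?V)) ?P" using morphism_openin[OF \<Phi> G] unfolding pV .
    then obtain U where "openin (ztop X) U" "?P = U \<inter> ?V" unfolding openin_subspace[OF swX] by blast
    then have P: "openin (ztop X) ?P" using oV by auto
    have "saturated ?P"
      unfolding saturated_def
    proof (intro ballI allI impI)
      fix x and u :: "nat \<Rightarrow> complex" assume x: "x \<in> params q k" and u: "\<forall>b. u b \<noteq> 0" and p: "pt q k x \<in> ?P"
      have e: "\<pi> (pt q k (torus_act q u x)) = \<pi> (pt q k x)" using \<pi>_torus_act[OF x] u by blast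
      have pX: "pt q k (torus_act q u x) \<in> points X" using pts torus_act_params[OF x, of u] u by blast
      then show "pt q k (torus_act q u x) \<in> ?P" using p e eq[OF pX] eq[of "pt q k x"] by auto
    qed
    note oi = open_image[OF P this]
    have im: "\<pi> ` ?P = {y \<in> V. \<phi> y \<in> G}"
    proof (intro equalityI subsetI)
      fix y assume "y \<in> \<pi> ` ?P" then show "y \<in> {y \<in> V. \<phi> y \<in> G}" using eq by auto
    next
      fix y assume y: "y \<in> {y \<in> V. \<phi> y \<in> G}"
      then obtain p where "p \<in> points X" "\<pi> p = y" using lift by blast
      then show "y \<in> \<pi> ` ?P" using y eq[of p] by (intro image_eqI[of _ _ p]) auto
    qed
    show ?thesis using P oi unfolding im by blast
  qed
  show ?thesis
  proof (rule morphismI, unfold pY)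
    fix y assume "y \<in> V"
    then obtain p where "p \<in> points X" "\<pi> p = y" using lift by blast
    then show "\<phi> y \<in> points Z" using morphism_points[OF \<Phi>, of p] \<open>y \<in> V\<close> eq[of p] unfolding pV by simp
  next
    fix G assume "openin (ztop Z) G"
    from key[OF this] have "openin (ztop Y) {y \<in> V. \<phi> y \<in> G}" by blast
    moreover have "{y \<in> V. \<phi> y \<in> G} = {y \<in> V. \<phi> y \<in> G} \<inter> V" by blast
    ultimately show "openin (ztop (subspace Y V)) {y \<in> V. \<phi> y \<in> G}"
      unfolding openin_subspace[OF swY] by blast
  next
    fix G g
    assume g: "reg Z G g"
    show "reg (subspace Y V) {y \<in> V. \<phi> y \<in> G} (\<lambda>y. g (\<phi> y))"
    proof -
      note K = key[OF reg_openin[OF Z g]]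
      have "reg (subspace X ?V) {p \<in> ?V. \<Phi> p \<in> G} (\<lambda>p. g (\<Phi> p))" using morphism_reg[OF \<Phi> g] unfolding pV .
      then have "reg X {p \<in> ?V. \<Phi> p \<in> G} (\<lambda>p. g (\<Phi> p))" unfolding reg_subspace_open[OF swX oV] by blast
      then have r: "reg X {p \<in> points X. \<pi> p \<in> {y \<in> V. \<phi> y \<in> G}} (\<lambda>p. g (\<Phi> p))" using K by simp
      have o: "openin (ztop Y) {y \<in> V. \<phi> y \<in> G}" using K by blast
      have "\<exists>f. reg Y {y \<in> V. \<phi> y \<in> G} f \<and>
        (\<forall>p\<in>points X. \<pi> p \<in> {y \<in> V. \<phi> y \<in> G} \<longrightarrow> g (\<Phi> p) = f (\<pi> p))"
      proof (rule descend_function[OF o r])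
        fix x and u :: "nat \<Rightarrow> complex" assume x: "x \<in> params q k" and u: "\<And>b. u b \<noteq> 0" and p: "\<pi> (pt q k x) \<in> {y \<in> V. \<phi> y \<in> G}"
        have e: "\<pi> (pt q k (torus_act q u x)) = \<pi> (pt q k x)" by (rule \<pi>_torus_act[OF x u])
        have "torus_act q u x \<in> params q k" by (rule torus_act_params[OF x u])
        then have "pt q k (torus_act q u x) \<in> points X" unfolding pts by (rule imageI)
        moreover have "pt q k x \<in> points X" unfolding pts by (rule imageI[OF x])
        ultimately have "\<Phi> (pt q k (torus_act q u x)) = \<Phi> (pt q k x)"
          using p e eq[of "pt q k (torus_act q u x)"] eq[of "pt q k x"] by simp
        then show "g (\<Phi> (pt q k (torus_act q u x))) = g (\<Phi> (pt q k x))" by simp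
      qed
      then obtain f where f: "reg Y {y \<in> V. \<phi> y \<in> G} f"
        "\<forall>p\<in>points X. \<pi> p \<in> {y \<in> V. \<phi> y \<in> G} \<longrightarrow> g (\<Phi> p) = f (\<pi> p)" by (elim exE conjE)
      have "reg Y {y \<in> V. \<phi> y \<in> G} (\<lambda>y. g (\<phi> y))"
      proof (rule reg_cong[OF swY f(1)])
        fix y assume y: "y \<in> {y \<in> V. \<phi> y \<in> G}"
        then obtain p where "p \<in> points X" "\<pi> p = y" using lift by blast
        then show "g (\<phi> y) = f y" using f(2)[THEN bspec, of p] eq[of p] y by simp
      qed
      then show ?thesis unfolding reg_subspace_open[OF swY V] by blast
    qed
  qed
qed

end

section \<open>The projective bundle\<close>

text \<open>Of the (k + 1) * q rows above the pivot of column \<open>k\<close>, the \<open>k\<close>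
  pivot rows of the earlier columns are excluded. The count is one more than the fibre
  dimension.\<close>

lemma card_row_supp:
  assumes "q \<ge> 1"
  shows "finite (row_supp q k)" "card (row_supp q k) = Suc (Suc k * (q - 1))"
proof -
  let ?P = "(\<lambda>a. Suc a * q) ` {..<k}"
  have eq: "row_supp q k = {..<Suc k * q} - ?P"
  proof (intro equalityI subsetI)
    fix i assume "i \<in> row_supp q k"
    then show "i \<in> {..<Suc k * q} - ?P" using row_supp_pivot[OF assms, of _ k] by (auto simp: row_supp_def simp del: mult_Suc)
  next
    fix i assume i: "i \<in> {..<Suc k * q} - ?P"
    have "i = 0" if "q dvd i"
    proof -
      from that obtain c where c: "i = q * c" by (rule dvdE)
      show ?thesis
      proof (cases c)
        case 0 then show ?thesis using c by simp
      next
        case (Suc a)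
        have ia: "i = Suc a * q" unfolding c Suc by (rule mult.commute)
        then have "a < k" using i by (simp del: mult_Suc)
        then have "i \<in> ?P" unfolding ia by (intro image_eqI[of _ _ a]) auto
        then show ?thesis using i by blast
      qed
    qed
    then show "i \<in> row_supp q k" using i by (auto simp: row_supp_def simp del: mult_Suc)
  qed
  show "finite (row_supp q k)" unfolding eq by simp
  have "inj_on (\<lambda>a. Suc a * q) {..<k}" using assms by (auto simp: inj_on_def simp del: mult_Suc)
  then have c: "card ?P = k" by (simp add: card_image)
  have "Suc a * q < Suc k * q" if "a < k" for a
    using that assms mult_less_mono1[of "Suc a" "Suc k" q] by simp
  then have "?P \<subseteq> {..<Suc k * q}" by auto
  then have "card (row_supp q k) = Suc k * q - k" unfolding eq by (simp add: card_Diff_subset c del: mult_Suc)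
  also have "\<dots> = Suc (Suc k * (q - 1))" using assms by (cases q) auto
  finally show "card (row_supp q k) = Suc (Suc k * (q - 1))" .
qed

text \<open>\<open>B\<close> is the base with \<open>k\<close> columns, \<open>T\<close> the total
  space with one column more.\<close>

locale torus_tower = B: torus_quotient q k Y' \<pi>' + T: torus_quotient q "Suc k" Y \<pi>
  for q k :: nat and Y' :: "'b fspace" and \<pi>' and Y :: "'a fspace" and \<pi>
begin

section \<open>The map to the smaller quotient\<close>

definition trunc :: "(nat \<Rightarrow> nat \<Rightarrow> complex) \<Rightarrow> nat \<Rightarrow> nat \<Rightarrow> complex" where
  "trunc x = (\<lambda>j i. if j < k then x j i else 0)"

definition forget :: "(nat set \<Rightarrow> complex) set \<Rightarrow> (nat set \<Rightarrow> complex) set" where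
  "forget p = pt q k (trunc (coord q (Suc k) p))"

definition \<phi> :: "'a \<Rightarrow> 'b" where
  "\<phi> y = \<pi>' (forget (SOME p. p \<in> points T.X \<and> \<pi> p = y))"

lemma trunc_params: "x \<in> params q (Suc k) \<Longrightarrow> trunc x \<in> params q k"
  unfolding params_def trunc_def by auto

lemma trunc_torus_act: "trunc (torus_act q u x) = torus_act q u (trunc x)"
  by (auto simp: trunc_def torus_act_def fun_eq_iff)

lemma forget_pt: "x \<in> params q (Suc k) \<Longrightarrow> forget (pt q (Suc k) x) = pt q k (trunc x)"
  by (simp add: forget_def T.cpt)

lemma points_XE:
  assumes "p \<in> points T.X" obtains x where "x \<in> params q (Suc k)" "p = pt q (Suc k) x"
  using assms unfolding T.pts by blast

lemma pt_points: "x \<in> params q (Suc k) \<Longrightarrow> pt q (Suc k) x \<in> points T.X"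
  unfolding T.pts by (rule imageI)

lemma open_X: "openin (ztop T.X) (points T.X)"
  by simp

lemma morphism_forget: "morphism T.X B.X forget"
proof -
  have "morphism T.X B.X (\<lambda>p. pt q k (\<lambda>j i. if j < k then coord q (Suc k) p j i else 0))"
  proof (rule morphism_pt[OF B.q B.k refl T.swX])
    fix p assume "p \<in> points T.X"
    then obtain x where x: "x \<in> params q (Suc k)" "p = pt q (Suc k) x" by (rule points_XE)
    show "(\<lambda>j i. if j < k then coord q (Suc k) p j i else 0) \<in> params q k"
      unfolding x(2) T.cpt[OF x(1)] by (rule trunc_params[OF x(1), unfolded trunc_def])
  next
    fix j i show "reg T.X (points T.X) (\<lambda>p. if j < k then coord q (Suc k) p j i else 0)"
      using reg_coord[OF T.q T.k] reg_const[OF T.swX open_X] by (cases "j < k") simp_all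
  qed
  then show ?thesis unfolding forget_def[abs_def] trunc_def .
qed

text \<open>Two preimages of a point differ by a torus element, and truncation commutes with the
  torus, so the lift chosen in \<open>\<phi>\<close> does not matter.\<close>

lemma \<phi>_\<pi>:
  assumes p: "p \<in> points T.X"
  shows "\<phi> (\<pi> p) = \<pi>' (forget p)"
proof -
  define p' where "p' = (SOME p'. p' \<in> points T.X \<and> \<pi> p' = \<pi> p)"
  have p': "p' \<in> points T.X \<and> \<pi> p' = \<pi> p" unfolding p'_def by (rule someI[of _ p]) (use p in simp)
  obtain x where x: "x \<in> params q (Suc k)" "p = pt q (Suc k) x" using p by (rule points_XE)
  obtain y where y: "y \<in> params q (Suc k)" "p' = pt q (Suc k) y" using conjunct1[OF p'] by (rule points_XE)
  have "\<pi> (pt q (Suc k) x) = \<pi> (pt q (Suc k) y)" using p' by (simp only: x(2) y(2))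
  then obtain u where u: "\<forall>b. u b \<noteq> 0" "y = torus_act q u x" by (rule T.\<pi>_eqD[OF x(1) y(1)])
  have "\<pi>' (forget p') = \<pi>' (pt q k (torus_act q u (trunc x)))"
    unfolding y(2) forget_pt[OF y(1)] unfolding u(2) trunc_torus_act ..
  also have "\<dots> = \<pi>' (pt q k (trunc x))"
    using u(1) by (intro B.\<pi>_torus_act trunc_params[OF x(1)]) blast
  also have "\<dots> = \<pi>' (forget p)" unfolding x(2) forget_pt[OF x(1)] ..
  finally show ?thesis unfolding \<phi>_def p'_def .
qed

lemma points_YE:
  assumes "y \<in> points Y" obtains x where "x \<in> params q (Suc k)" "y = \<pi> (pt q (Suc k) x)"
  using assms unfolding T.surj_\<pi>[symmetric] T.pts by blast

lemma points_Y'E: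
  assumes "y \<in> points Y'" obtains x where "x \<in> params q k" "y = \<pi>' (pt q k x)"
  using assms unfolding B.surj_\<pi>[symmetric] B.pts by blast

lemma morphism_\<phi>: "morphism Y Y' \<phi>"
proof -
  have eq: "{p \<in> points T.X. \<pi> p \<in> points Y} = points T.X"
    using morphism_points[OF T.morphism_\<pi>] by blast
  have c: "morphism T.X Y' (\<lambda>p. \<pi>' (forget p))"
    by (rule morphism_compose[OF T.swX morphism_forget B.morphism_\<pi>])
  have "morphism (subspace Y (points Y)) Y' \<phi>"
    by (rule T.descend_morphism[OF _ B.swY morphism_restrict[OF T.swX c]]) (auto simp: \<phi>_\<pi>)
  then show ?thesis
    by (intro morphism_local[OF T.swY] exI[of _ "points Y"]) auto
qed

text \<open>\<open>D\<close>, \<open>U\<close> and \<open>V\<close> are the chart for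
  \<open>c\<close> in three places: in the semistable locus of the base, in the base quotient, and
  pulled back to the total quotient.\<close>

definition D :: "(nat \<Rightarrow> nat) \<Rightarrow> (nat set \<Rightarrow> complex) set set" where
  "D c = pt q k ` chart q k c"

definition U :: "(nat \<Rightarrow> nat) \<Rightarrow> 'b set" where
  "U c = \<pi>' ` D c"

definition V :: "(nat \<Rightarrow> nat) \<Rightarrow> 'a set" where
  "V c = {y \<in> points Y. \<phi> y \<in> U c}"

lemma pt_in_D: "x \<in> params q k \<Longrightarrow> pt q k x \<in> D c \<longleftrightarrow> x \<in> chart q k c"
proof
  assume x: "x \<in> params q k" and "pt q k x \<in> D c"
  then obtain y where y: "y \<in> chart q k c" "pt q k x = pt q k y" unfolding D_def by blast
  then have "y \<in> params q k" by (simp add: chart_def)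
  then have "x = y" using arg_cong[OF y(2), of "coord q k"] unfolding B.cpt[OF x] by (simp add: B.cpt)
  then show "x \<in> chart q k c" using y(1) by simp
qed (simp add: D_def)

lemma D_open: "openin (ztop B.X) (D c)" "B.saturated (D c)"
proof -
  let ?F = "\<lambda>p. \<Prod>j<k. coord q k p j (c j)"
  have "reg B.X (points B.X) ?F" by (intro reg_prod[OF B.swX] reg_coord[OF B.q B.k]) simp
  moreover have "{p \<in> points B.X. ?F p \<noteq> 0} = D c"
  proof (intro equalityI subsetI)
    fix p assume p: "p \<in> {p \<in> points B.X. ?F p \<noteq> 0}"
    then have "p \<in> points B.X" by simp
    then obtain x where x: "x \<in> params q k" "p = pt q k x" unfolding B.pts by (elim imageE)
    have "?F p \<noteq> 0" using p by simp
    then have "(\<Prod>j<k. x j (c j)) \<noteq> 0" unfolding x(2) B.cpt[OF x(1)] .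
    then have "x \<in> chart q k c" using x(1) by (simp add: chart_def)
    then show "p \<in> D c" unfolding D_def x(2) by (rule imageI)
  next
    fix p assume "p \<in> D c"
    then obtain x where x: "x \<in> chart q k c" "p = pt q k x" unfolding D_def by blast
    then have xp: "x \<in> params q k" by (simp add: chart_def)
    have "?F p \<noteq> 0" unfolding x(2) B.cpt[OF xp] using x(1) by (simp add: chart_def)
    moreover have "p \<in> points B.X" unfolding x(2) B.pts by (rule imageI[OF xp])
    ultimately show "p \<in> {p \<in> points B.X. ?F p \<noteq> 0}" by simp
  qed
  ultimately show "openin (ztop B.X) (D c)" using openin_nonzero[OF B.swX, of "points B.X" ?F] by simp
  show "B.saturated (D c)" unfolding B.saturated_def
  proof (intro ballI allI impI)
    fix x and u :: "nat \<Rightarrow> complex" assume x: "x \<in> params q k" and u: "\<forall>b. u b \<noteq> 0" and "pt q k x \<in> D c"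
    then have "x \<in> chart q k c" using pt_in_D by blast
    then have "torus_act q u x \<in> chart q k c" by (rule chart_torus_act) (use u in blast)
    then show "pt q k (torus_act q u x) \<in> D c" unfolding D_def by (rule imageI)
  qed
qed

lemma U_open: "openin (ztop Y') (U c)"
  unfolding U_def by (rule B.open_image(1)[OF D_open])

lemma \<pi>'_in_U: "x \<in> params q k \<Longrightarrow> \<pi>' (pt q k x) \<in> U c \<longleftrightarrow> x \<in> chart q k c"
proof -
  assume x: "x \<in> params q k"
  then have "pt q k x \<in> points B.X" unfolding B.pts by (rule imageI)
  then have "\<pi>' (pt q k x) \<in> U c \<longleftrightarrow> pt q k x \<in> {p \<in> points B.X. \<pi>' p \<in> \<pi>' ` D c}" by (simp add: U_def)
  also have "\<dots> \<longleftrightarrow> x \<in> chart q k c" unfolding B.open_image(2)[OF D_open] by (rule pt_in_D[OF x])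
  finally show ?thesis .
qed

lemma preimage_U: "{p \<in> points B.X. \<pi>' p \<in> U c} = D c"
  unfolding U_def by (rule B.open_image(2)[OF D_open])

lemma V_open: "openin (ztop Y) (V c)"
  unfolding V_def by (rule morphism_openin[OF morphism_\<phi> U_open])

lemma \<phi>_pt: "x \<in> params q (Suc k) \<Longrightarrow> \<phi> (\<pi> (pt q (Suc k) x)) = \<pi>' (pt q k (trunc x))"
  using \<phi>_\<pi>[OF pt_points] forget_pt by simp

lemma \<pi>_in_V: "x \<in> params q (Suc k) \<Longrightarrow> \<pi> (pt q (Suc k) x) \<in> V c \<longleftrightarrow> trunc x \<in> chart q k c"
  unfolding V_def using \<pi>'_in_U[OF trunc_params] morphism_points[OF T.morphism_\<pi> pt_points] by (simp add: \<phi>_pt)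

lemma weight_fun_trunc: "b \<le> k \<Longrightarrow> weight_fun q c (trunc x) b = weight_fun q c x b"
  by (rule weight_fun_cong) (simp add: trunc_def)

definition m :: nat where "m = Suc k * (q - 1)"

text \<open>An arbitrary numbering of the free rows of the last column by the homogeneous
  coordinates of the fibre.\<close>

definition e :: "nat \<Rightarrow> nat" where "e = (SOME e. bij_betw e {..m} (row_supp q k))"

lemma e: "bij_betw e {..m} (row_supp q k)"
proof -
  have "card {..m} = card (row_supp q k)" using card_row_supp(2)[OF B.q] by (simp add: m_def)
  then have "\<exists>e. bij_betw e {..m} (row_supp q k)"
    using finite_same_card_bij[OF finite_atMost card_row_supp(1)[OF B.q]] by blast
  then show ?thesis unfolding e_def by (rule someI_ex)
qed

lemma e_supp: "b \<le> m \<Longrightarrow> e b \<in> row_supp q k"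
  using e by (auto simp: bij_betw_def)

lemma e_block: "b \<le> m \<Longrightarrow> e b div q \<le> k"
  using row_supp_block[OF B.q e_supp] .

definition inv_e :: "nat \<Rightarrow> nat" where "inv_e = the_inv_into {..m} e"

lemma inv_e: "i \<in> row_supp q k \<Longrightarrow> inv_e i \<le> m \<and> e (inv_e i) = i" "b \<le> m \<Longrightarrow> inv_e (e b) = b"
proof -
  have inj: "inj_on e {..m}" and im: "e ` {..m} = row_supp q k" using e by (auto simp: bij_betw_def)
  show "inv_e i \<le> m \<and> e (inv_e i) = i" if "i \<in> row_supp q k"
    using the_inv_into_into[OF inj, of i "{..m}"] f_the_inv_into_f[OF inj, of i] that im
    by (simp add: inv_e_def)
  show "inv_e (e b) = b" if "b \<le> m" using the_inv_into_f_f[OF inj, of b] that by (simp add: inv_e_def)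
qed

text \<open>The entry in row \<open>e b\<close> has weight \<open>u (e b div q) / u (Suc k)\<close>;
  the monomial in front has weight \<open>u 0 / u (e b div q)\<close>, so all coordinates transform
  by the same scalar and the line is well defined on \<open>Y\<close>.\<close>

definition fibre_vec :: "(nat \<Rightarrow> nat) \<Rightarrow> (nat \<Rightarrow> nat \<Rightarrow> complex) \<Rightarrow> nat \<Rightarrow> complex" where
  "fibre_vec c x b = (if b \<le> m then weight_fun q c x (e b div q) * x k (e b) else 0)"

definition \<kappa> :: "(nat \<Rightarrow> nat) \<Rightarrow> 'a \<Rightarrow> (nat \<Rightarrow> complex) set" where
  "\<kappa> c y = line (fibre_vec c (coord q (Suc k) (SOME p. p \<in> points T.X \<and> \<pi> p = y)))"

lemma fibre_vec_torus_act:
  assumes "\<And>b. u b \<noteq> 0"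
  shows "fibre_vec c (torus_act q u x) = (\<lambda>b. u 0 / u (Suc k) * fibre_vec c x b)"
proof
  fix b
  have "u (e b div q) \<noteq> 0" by (rule assms)
  moreover have "torus_act q u x k (e b) = u (e b div q) / u (Suc k) * x k (e b)" by (simp add: torus_act_def)
  ultimately show "fibre_vec c (torus_act q u x) b = u 0 / u (Suc k) * fibre_vec c x b"
    unfolding fibre_vec_def weight_fun_torus_act[OF assms] by simp
qed

lemma fibre_vec_nonzero:
  assumes c: "row_choice q k c" and x: "x \<in> params q (Suc k)" "trunc x \<in> chart q k c"
  shows "line (fibre_vec c x) \<in> proj_points {..m}"
proof -
  obtain i where i: "x k i \<noteq> 0" using x(1) unfolding params_def by blast
  then have ir: "i \<in> row_supp q k" using x(1) unfolding params_def by blast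
  define b where "b = inv_e i"
  have b: "b \<le> m" "e b = i" using inv_e(1)[OF ir] by (auto simp: b_def)
  have "weight_fun q c (trunc x) (e b div q) \<noteq> 0"
    by (rule chart_weight_nonzero[OF B.q c x(2) e_block[OF b(1)]])
  then have "fibre_vec c x b \<noteq> 0" using b i e_block[OF b(1)] by (simp add: fibre_vec_def weight_fun_trunc)
  moreover have "fibre_vec c x \<in> vectors {..m}" by (simp add: vectors_def fibre_vec_def)
  ultimately show ?thesis by (rule line_in_proj_points[rotated])
qed

lemma \<kappa>_pt:
  assumes x: "x \<in> params q (Suc k)"
  shows "\<kappa> c (\<pi> (pt q (Suc k) x)) = line (fibre_vec c x)"
proof -
  define p' where "p' = (SOME p'. p' \<in> points T.X \<and> \<pi> p' = \<pi> (pt q (Suc k) x))"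
  have p': "p' \<in> points T.X \<and> \<pi> p' = \<pi> (pt q (Suc k) x)"
    unfolding p'_def by (rule someI[of _ "pt q (Suc k) x"]) (use pt_points[OF x] in simp)
  obtain y where y: "y \<in> params q (Suc k)" "p' = pt q (Suc k) y" using conjunct1[OF p'] by (rule points_XE)
  have "\<pi> (pt q (Suc k) x) = \<pi> (pt q (Suc k) y)" using p' by (simp only: y(2))
  then obtain u where u: "\<forall>b. u b \<noteq> 0" "y = torus_act q u x" by (rule T.\<pi>_eqD[OF x y(1)])
  have "\<kappa> c (\<pi> (pt q (Suc k) x)) = line (fibre_vec c (coord q (Suc k) p'))" unfolding \<kappa>_def p'_def ..
  also have "\<dots> = line (fibre_vec c (torus_act q u x))" unfolding y(2) T.cpt[OF y(1)] unfolding u(2) ..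
  also have "\<dots> = line (\<lambda>b. u 0 / u (Suc k) * fibre_vec c x b)"
    using u(1) by (subst fibre_vec_torus_act) simp_all
  also have "\<dots> = line (fibre_vec c x)" using u(1) by (intro line_scale) simp
  finally show ?thesis .
qed

lemma preimage_V: "{p \<in> points T.X. \<pi> p \<in> V c} = pt q (Suc k) ` {x \<in> params q (Suc k). trunc x \<in> chart q k c}"
proof (intro equalityI subsetI)
  fix p assume p: "p \<in> {p \<in> points T.X. \<pi> p \<in> V c}"
  then have "p \<in> points T.X" by simp
  then obtain x where x: "x \<in> params q (Suc k)" "p = pt q (Suc k) x" by (rule points_XE)
  have "trunc x \<in> chart q k c" using p \<pi>_in_V[OF x(1), of c] unfolding x(2) by simp
  then show "p \<in> pt q (Suc k) ` {x \<in> params q (Suc k). trunc x \<in> chart q k c}"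
    unfolding x(2) using x(1) by (intro imageI) simp
next
  fix p assume "p \<in> pt q (Suc k) ` {x \<in> params q (Suc k). trunc x \<in> chart q k c}"
  then obtain x where "x \<in> params q (Suc k)" "trunc x \<in> chart q k c" "p = pt q (Suc k) x" by blast
  then show "p \<in> {p \<in> points T.X. \<pi> p \<in> V c}" using \<pi>_in_V pt_points by simp
qed

text \<open>The coordinates of \<open>fibre_vec\<close> are regular on the semistable locus but not
  invariant; it is the line that descends.\<close>

lemma morphism_\<kappa>:
  assumes c: "row_choice q k c"
  shows "morphism (subspace Y (V c)) (proj_space {..m}) (\<kappa> c)"
proof -
  let ?P = "{p \<in> points T.X. \<pi> p \<in> V c}"
  have oP: "openin (ztop T.X) ?P" by (rule morphism_openin[OF T.morphism_\<pi> V_open])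
  note swP = space_with_functions_subspace[OF T.swX, of ?P]
  have pP: "points (subspace T.X ?P) = ?P" unfolding points_subspace[OF T.swX] by blast
  have "morphism (subspace T.X ?P) (proj_space {..m}) (\<lambda>p. line (fibre_vec c (coord q (Suc k) p)))"
  proof (rule morphism_projI[OF swP], unfold pP)
    fix p assume "p \<in> ?P"
    then obtain x where x: "x \<in> params q (Suc k)" "trunc x \<in> chart q k c" "p = pt q (Suc k) x"
      unfolding preimage_V by blast
    show "line (fibre_vec c (coord q (Suc k) p)) \<in> proj_points {..m}"
      unfolding x(3) T.cpt[OF x(1)] by (rule fibre_vec_nonzero[OF c x(1,2)])
  next
    fix p assume p: "p \<in> ?P"
    let ?f = "\<lambda>b p. weight_fun q c (coord q (Suc k) p) (e b div q) * coord q (Suc k) p k (e b)"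
    have "reg T.X (points T.X) (?f b)" for b
      by (intro reg_mult[OF T.swX] reg_weight_fun[OF T.swX open_X] reg_coord[OF T.q T.k])
    then have "reg T.X ?P (?f b)" for b by (rule reg_subset[OF T.swX _ oP]) blast
    then have r: "reg (subspace T.X ?P) ?P (?f b)" for b unfolding reg_subspace_open[OF T.swX oP] by blast
    have "(\<lambda>b. if b \<in> {..m} then ?f b p else 0) = fibre_vec c (coord q (Suc k) p)" for p
      by (auto simp: fibre_vec_def fun_eq_iff)
    then have mem: "(\<lambda>b. if b \<in> {..m} then ?f b p else 0) \<in> line (fibre_vec c (coord q (Suc k) p))" for p
      by (simp only: line_self)
    then show "\<exists>Va ma. openin (ztop (subspace T.X ?P)) Va \<and> p \<in> Va \<and> (\<forall>i\<in>{..m}. reg (subspace T.X ?P) Va (ma i)) \<and>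
        (\<forall>y\<in>Va. (\<lambda>i. if i \<in> {..m} then ma i y else 0) \<in> line (fibre_vec c (coord q (Suc k) y)))"
      using p r reg_openin[OF swP r] mem
      by (intro exI[of _ ?P] exI[of _ ?f] conjI ballI)
  qed
  then show ?thesis
  proof (rule T.descend_morphism[OF V_open space_with_functions_proj])
    fix p assume "p \<in> points T.X"
    then obtain x where x: "x \<in> params q (Suc k)" "p = pt q (Suc k) x" by (rule points_XE)
    show "\<kappa> c (\<pi> p) = line (fibre_vec c (coord q (Suc k) p))"
      unfolding x(2) \<kappa>_pt[OF x(1)] T.cpt[OF x(1)] ..
  qed
qed

end

lemma sum_diagonal:
  fixes f g :: "nat \<Rightarrow> complex"
  assumes "i \<le> m" "j \<le> m"
  shows "(\<Sum>l\<le>m. (if i = l then f i else 0) * (if l = j then g l else 0)) = (if i = j then f i * g i else 0)"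
proof -
  have "(\<Sum>l\<le>m. (if i = l then f i else 0) * (if l = j then g l else 0)) =
      (\<Sum>l\<le>m. if l = i then (if i = j then f i * g i else 0) else 0)"
    by (rule sum.cong) auto
  then show ?thesis using assms by simp
qed

section \<open>Local sections and trivialisations\<close>

context torus_tower
begin

text \<open>The weights of the three factors cancel, so the expression is an invariant function on
  the chart. Its values are the entries of the torus translate in which all chosen entries are
  1.\<close>

lemma nu_exists:
  assumes c: "row_choice q k c" and j: "j < k"
  shows "\<exists>f. reg Y' (U c) f \<and> (\<forall>x\<in>chart q k c. f (\<pi>' (pt q k x)) =
    weight_fun q c x (i div q) * x j i / weight_fun q c x (Suc j))"
proof -
  let ?F = "\<lambda>p. weight_fun q c (coord q k p) (i div q) * coord q k p j i / weight_fun q c (coord q k p) (Suc j)"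
  have o: "openin (ztop B.X) (points B.X)" by simp
  have r: "reg B.X (points B.X) (\<lambda>p. coord q k p j i)" for j i by (rule reg_coord[OF B.q B.k])
  have "reg B.X (D c) ?F"
  proof (rule reg_divide[OF B.swX])
    have "reg B.X (points B.X) (\<lambda>p. weight_fun q c (coord q k p) (i div q) * coord q k p j i)"
      by (intro reg_mult[OF B.swX] reg_weight_fun[OF B.swX o] r)
    then show "reg B.X (D c) (\<lambda>p. weight_fun q c (coord q k p) (i div q) * coord q k p j i)"
      by (rule reg_subset[OF B.swX _ D_open(1) openin_subset[OF D_open(1)]])
    have "reg B.X (points B.X) (\<lambda>p. weight_fun q c (coord q k p) (Suc j))"
      by (intro reg_weight_fun[OF B.swX o] r)
    then show "reg B.X (D c) (\<lambda>p. weight_fun q c (coord q k p) (Suc j))"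
      by (rule reg_subset[OF B.swX _ D_open(1) openin_subset[OF D_open(1)]])
    fix p assume "p \<in> D c"
    then obtain x where x: "x \<in> chart q k c" "p = pt q k x" unfolding D_def by (elim imageE)
    then have "x \<in> params q k" by (simp add: chart_def)
    then show "weight_fun q c (coord q k p) (Suc j) \<noteq> 0"
      unfolding x(2) using chart_weight_nonzero[OF B.q c x(1), of "Suc j"] j by (simp add: B.cpt)
  qed
  then have "reg B.X {p \<in> points B.X. \<pi>' p \<in> U c} ?F" unfolding preimage_U .
  then have "\<exists>f. reg Y' (U c) f \<and> (\<forall>p\<in>points B.X. \<pi>' p \<in> U c \<longrightarrow> ?F p = f (\<pi>' p))"
  proof (rule B.descend_function[OF U_open])
    fix x and u :: "nat \<Rightarrow> complex" assume x: "x \<in> params q k" and u: "\<And>b. u b \<noteq> 0"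
    have "u (i div q) \<noteq> 0" "u (Suc j) \<noteq> 0" "u 0 \<noteq> 0" using u by blast+
    then show "?F (pt q k (torus_act q u x)) = ?F (pt q k x)"
      unfolding B.cpt[OF x] B.cpt[OF torus_act_params[OF x u]] weight_fun_torus_act[OF u]
      by (simp add: torus_act_def)
  qed
  then obtain f where f: "reg Y' (U c) f" "\<forall>p\<in>points B.X. \<pi>' p \<in> U c \<longrightarrow> ?F p = f (\<pi>' p)" by (elim exE conjE)
  have "f (\<pi>' (pt q k x)) = weight_fun q c x (i div q) * x j i / weight_fun q c x (Suc j)"
    if x: "x \<in> chart q k c" for x
  proof -
    have xp: "x \<in> params q k" using x by (simp add: chart_def)
    then have "pt q k x \<in> points B.X" unfolding B.pts by (rule imageI)
    then have "?F (pt q k x) = f (\<pi>' (pt q k x))" using f(2) \<pi>'_in_U[OF xp] x by simp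
    then show ?thesis unfolding B.cpt[OF xp] by (rule sym)
  qed
  with f(1) show ?thesis by blast
qed

definition nu :: "(nat \<Rightarrow> nat) \<Rightarrow> nat \<Rightarrow> nat \<Rightarrow> 'b \<Rightarrow> complex" where
  "nu c j i = (SOME f. reg Y' (U c) f \<and> (\<forall>x\<in>chart q k c. f (\<pi>' (pt q k x)) =
    weight_fun q c x (i div q) * x j i / weight_fun q c x (Suc j)))"

lemma nu:
  assumes "row_choice q k c" "j < k"
  shows "reg Y' (U c) (nu c j i)"
    "x \<in> chart q k c \<Longrightarrow> nu c j i (\<pi>' (pt q k x)) = weight_fun q c x (i div q) * x j i / weight_fun q c x (Suc j)"
  using someI_ex[OF nu_exists[OF assms, of i], folded nu_def] by auto

text \<open>Builds a parameter from its two coordinates: the normal form over \<open>z\<close> in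
  the first \<open>k\<close> columns, and \<open>w\<close> as the last column.\<close>

definition sec :: "(nat \<Rightarrow> nat) \<Rightarrow> (nat \<Rightarrow> complex) \<Rightarrow> 'b \<Rightarrow> nat \<Rightarrow> nat \<Rightarrow> complex" where
  "sec c w z = (\<lambda>j i. if j < k then nu c j i z
     else if j = k \<and> i \<in> row_supp q k then w (inv_e i) else 0)"

definition norm_weights :: "(nat \<Rightarrow> nat) \<Rightarrow> (nat \<Rightarrow> nat \<Rightarrow> complex) \<Rightarrow> nat \<Rightarrow> complex" where
  "norm_weights c x = (\<lambda>b. if b \<le> k then weight_fun q c x b else 1)"

lemma norm_weights_nonzero: "row_choice q k c \<Longrightarrow> x \<in> chart q k c \<Longrightarrow> norm_weights c x b \<noteq> 0"
  using chart_weight_nonzero[OF B.q] by (simp add: norm_weights_def)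

lemma nu_torus_act:
  assumes c: "row_choice q k c" and x: "x \<in> chart q k c" and j: "j < k"
  shows "nu c j i (\<pi>' (pt q k x)) = torus_act q (norm_weights c x) x j i"
proof -
  have "x \<in> params q k" using x by (simp add: chart_def)
  then show ?thesis
    unfolding nu(2)[OF c j x] norm_weights_def
    using normalised_is_torus_act[OF chart_weight_nonzero[OF B.q c x] B.q _ j] by simp
qed

lemma trunc_sec:
  assumes c: "row_choice q k c" and x: "x \<in> chart q k c"
  shows "trunc (sec c w (\<pi>' (pt q k x))) = torus_act q (norm_weights c x) x"
proof (intro ext)
  fix j i
  have "x \<in> params q k" using x by (simp add: chart_def)
  then have "x j i = 0" if "\<not> j < k" using that unfolding params_def by blast
  then show "trunc (sec c w (\<pi>' (pt q k x))) j i = torus_act q (norm_weights c x) x j i"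
    using nu_torus_act[OF c x, of j i] by (simp add: trunc_def sec_def torus_act_def)
qed

lemma sec_params:
  assumes c: "row_choice q k c" and x: "x \<in> chart q k c" and w: "b \<le> m" "w b \<noteq> 0"
  shows "sec c w (\<pi>' (pt q k x)) \<in> params q (Suc k)"
proof -
  let ?s = "sec c w (\<pi>' (pt q k x))"
  have xp: "x \<in> params q k" using x by (simp add: chart_def)
  have N: "trunc ?s \<in> params q k"
    unfolding trunc_sec[OF c x] by (rule torus_act_params[OF xp norm_weights_nonzero[OF c x]])
  have ts: "trunc ?s j i = ?s j i" if "j < k" for j i using that by (simp add: trunc_def)
  have 1: "?s j i = 0" if "\<not> (j < Suc k \<and> i \<in> row_supp q j)" for j i
  proof (cases "j < k")
    case True
    then have "trunc ?s j i = 0" using N that unfolding params_def by (simp add: less_SucI)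
    then show ?thesis using ts[OF True] by simp
  next
    case False then show ?thesis using that by (auto simp: sec_def)
  qed
  have 2: "\<exists>i. ?s j i \<noteq> 0" if "j < Suc k" for j
  proof (cases "j < k")
    case True
    then obtain i where "trunc ?s j i \<noteq> 0" using N unfolding params_def by blast
    then show ?thesis using ts[OF True] by (intro exI[of _ i]) simp
  next
    case False
    then have "j = k" using that by simp
    then have "?s j (e b) = w b" using e_supp[OF w(1)] inv_e(2)[OF w(1)] by (simp add: sec_def)
    then show ?thesis using w(2) by (intro exI[of _ "e b"]) simp
  qed
  show ?thesis unfolding params_def using 1 2 by simp
qed

text \<open>In normal form all weights up to block \<open>k\<close> are 1, so the last column is
  read off unchanged.\<close>

lemma sec_fibre_vec:
  assumes c: "row_choice q k c" and x: "x \<in> chart q k c" and w: "w \<in> vectors {..m}"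
  shows "fibre_vec c (sec c w (\<pi>' (pt q k x))) = w"
proof
  fix b
  let ?s = "sec c w (\<pi>' (pt q k x))"
  show "fibre_vec c ?s b = w b"
  proof (cases "b \<le> m")
    case False then show ?thesis using w by (simp add: fibre_vec_def vectors_def)
  next
    case True
    note eb = e_block[OF True]
    have "weight_fun q c ?s (e b div q) = weight_fun q c (trunc ?s) (e b div q)" using weight_fun_trunc[OF eb] by simp
    also have "\<dots> = 1"
      unfolding trunc_sec[OF c x] weight_fun_torus_act[OF norm_weights_nonzero[OF c x]]
      using eb norm_weights_nonzero[OF c x, of "e b div q"] by (simp add: norm_weights_def)
    finally show ?thesis
      using True e_supp[OF True] inv_e(2)[OF True] by (simp add: fibre_vec_def sec_def)
  qed
qed

lemma sec_scale:
  assumes c: "row_choice q k c" and x: "x \<in> chart q k c" and w: "b \<le> m" "w b \<noteq> 0" and t: "t \<noteq> 0"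
  shows "\<pi> (pt q (Suc k) (sec c (\<lambda>b. t * w b) (\<pi>' (pt q k x)))) = \<pi> (pt q (Suc k) (sec c w (\<pi>' (pt q k x))))"
proof -
  \<comment> \<open>Only the last torus factor is used: it scales the last column by
    \<open>t\<close> and fixes the others, as no free entry lies in block k + 1.\<close>
  define u where "u b = (if b = Suc k then 1 / t else 1)" for b
  let ?s = "sec c w (\<pi>' (pt q k x))"
  have sp: "?s \<in> params q (Suc k)" by (rule sec_params[where w = w and b = b, OF c x w])
  have "sec c (\<lambda>b. t * w b) (\<pi>' (pt q k x)) = torus_act q u ?s"
  proof (intro ext)
    fix j i
    show "sec c (\<lambda>b. t * w b) (\<pi>' (pt q k x)) j i = torus_act q u ?s j i"
    proof (cases "j < Suc k \<and> i \<in> row_supp q j")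
      case True
      then have "i div q \<le> j" using row_supp_block[OF B.q] by blast
      then show ?thesis using True t by (auto simp: sec_def torus_act_def u_def)
    next
      case False
      then have z: "?s j i = 0" using sp unfolding params_def by blast
      have "sec c (\<lambda>b. t * w b) (\<pi>' (pt q k x)) \<in> params q (Suc k)"
        by (rule sec_params[where w = "\<lambda>b. t * w b" and b = b, OF c x w(1)]) (use w t in simp)
      then have "sec c (\<lambda>b. t * w b) (\<pi>' (pt q k x)) j i = 0" using False unfolding params_def by blast
      then show ?thesis using z by (simp add: torus_act_def)
    qed
  qed
  then show ?thesis using T.\<pi>_torus_act[OF sp, of u] t by (simp add: u_def)
qed

definition h :: "(nat \<Rightarrow> nat) \<Rightarrow> 'a \<Rightarrow> 'b \<times> (nat \<Rightarrow> complex) set" where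
  "h c y = (\<phi> y, \<kappa> c y)"

definition g :: "(nat \<Rightarrow> nat) \<Rightarrow> 'b \<times> (nat \<Rightarrow> complex) set \<Rightarrow> 'a" where
  "g c p = \<pi> (pt q (Suc k) (sec c (SOME w. w \<in> snd p) (fst p)))"

abbreviation "P c \<equiv> prod_space (subspace Y' (U c)) (proj_space {..m})"

lemma points_U: "points (subspace Y' (U c)) = U c"
  unfolding points_subspace[OF B.swY] using openin_subset[OF U_open] by blast

lemma points_V: "points (subspace Y (V c)) = V c"
  unfolding points_subspace[OF T.swY] using openin_subset[OF V_open] by blast

lemmas swU = space_with_functions_subspace[OF B.swY]
lemmas swP = space_with_functions_prod[OF swU space_with_functions_proj]

lemma points_P: "points (P c) = U c \<times> proj_points {..m}"
  unfolding points_prod_space[OF swU space_with_functions_proj] points_U points_proj_space ..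

lemma U_chart: assumes "z \<in> U c" obtains x where "x \<in> chart q k c" "z = \<pi>' (pt q k x)"
  using assms unfolding U_def D_def by blast

lemma morphism_h:
  assumes c: "row_choice q k c"
  shows "morphism (subspace Y (V c)) (P c) (h c)"
proof -
  note swV = space_with_functions_subspace[OF T.swY, of "V c"]
  have "morphism (subspace Y (V c)) (subspace Y' (U c)) \<phi>"
  proof (rule morphism_into_subspace[OF swV morphism_restrict[OF T.swY morphism_\<phi>] _ B.swY])
    fix y assume "y \<in> points (subspace Y (V c))"
    then show "\<phi> y \<in> U c" unfolding points_V by (simp add: V_def)
  qed
  then have "morphism (subspace Y (V c)) (P c) (\<lambda>y. (\<phi> y, \<kappa> c y))"
    by (rule morphism_pair[OF swU space_with_functions_proj swV _ morphism_\<kappa>[OF c]])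
  then show ?thesis unfolding h_def[abs_def] .
qed

lemma g_normal_form:
  assumes c: "row_choice q k c" and p: "p \<in> points (P c)"
  obtains x w b where "x \<in> chart q k c" "fst p = \<pi>' (pt q k x)" "w = (SOME w. w \<in> snd p)" "w \<in> snd p"
    "w \<in> vectors {..m}" "b \<le> m" "w b \<noteq> 0"
    "g c p = \<pi> (pt q (Suc k) (sec c w (\<pi>' (pt q k x))))" "sec c w (\<pi>' (pt q k x)) \<in> params q (Suc k)"
proof -
  have z: "fst p \<in> U c" and L: "snd p \<in> proj_points {..m}" using p unfolding points_P by auto
  obtain x where x: "x \<in> chart q k c" "fst p = \<pi>' (pt q k x)" using z by (rule U_chart)
  define w where "w = (SOME w. w \<in> snd p)"
  have w: "w \<in> snd p" unfolding w_def by (rule proj_points_some[OF L])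
  obtain b where b: "b \<in> {..m}" "\<forall>v\<in>snd p. v b \<noteq> 0" by (rule proj_points_coord[OF L])
  have bm: "b \<le> m" using b by simp
  have wb: "w b \<noteq> 0" using b w by blast
  have gp: "g c p = \<pi> (pt q (Suc k) (sec c w (\<pi>' (pt q k x))))" by (simp only: g_def w_def x(2))
  from that[OF x w_def w proj_points_vector(1)[OF L w] bm wb gp sec_params[where w = w and b = b, OF c x(1) bm wb]]
  show thesis .
qed

lemma h_g:
  assumes c: "row_choice q k c" and p: "p \<in> points (P c)"
  shows "g c p \<in> V c" "h c (g c p) = p"
proof -
  obtain x w b where x: "x \<in> chart q k c" "fst p = \<pi>' (pt q k x)" and w: "w = (SOME w. w \<in> snd p)" "w \<in> snd p"
    "w \<in> vectors {..m}" "b \<le> m" "w b \<noteq> 0"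
    and gp: "g c p = \<pi> (pt q (Suc k) (sec c w (\<pi>' (pt q k x))))" and sp: "sec c w (\<pi>' (pt q k x)) \<in> params q (Suc k)"
    by (rule g_normal_form[OF c p])
  have xp: "x \<in> params q k" using x by (simp add: chart_def)
  have "trunc (sec c w (\<pi>' (pt q k x))) \<in> chart q k c"
    unfolding trunc_sec[OF c x(1)] by (rule chart_torus_act[OF x(1) norm_weights_nonzero[OF c x(1)]])
  then show "g c p \<in> V c" unfolding gp using \<pi>_in_V[OF sp] by blast
  have "\<phi> (g c p) = \<pi>' (pt q k (torus_act q (norm_weights c x) x))"
    unfolding gp \<phi>_pt[OF sp] trunc_sec[OF c x(1)] ..
  also have "\<dots> = fst p" unfolding x(2) by (rule B.\<pi>_torus_act[OF xp norm_weights_nonzero[OF c x(1)]])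
  finally have 1: "\<phi> (g c p) = fst p" .
  have L: "snd p \<in> proj_points {..m}" using p unfolding points_P by auto
  have "\<kappa> c (g c p) = line w" unfolding gp \<kappa>_pt[OF sp] sec_fibre_vec[OF c x(1) w(3)] ..
  also have "\<dots> = snd p" using proj_points_line[OF L w(2)] by simp
  finally show "h c (g c p) = p" using 1 by (simp add: h_def)
qed

text \<open>The normal form over the image of \<open>x\<close>, completed by the weighted last
  column, is the torus translate of \<open>x\<close> by its own weights. The chosen representative
  of the line differs from \<open>fibre_vec\<close> by a factor, which \<open>sec_scale\<close>
  removes.\<close>

lemma g_h:
  assumes c: "row_choice q k c" and y: "y \<in> V c"
  shows "g c (h c y) = y"
proof -
  have "y \<in> points Y" using y by (simp add: V_def)
  then obtain x where x: "x \<in> params q (Suc k)" "y = \<pi> (pt q (Suc k) x)" by (rule points_YE)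
  have tc: "trunc x \<in> chart q k c" using y \<pi>_in_V[OF x(1)] unfolding x(2) by blast
  have fz: "fst (h c y) = \<pi>' (pt q k (trunc x))" and sl: "snd (h c y) = line (fibre_vec c x)"
    unfolding h_def x(2) using \<phi>_pt[OF x(1)] \<kappa>_pt[OF x(1)] by simp_all
  define w where "w = (SOME w. w \<in> snd (h c y))"
  have "w \<in> line (fibre_vec c x)" unfolding w_def sl
    by (rule someI[of "\<lambda>w. w \<in> line (fibre_vec c x)", OF line_self])
  then obtain t where t: "t \<noteq> 0" "w = (\<lambda>b. t * fibre_vec c x b)" by (rule lineE)
  obtain b where b0: "b \<in> {..m}" "\<forall>v\<in>line (fibre_vec c x). v b \<noteq> 0"
    by (rule proj_points_coord[OF fibre_vec_nonzero[OF c x(1) tc]])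
  have b: "b \<le> m" "fibre_vec c x b \<noteq> 0"
    using b0(1) bspec[OF b0(2) line_self] by simp_all
  have "g c (h c y) = \<pi> (pt q (Suc k) (sec c (\<lambda>b. t * fibre_vec c x b) (\<pi>' (pt q k (trunc x)))))"
    unfolding g_def w_def[symmetric] fz unfolding t(2) ..
  also have "\<dots> = \<pi> (pt q (Suc k) (sec c (fibre_vec c x) (\<pi>' (pt q k (trunc x)))))"
    by (rule sec_scale[where w = "fibre_vec c x" and b = b, OF c tc b t(1)])
  also have "sec c (fibre_vec c x) (\<pi>' (pt q k (trunc x))) = torus_act q (norm_weights c (trunc x)) x"
  proof (intro ext)
    fix j i
    consider "j < k" | "j = k" "i \<in> row_supp q k" | "\<not> j < k" "\<not> (j = k \<and> i \<in> row_supp q k)" by blast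
    then show "sec c (fibre_vec c x) (\<pi>' (pt q k (trunc x))) j i = torus_act q (norm_weights c (trunc x)) x j i"
    proof cases
      case 1
      then show ?thesis
        using nu_torus_act[OF c tc 1, of i] by (simp add: sec_def torus_act_def trunc_def)
    next
      case 2
      have "i div q \<le> k" by (rule row_supp_block[OF B.q 2(2)])
      then show ?thesis using 2 inv_e(1)[OF 2(2)]
        by (simp add: sec_def torus_act_def norm_weights_def fibre_vec_def weight_fun_trunc)
    next
      case 3
      then have "\<not> (j < Suc k \<and> i \<in> row_supp q j)" by (auto simp: less_Suc_eq)
      then have "x j i = 0" using x(1) unfolding params_def by blast
      then show ?thesis using 3 by (auto simp: sec_def torus_act_def)
    qed
  qed
  also have "\<pi> (pt q (Suc k) \<dots>) = y"
    unfolding x(2) by (rule T.\<pi>_torus_act[OF x(1) norm_weights_nonzero[OF c tc]])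
  finally show ?thesis .
qed

text \<open>The representative taken by \<open>SOME\<close> in \<open>g\<close> need not vary
  regularly. Where the coordinate \<open>b0\<close> is nonzero it is replaced by the representative
  with that coordinate equal to 1, which is regular and has the same image by
  \<open>sec_scale\<close>.\<close>

lemma morphism_g:
  assumes c: "row_choice q k c"
  shows "morphism (P c) (subspace Y (V c)) (g c)"
proof -
  have "morphism (P c) Y (g c)"
  proof (rule morphism_local[OF swP])
    fix p0 assume p0: "p0 \<in> points (P c)"
    then have L0: "snd p0 \<in> proj_points {..m}" unfolding points_P by auto
    obtain b0 where b0: "b0 \<in> {..m}" "\<forall>v\<in>snd p0. v b0 \<noteq> 0" by (rule proj_points_coord[OF L0])
    let ?L = "{L \<in> proj_points {..m}. \<forall>v\<in>L. v b0 \<noteq> 0}"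
    have hb0: "homfun {..m} 1 (\<lambda>v. v b0)" by (rule homfun.coord[OF b0(1)])
    let ?G = "{p \<in> points (P c). snd p \<in> ?L}"
    note msnd = morphism_snd[OF swU space_with_functions_proj, of "U c" "{..m}"]
    note mfst = morphism_fst[OF swU space_with_functions_proj, of "U c" "{..m}"]
    have oG: "openin (ztop (P c)) ?G" by (rule morphism_openin[OF msnd openin_proj_nonzero[OF hb0]])
    note swG = space_with_functions_subspace[OF swP[of "U c" "{..m}"], of ?G]
    have pG: "points (subspace (P c) ?G) = ?G" unfolding points_subspace[OF swP] by blast
    define \<rho> where "\<rho> b L = (SOME v. v \<in> L) b / (SOME v. v \<in> L) b0" for b and L :: "(nat \<Rightarrow> complex) set"
    have r\<rho>: "reg (P c) ?G (\<lambda>p. \<rho> b (snd p))" if "b \<le> m" for b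
    proof -
      have hb: "homfun {..m} 1 (\<lambda>v. v b)" by (rule homfun.coord) (use that in simp)
      have "reg (proj_space {..m}) ?L (\<rho> b)"
        unfolding \<rho>_def by (rule reg_proj_quotient[OF hb hb0 proj_quotient[OF hb hb0]])
      from morphism_reg[OF msnd this] show ?thesis .
    qed
    have rnu: "reg (P c) ?G (\<lambda>p. nu c j i (fst p))" if "j < k" for j i
    proof -
      have "reg (subspace Y' (U c)) (U c) (nu c j i)"
        unfolding reg_subspace_open[OF B.swY U_open] using nu(1)[OF c that] by blast
      from morphism_reg[OF mfst this] have "reg (P c) {p \<in> points (P c). fst p \<in> U c} (\<lambda>p. nu c j i (fst p))" .
      then show ?thesis by (rule reg_subset[OF swP _ oG]) (auto simp: points_P)
    qed
    let ?\<xi> = "\<lambda>j i p. sec c (\<lambda>b. \<rho> b (snd p)) (fst p) j i"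
    have key: "(\<lambda>j i. ?\<xi> j i p) \<in> params q (Suc k) \<and> g c p = \<pi> (pt q (Suc k) (\<lambda>j i. ?\<xi> j i p))"
      if p: "p \<in> ?G" for p
    proof -
      have pP: "p \<in> points (P c)" using p by simp
      obtain x w b where x: "x \<in> chart q k c" "fst p = \<pi>' (pt q k x)" and w: "w = (SOME w. w \<in> snd p)" "w \<in> snd p"
        "w \<in> vectors {..m}" "b \<le> m" "w b \<noteq> 0"
        and gp: "g c p = \<pi> (pt q (Suc k) (sec c w (\<pi>' (pt q k x))))" and sp: "sec c w (\<pi>' (pt q k x)) \<in> params q (Suc k)"
        by (rule g_normal_form[OF c pP])
      have wb0: "w b0 \<noteq> 0" using p w(2) by blast
      have \<rho>w: "(\<lambda>b. \<rho> b (snd p)) = (\<lambda>b. (1 / w b0) * w b)" unfolding \<rho>_def w(1)[symmetric] by simp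
      have "(1 / w b0) * w b \<noteq> 0" using wb0 w(5) by simp
      then have "sec c (\<lambda>b. (1 / w b0) * w b) (\<pi>' (pt q k x)) \<in> params q (Suc k)"
        by (rule sec_params[where w = "\<lambda>b. (1 / w b0) * w b" and b = b, OF c x(1) w(4)])
      moreover have "\<pi> (pt q (Suc k) (sec c (\<lambda>b. (1 / w b0) * w b) (\<pi>' (pt q k x)))) = g c p"
        unfolding gp by (rule sec_scale[where w = w and b = b, OF c x(1) w(4,5)]) (use wb0 in simp)
      ultimately show ?thesis unfolding \<rho>w x(2) by simp
    qed
    have "morphism (subspace (P c) ?G) T.X (\<lambda>p. pt q (Suc k) (\<lambda>j i. ?\<xi> j i p))"
    proof (rule morphism_pt[OF T.q T.k refl swG], unfold pG)
      show "(\<lambda>j i. ?\<xi> j i p) \<in> params q (Suc k)" if "p \<in> ?G" for p using key[OF that] by (rule conjunct1)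
      fix j i
      consider "j < k" | "j = k" "i \<in> row_supp q k" | "\<not> j < k" "\<not> (j = k \<and> i \<in> row_supp q k)" by blast
      then have "reg (P c) ?G (?\<xi> j i)"
      proof cases
        case 1 then show ?thesis using rnu by (simp add: sec_def)
      next
        case 2 then show ?thesis using r\<rho>[of "inv_e i"] inv_e(1)[OF 2(2)] by (simp add: sec_def)
      next
        case 3
        then have "?\<xi> j i = (\<lambda>_. 0)" by (auto simp: sec_def fun_eq_iff)
        then show ?thesis using reg_const[OF swP oG, of 0] by (simp only:)
      qed
      then show "reg (subspace (P c) ?G) ?G (?\<xi> j i)" unfolding reg_subspace_open[OF swP oG] by blast
    qed
    then have "morphism (subspace (P c) ?G) Y (\<lambda>p. \<pi> (pt q (Suc k) (\<lambda>j i. ?\<xi> j i p)))"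
      by (rule morphism_compose[OF swG _ T.morphism_\<pi>])
    then have "morphism (subspace (P c) ?G) Y (g c)"
      by (rule morphism_cong[OF swG]) (use key pG in blast)
    moreover have "p0 \<in> ?G" using p0 L0 b0(2) by simp
    ultimately show "\<exists>V. openin (ztop (P c)) V \<and> p0 \<in> V \<and> morphism (subspace (P c) V) Y (g c)"
      using oG by (intro exI[of _ ?G] conjI)
  qed
  then show ?thesis by (rule morphism_into_subspace[OF swP _ h_g(1)[OF c] T.swY])
qed

lemma isomorphism_h:
  assumes c: "row_choice q k c"
  shows "isomorphism (subspace Y (V c)) (P c) (h c)"
  unfolding isomorphism_def
  using morphism_h[OF c] morphism_g[OF c] g_h[OF c] h_g(2)[OF c] points_V by (intro conjI exI[of _ "g c"]) auto

text \<open>At block \<open>b\<close> the monomials of both choices have the weight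
  \<open>u 0 / u b\<close>, so their quotient is invariant and descends.\<close>

lemma weight_ratio:
  assumes c: "row_choice q k c" and d: "row_choice q k d" and O: "openin (ztop Y') S" "S \<subseteq> U c \<inter> U d" and b: "b \<le> k"
  shows "\<exists>f. reg Y' S f \<and> (\<forall>x\<in>params q k. \<pi>' (pt q k x) \<in> S \<longrightarrow>
    f (\<pi>' (pt q k x)) = weight_fun q c x b / weight_fun q d x b)"
proof -
  let ?F = "\<lambda>p. weight_fun q c (coord q k p) b / weight_fun q d (coord q k p) b"
  let ?S = "{p \<in> points B.X. \<pi>' p \<in> S}"
  have o: "openin (ztop B.X) (points B.X)" by simp
  have oS: "openin (ztop B.X) ?S" by (rule morphism_openin[OF B.morphism_\<pi> O(1)])
  have r: "reg B.X ?S (\<lambda>p. weight_fun q c (coord q k p) b)" for c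
    by (rule reg_subset[OF B.swX _ oS]) (auto intro!: reg_weight_fun[OF B.swX o] reg_coord[OF B.q B.k])
  have "reg B.X ?S ?F"
  proof (rule reg_divide[OF B.swX r r])
    fix p assume p: "p \<in> ?S"
    then have "p \<in> points B.X" by simp
    then obtain x where x: "x \<in> params q k" "p = pt q k x" unfolding B.pts by (elim imageE)
    have "\<pi>' (pt q k x) \<in> U d" using p O(2) unfolding x(2) by blast
    then have "x \<in> chart q k d" using \<pi>'_in_U[OF x(1)] by blast
    from chart_weight_nonzero[OF B.q d this b]
    show "weight_fun q d (coord q k p) b \<noteq> 0" unfolding x(2) B.cpt[OF x(1)] .
  qed
  then have "\<exists>f. reg Y' S f \<and> (\<forall>p\<in>points B.X. \<pi>' p \<in> S \<longrightarrow> ?F p = f (\<pi>' p))"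
  proof (rule B.descend_function[OF O(1)])
    fix x and u :: "nat \<Rightarrow> complex" assume x: "x \<in> params q k" and u: "\<And>b. u b \<noteq> 0"
    have "u b \<noteq> 0" "u 0 \<noteq> 0" using u by blast+
    then show "?F (pt q k (torus_act q u x)) = ?F (pt q k x)"
      unfolding B.cpt[OF x] B.cpt[OF torus_act_params[OF x u]] weight_fun_torus_act[OF u] by simp
  qed
  then obtain f where f: "reg Y' S f" "\<forall>p\<in>points B.X. \<pi>' p \<in> S \<longrightarrow> ?F p = f (\<pi>' p)" by (elim exE conjE)
  have "f (\<pi>' (pt q k x)) = weight_fun q c x b / weight_fun q d x b"
    if x: "x \<in> params q k" "\<pi>' (pt q k x) \<in> S" for x
  proof -
    have "pt q k x \<in> points B.X" unfolding B.pts by (rule imageI[OF x(1)])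
    then have "?F (pt q k x) = f (\<pi>' (pt q k x))" using f(2) x(2) by simp
    then show ?thesis unfolding B.cpt[OF x(1)] by (rule sym)
  qed
  with f(1) show ?thesis by blast
qed

text \<open>The fibre vectors of two choices differ entrywise by quotients of weights, so the
  transition matrix is diagonal; its inverse is obtained by exchanging the two choices.\<close>

lemma transition:
  assumes c: "row_choice q k c" and d: "row_choice q k d" and S: "openin (ztop Y') S" "S \<subseteq> U c \<inter> U d"
  shows "\<exists>a. invertible_over Y' S m a \<and> (\<forall>y\<in>points Y. \<phi> y \<in> S \<longrightarrow> (\<forall>v\<in>snd (h d y).
    (\<lambda>i. if i \<le> m then \<Sum>j\<le>m. a i j (\<phi> y) * v j else 0) \<in> snd (h c y)))"
proof -
  have "\<forall>b. \<exists>f. b \<le> k \<longrightarrow> reg Y' S f \<and> (\<forall>x\<in>params q k. \<pi>' (pt q k x) \<in> S \<longrightarrow>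
    f (\<pi>' (pt q k x)) = weight_fun q c x b / weight_fun q d x b)"
    using weight_ratio[OF c d S] by metis
  from choice[OF this] obtain f where f: "\<And>b. b \<le> k \<Longrightarrow> reg Y' S (f b)"
    "\<And>b x. b \<le> k \<Longrightarrow> x \<in> params q k \<Longrightarrow> \<pi>' (pt q k x) \<in> S \<Longrightarrow>
      f b (\<pi>' (pt q k x)) = weight_fun q c x b / weight_fun q d x b" by auto
  have S': "S \<subseteq> U d \<inter> U c" using S(2) by blast
  have "\<forall>b. \<exists>f. b \<le> k \<longrightarrow> reg Y' S f \<and> (\<forall>x\<in>params q k. \<pi>' (pt q k x) \<in> S \<longrightarrow>
    f (\<pi>' (pt q k x)) = weight_fun q d x b / weight_fun q c x b)"
    using weight_ratio[OF d c S(1) S'] by metis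
  from choice[OF this] obtain f' where f': "\<And>b. b \<le> k \<Longrightarrow> reg Y' S (f' b)"
    "\<And>b x. b \<le> k \<Longrightarrow> x \<in> params q k \<Longrightarrow> \<pi>' (pt q k x) \<in> S \<Longrightarrow>
      f' b (\<pi>' (pt q k x)) = weight_fun q d x b / weight_fun q c x b" by auto
  \<comment> \<open>The diagonal entry depends only on the block of the row numbered by
    \<open>i\<close>.\<close>
  define a where "a i j z = (if i = j then f (e i div q) z else 0)" for i j z
  define a' where "a' i j z = (if i = j then f' (e i div q) z else 0)" for i j z
  have charts: "x \<in> chart q k c \<and> x \<in> chart q k d" if "x \<in> params q k" "\<pi>' (pt q k x) \<in> S" for x
    using \<pi>'_in_U[OF that(1)] that(2) S(2) by blast
  have inv: "f b z * f' b z = 1" if z: "z \<in> S" and b: "b \<le> k" for z b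
  proof -
    have "z \<in> points Y'" using z openin_subset[OF S(1)] by blast
    then obtain x where x: "x \<in> params q k" "z = \<pi>' (pt q k x)" by (rule points_Y'E)
    have xS: "\<pi>' (pt q k x) \<in> S" using z x(2) by simp
    have "weight_fun q c x b \<noteq> 0" "weight_fun q d x b \<noteq> 0"
      using chart_weight_nonzero[OF B.q c _ b, of x] chart_weight_nonzero[OF B.q d _ b, of x] charts[OF x(1) xS] by blast+
    then show ?thesis unfolding x(2) f(2)[OF b x(1) xS] f'(2)[OF b x(1) xS] by simp
  qed
  have "invertible_over Y' S m a"
    unfolding invertible_over_def
  proof (intro conjI exI[of _ a'] allI impI ballI)
    fix i j assume ij: "i \<le> m" "j \<le> m"
    show "reg Y' S (a i j)"
      using f(1)[OF e_block[OF ij(1)]] reg_const[OF B.swY S(1)] by (cases "i = j") (simp_all add: a_def[abs_def])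
    show "reg Y' S (a' i j)"
      using f'(1)[OF e_block[OF ij(1)]] reg_const[OF B.swY S(1)] by (cases "i = j") (simp_all add: a'_def[abs_def])
    fix z assume z: "z \<in> S"
    note one = inv[OF z e_block[OF ij(1)]]
    then have one': "f' (e i div q) z * f (e i div q) z = 1" by (simp only: mult.commute)
    show "(\<Sum>l\<le>m. a i l z * a' l j z) = (if i = j then 1 else 0)"
      unfolding a_def a'_def using sum_diagonal[OF ij, of "\<lambda>i. f (e i div q) z" "\<lambda>i. f' (e i div q) z"] one
      by (cases "i = j") simp_all
    show "(\<Sum>l\<le>m. a' i l z * a l j z) = (if i = j then 1 else 0)"
      unfolding a_def a'_def using sum_diagonal[OF ij, of "\<lambda>i. f' (e i div q) z" "\<lambda>i. f (e i div q) z"] one'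
      by (cases "i = j") simp_all
  qed
  moreover have "(\<lambda>i. if i \<le> m then \<Sum>j\<le>m. a i j (\<phi> y) * v j else 0) \<in> snd (h c y)"
    if y: "y \<in> points Y" "\<phi> y \<in> S" and v: "v \<in> snd (h d y)" for y v
  proof -
    obtain x where x: "x \<in> params q (Suc k)" "y = \<pi> (pt q (Suc k) x)" using y(1) by (rule points_YE)
    have py: "\<phi> y = \<pi>' (pt q k (trunc x))" unfolding x(2) by (rule \<phi>_pt[OF x(1)])
    have tS: "\<pi>' (pt q k (trunc x)) \<in> S" using y(2) unfolding py .
    note tp = trunc_params[OF x(1)]
    have "v \<in> line (fibre_vec d x)" using v unfolding h_def x(2) snd_conv \<kappa>_pt[OF x(1)] .
    then obtain t where t: "t \<noteq> 0" "v = (\<lambda>b. t * fibre_vec d x b)" by (rule lineE)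
    have "(\<lambda>i. if i \<le> m then \<Sum>j\<le>m. a i j (\<phi> y) * v j else 0) = (\<lambda>i. t * fibre_vec c x i)"
    proof
      fix i
      show "(if i \<le> m then \<Sum>j\<le>m. a i j (\<phi> y) * v j else 0) = t * fibre_vec c x i"
      proof (cases "i \<le> m")
        case False then show ?thesis by (simp add: fibre_vec_def)
      next
        case True
        note eb = e_block[OF True]
        have "(\<Sum>j\<le>m. a i j (\<phi> y) * v j) = (\<Sum>j\<le>m. if j = i then f (e i div q) (\<phi> y) * v i else 0)"
          by (rule sum.cong) (auto simp: a_def)
        also have "\<dots> = f (e i div q) (\<phi> y) * v i" using True by simp
        also have "f (e i div q) (\<phi> y) = weight_fun q c x (e i div q) / weight_fun q d x (e i div q)"
          unfolding py f(2)[OF eb tp tS] weight_fun_trunc[OF eb] ..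
        also have "\<dots> * v i = t * fibre_vec c x i"
        proof -
          have "weight_fun q d (trunc x) (e i div q) \<noteq> 0"
            using chart_weight_nonzero[OF B.q d _ eb] charts[OF tp tS] by blast
          then show ?thesis using True by (simp add: t(2) fibre_vec_def weight_fun_trunc[OF eb])
        qed
        finally show ?thesis using True by simp
      qed
    qed
    then show ?thesis unfolding h_def x(2) snd_conv \<kappa>_pt[OF x(1)] using lineI[OF t(1)] by simp
  qed
  ultimately show ?thesis by blast
qed

lemma projective_bundle_\<phi>: "projective_bundle m Y Y' \<phi>"
  unfolding projective_bundle_def
proof (intro conjI morphism_\<phi> exI[of _ "{(U c, h c) | c. row_choice q k c}"])
  let ?T = "{(U c, h c) | c. row_choice q k c}"
  show "\<forall>(G, f)\<in>?T. openin (ztop Y') G \<and>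
      isomorphism (subspace Y {y \<in> points Y. \<phi> y \<in> G}) (prod_space (subspace Y' G) (proj_space {..m})) f \<and>
      (\<forall>y\<in>points Y. \<phi> y \<in> G \<longrightarrow> fst (f y) = \<phi> y)"
  proof (clarify, intro conjI ballI impI)
    fix c assume c: "row_choice q k c"
    show "openin (ztop Y') (U c)" by (rule U_open)
    show "isomorphism (subspace Y {y \<in> points Y. \<phi> y \<in> U c}) (P c) (h c)"
      unfolding V_def[symmetric] by (rule isomorphism_h[OF c])
    show "fst (h c y) = \<phi> y" for y by (simp add: h_def)
  qed
  show "\<Union> (fst ` ?T) = points Y'"
  proof (intro equalityI subsetI)
    fix z assume "z \<in> \<Union> (fst ` ?T)"
    then show "z \<in> points Y'" using openin_subset[OF U_open] by auto
  next
    fix z assume "z \<in> points Y'"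
    then obtain x where x: "x \<in> params q k" "z = \<pi>' (pt q k x)" by (rule points_Y'E)
    obtain c where c: "row_choice q k c" "x \<in> chart q k c" by (rule params_in_chart[OF x(1)])
    then have "z \<in> U c" unfolding x(2) using \<pi>'_in_U[OF x(1)] by blast
    then show "z \<in> \<Union> (fst ` ?T)" using c(1) by force
  qed
  show "\<forall>(G, f)\<in>?T. \<forall>(G', f')\<in>?T. \<forall>S. affine_open Y' S \<and> S \<subseteq> G \<inter> G' \<longrightarrow>
      (\<exists>a. invertible_over Y' S m a \<and> (\<forall>y\<in>points Y. \<phi> y \<in> S \<longrightarrow> (\<forall>v\<in>snd (f' y).
        (\<lambda>i. if i \<le> m then \<Sum>j\<le>m. a i j (\<phi> y) * v j else 0) \<in> snd (f y))))"
  proof (clarify)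
    fix c d S assume "row_choice q k c" "row_choice q k d" "affine_open Y' S" "S \<subseteq> U c \<inter> U d"
    then show "\<exists>a. invertible_over Y' S m a \<and> (\<forall>y\<in>points Y. \<phi> y \<in> S \<longrightarrow> (\<forall>v\<in>snd (h d y).
        (\<lambda>i. if i \<le> m then \<Sum>j\<le>m. a i j (\<phi> y) * v j else 0) \<in> snd (h c y)))"
      by (intro transition) (simp_all add: affine_open_def)
  qed
qed

end

theorem theorem1p1:
  fixes r q :: nat
    and Y :: "'a fspace"
    and Y' :: "'b fspace"
  assumes "r \<ge> 2" and "q \<ge> 2"
    and "is_Y q r Y"
    and "is_Y q (r - 1) Y'"
  shows "\<exists>\<phi>. projective_bundle (r * (q - 1)) Y Y' \<phi>"
proof -
  define k where "k = r - 1"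
  have r: "r = Suc k" and k: "k \<ge> 1" using assms(1) by (simp_all add: k_def)
  have q: "q \<ge> 1" using assms(2) by simp
  obtain \<pi> where \<pi>: "good_quotient (T_J q r) (psl_act (r * q + 1) r) (ss_space q r) Y \<pi>"
    using assms(3) unfolding is_Y_def ss_space_def by blast
  obtain \<pi>' where \<pi>': "good_quotient (T_J q k) (psl_act (k * q + 1) k) (ss_space q k) Y' \<pi>'"
    using assms(4) unfolding is_Y_def ss_space_def k_def by blast
  interpret B: torus_quotient q k Y' \<pi>' using q k \<pi>' by unfold_locales
  interpret T: torus_quotient q "Suc k" Y \<pi> using q \<pi> unfolding r by unfold_locales simp_all
  interpret torus_tower q k Y' \<pi>' Y \<pi> ..
  show ?thesis using projective_bundle_\<phi> unfolding m_def r by blast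
qed

end
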